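(* Let $c\in\mathbb{C}$, $\ell\in\mathbb{Z}_{>0}$, $V=(Vir^c)^{\otimes\ell}$, and let $G$ be any subgroup of $S_\ell$, acting on $V$ by permuting tensor factors. Assume that $\Psi_i:Vir^+\to\mathbb{C}$, $i=1,\dots,\ell$, are Whittaker functions such that $$\Psi_i(L(1))=a_i,\quad \Psi_i(L(2))=b_i,\quad \Psi_i(L(n))=0\quad(n\ge3).$$ Assume that for each $g\in G$, $g\neq1$, $$(a_{g(1)},\dots,a_{g(\ell)})\ne(a_1,\dots,a_\ell)\quad\text{or}\quad(b_{g(1)},\dots,b_{g(\ell)})\neq(b_1,\dots,b_\ell).$$ Then $$\mathrm{Wh}(\Psi_1,\dots,\Psi_\ell):=\mathrm{Wh}_c(\Psi_1)\otimes\cdots\otimes\mathrm{Wh}_c(\Psi_\ell)$$ is an irreducible $V^G$-module.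
   Context: $Vir$ is the Virasoro Lie algebra with generators $L(n)$ ($n\in\mathbb{Z}$) and central element $C$; $Vir^c$ is the universal Virasoro vertex operator algebra of central charge $c$; $Vir^+$ is the Lie subalgebra of $Vir$ generated by $L(n)$, $n\in\mathbb{Z}_{>0}$. A Whittaker function is a Lie algebra homomorphism $\Psi:Vir^+\to\mathbb{C}$. The universal Whittaker module of central charge $c$ is $\mathrm{Wh}_c(\Psi)=U(Vir)\otimes_{U(Vir^+\oplus\mathbb{C}C)}\mathbb{C}w$ with $xw=\Psi(x)w$ for $x\in Vir^+$ and $Cw=cw$; it is a restricted $Vir$-module of central charge $c$ and hence a weak $Vir^c$-module. The tensor product of $\ell$ such modules is a weak module for $V=(Vir^c)^{\otimes\ell}$. $V^G$ is the subalgebra of $G$-fixed points of $V$. Irreducible as a $V^G$-module means nonzero with no nonzero proper subspace stable under all modes $v_n$, $v\in V^G$.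
   Formalization: The formal theorem additionally assumes that every Whittaker function Ψ_i is nonzero, i.e. (a_i,b_i) ≠ (0,0); if some Ψ_i = 0, then Wh_c(Ψ_i) is reducible (L(0)w generates a proper submodule) and the conclusion fails. *)

theory Defs
  imports Complex_Main "HOL-Library.Poly_Mapping" "HOL-Algebra.Bij" "HOL-Algebra.AbelCoset"
    "HOL-Algebra.Module"
begin

section \<open>Complex vector spaces\<close>

text \<open>
  Complex vector spaces that depend on parameters are modules, in the sense of HOL-Algebra, over the
  ring of complex numbers. Only the additive fields and \<open>smult\<close> of such a record are relevant.
\<close>

definition complex_field :: "complex ring" where
  "complex_field = \<lparr>carrier = UNIV, mult = (*), one = 1, zero = 0, add = (+)\<rparr>"

definition quot_module :: "(complex, 'a) module \<Rightarrow> 'a set \<Rightarrow> (complex, 'a set) module" where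
  "quot_module M N = \<lparr>carrier = a_rcosets\<^bsub>M\<^esub> N, mult = undefined, one = undefined,
     zero = N, add = set_add M, smult = (\<lambda>a A. \<Union>x\<in>A. N +>\<^bsub>M\<^esub> (a \<odot>\<^bsub>M\<^esub> x))\<rparr>"

definition pm_scale :: "complex \<Rightarrow> ('x \<Rightarrow>\<^sub>0 complex) \<Rightarrow> ('x \<Rightarrow>\<^sub>0 complex)" where
  "pm_scale a f = Poly_Mapping.map ((*) a) f"

definition free_module :: "'x set \<Rightarrow> (complex, 'x \<Rightarrow>\<^sub>0 complex) module" where
  "free_module S = \<lparr>carrier = {f. Poly_Mapping.keys f \<subseteq> S}, mult = undefined, one = undefined,
     zero = 0, add = (+), smult = pm_scale\<rparr>"

text \<open>
  The tensor product of a finite family of vector spaces: the free vector space on the families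
  \<open>X\<close> with \<open>X i \<in> M i\<close> (standing for pure tensors), modulo the multilinearity relations.
\<close>

definition families :: "('n \<Rightarrow> (complex, 'a) module) \<Rightarrow> ('n \<Rightarrow> 'a) set" where
  "families M = {X. \<forall>i. X i \<in> carrier (M i)}"

inductive_set multilin_rel ::
  "('n \<Rightarrow> (complex, 'a) module) \<Rightarrow> (('n \<Rightarrow> 'a) \<Rightarrow>\<^sub>0 complex) set"
  for M :: "'n \<Rightarrow> (complex, 'a) module" where
  zero: "0 \<in> multilin_rel M"
| step: "\<lbrakk>r \<in> multilin_rel M; X \<in> families M; y \<in> carrier (M i); z \<in> carrier (M i)\<rbrakk> \<Longrightarrow>
    r + pm_scale s
         (Poly_Mapping.single (X(i := a \<odot>\<^bsub>M i\<^esub> y \<oplus>\<^bsub>M i\<^esub> b \<odot>\<^bsub>M i\<^esub> z)) 1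
          - Poly_Mapping.single (X(i := y)) a - Poly_Mapping.single (X(i := z)) b)
    \<in> multilin_rel M"

definition tensor_class ::
  "('n \<Rightarrow> (complex, 'a) module) \<Rightarrow> (('n \<Rightarrow> 'a) \<Rightarrow>\<^sub>0 complex) \<Rightarrow> (('n \<Rightarrow> 'a) \<Rightarrow>\<^sub>0 complex) set" where
  "tensor_class M f = multilin_rel M +>\<^bsub>free_module (families M)\<^esub> f"

definition tensor_module ::
  "('n::finite \<Rightarrow> (complex, 'a) module) \<Rightarrow> (complex, (('n \<Rightarrow> 'a) \<Rightarrow>\<^sub>0 complex) set) module" where
  "tensor_module M = quot_module (free_module (families M)) (multilin_rel M)"


section \<open>The Virasoro Lie algebra and Whittaker functions\<close>

datatype vir_basis = Lgen int | Cgen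

type_synonym vir = "vir_basis \<Rightarrow>\<^sub>0 complex"

abbreviation Lvir :: "int \<Rightarrow> vir" where "Lvir n \<equiv> Poly_Mapping.single (Lgen n) 1"
abbreviation Cvir :: vir where "Cvir \<equiv> Poly_Mapping.single Cgen 1"

fun basis_bracket :: "vir_basis \<Rightarrow> vir_basis \<Rightarrow> vir" where
  "basis_bracket (Lgen m) (Lgen n) =
     pm_scale (of_int (m - n)) (Lvir (m + n))
     + (if m + n = 0 then pm_scale (of_int (m ^ 3 - m) / 12) Cvir else 0)"
| "basis_bracket _ _ = 0"

definition vir_bracket :: "vir \<Rightarrow> vir \<Rightarrow> vir" where
  "vir_bracket x y = (\<Sum>p\<in>Poly_Mapping.keys x. \<Sum>q\<in>Poly_Mapping.keys y.
     pm_scale (Poly_Mapping.lookup x p * Poly_Mapping.lookup y q) (basis_bracket p q))"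

definition lie_subalgebra :: "vir set \<Rightarrow> bool" where
  "lie_subalgebra S \<longleftrightarrow> 0 \<in> S \<and> (\<forall>x\<in>S. \<forall>y\<in>S. x + y \<in> S \<and> vir_bracket x y \<in> S)
     \<and> (\<forall>a. \<forall>x\<in>S. pm_scale a x \<in> S)"

definition vir_pos :: "vir set" where
  "vir_pos = \<Inter>{S. lie_subalgebra S \<and> (\<forall>n>0. Lvir n \<in> S)}"

text \<open>
  A Whittaker function is represented by a function on the whole of Vir of which only the
  restriction to \<open>vir_pos\<close> matters. The bracket of the target is zero. The trivial function is
  allowed here, but its universal Whittaker module is reducible: if \<open>\<Psi> = 0\<close>, then \<open>L(0) w\<close> is
  annihilated by all \<open>L(n)\<close>, \<open>n > 0\<close>, and generates a nonzero proper submodule.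
\<close>

definition whittaker_function :: "(vir \<Rightarrow> complex) \<Rightarrow> bool" where
  "whittaker_function \<Psi> \<longleftrightarrow>
     (\<forall>x\<in>vir_pos. \<forall>y\<in>vir_pos. \<Psi> (x + y) = \<Psi> x + \<Psi> y \<and> \<Psi> (vir_bracket x y) = 0)
     \<and> (\<forall>a. \<forall>x\<in>vir_pos. \<Psi> (pm_scale a x) = a * \<Psi> x)"


section \<open>The universal enveloping algebra\<close>

text \<open>
  Words in the basis form a monoid under concatenation (written additively), and the tensor algebra of Vir is the monoid algebra of words.
\<close>

datatype vir_word = Word (letters: "vir_basis list")

instantiation vir_word :: monoid_add
begin
definition zero_vir_word :: vir_word where "0 = Word []"
definition plus_vir_word :: "vir_word \<Rightarrow> vir_word \<Rightarrow> vir_word" where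
  "u + v = Word (letters u @ letters v)"
instance
  by standard (simp_all add: zero_vir_word_def plus_vir_word_def)
end

type_synonym vir_tensor_algebra = "vir_word \<Rightarrow>\<^sub>0 complex"

definition tensor_of_vir :: "vir \<Rightarrow> vir_tensor_algebra" where
  "tensor_of_vir x =
     (\<Sum>p\<in>Poly_Mapping.keys x. Poly_Mapping.single (Word [p]) (Poly_Mapping.lookup x p))"

inductive_set uea_ideal :: "vir_tensor_algebra set" where
  zero: "0 \<in> uea_ideal"
| step: "r \<in> uea_ideal \<Longrightarrow>
    r + s * (tensor_of_vir x * tensor_of_vir y - tensor_of_vir y * tensor_of_vir x
             - tensor_of_vir (vir_bracket x y)) * t \<in> uea_ideal"

lemma uea_ideal_add: "u \<in> uea_ideal \<Longrightarrow> r \<in> uea_ideal \<Longrightarrow> r + u \<in> uea_ideal"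
proof (induction u rule: uea_ideal.induct)
  case (step u s x y t)
  then show ?case
    using uea_ideal.step[of "r + u" s x y t] by (simp add: add.assoc)
qed simp

lemma uea_ideal_mult: "u \<in> uea_ideal \<Longrightarrow> p * u * q \<in> uea_ideal"
proof (induction u rule: uea_ideal.induct)
  case zero
  then show ?case by (simp add: uea_ideal.zero)
next
  case (step u s x y t)
  then show ?case
    using uea_ideal.step[of "p * u * q" "p * s" x y "t * q"]
    by (simp add: distrib_left distrib_right mult.assoc)
qed

lemma uea_ideal_uminus: "u \<in> uea_ideal \<Longrightarrow> - u \<in> uea_ideal"
  using uea_ideal_mult[of u "- 1" 1] by simp

lemma lookup_mult_0:
  fixes f g :: vir_tensor_algebra
  shows "Poly_Mapping.lookup (f * g) 0 = Poly_Mapping.lookup f 0 * Poly_Mapping.lookup g 0"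
proof -
  have z: "0 = u + v \<longleftrightarrow> 0 = v \<and> 0 = u" for u v :: vir_word
    by (cases u; cases v) (auto simp: zero_vir_word_def plus_vir_word_def)
  have "Poly_Mapping.lookup (f * g) 0
      = (\<Sum>l. Poly_Mapping.lookup f l * ((\<Sum>q. Poly_Mapping.lookup g q when 0 = q) when 0 = l))"
    unfolding lookup_mult z by (intro Sum_any.cong) (simp add: when_def)
  also have "\<dots> = (\<Sum>l. Poly_Mapping.lookup f l * Poly_Mapping.lookup g 0 when 0 = l)"
    by (intro Sum_any.cong) (simp add: when_def)
  finally show ?thesis by simp
qed

lemma uea_ideal_lookup_0: "u \<in> uea_ideal \<Longrightarrow> Poly_Mapping.lookup u 0 = 0"
proof (induction u rule: uea_ideal.induct)
  case (step u s x y t)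
  have "Poly_Mapping.lookup (tensor_of_vir x) 0 = 0" for x
    by (simp add: tensor_of_vir_def lookup_sum lookup_single zero_vir_word_def)
  then show ?case
    using step.IH by (simp add: lookup_add lookup_minus lookup_mult_0)
qed simp

quotient_type uvir = vir_tensor_algebra / "\<lambda>u v. u - v \<in> uea_ideal"
proof (rule equivpI)
  show "reflp (\<lambda>u v. u - v \<in> uea_ideal)"
    by (simp add: reflp_def uea_ideal.zero)
  show "symp (\<lambda>u v. u - v \<in> uea_ideal)"
    by (rule sympI) (metis minus_diff_eq uea_ideal_uminus)
  show "transp (\<lambda>u v. u - v \<in> uea_ideal)"
    by (rule transpI) (metis diff_add_cancel add_diff_eq uea_ideal_add)
qed

instantiation uvir :: ring_1
begin

lift_definition zero_uvir :: uvir is 0 .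
lift_definition one_uvir :: uvir is 1 .

lift_definition plus_uvir :: "uvir \<Rightarrow> uvir \<Rightarrow> uvir" is "(+)"
  by (metis add_diff_add uea_ideal_add)

lift_definition uminus_uvir :: "uvir \<Rightarrow> uvir" is uminus
  by (metis minus_diff_minus uea_ideal_uminus)

lift_definition minus_uvir :: "uvir \<Rightarrow> uvir \<Rightarrow> uvir" is "(-)"
proof -
  fix a b c d :: vir_tensor_algebra
  assume h: "a - b \<in> uea_ideal" "c - d \<in> uea_ideal"
  have "a - c - (b - d) = (a - b) + - (c - d)"
    by (simp add: algebra_simps)
  then show "a - c - (b - d) \<in> uea_ideal"
    using h by (simp only: uea_ideal_add uea_ideal_uminus)
qed

lift_definition times_uvir :: "uvir \<Rightarrow> uvir \<Rightarrow> uvir" is "(*)"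
proof -
  fix a b c d :: vir_tensor_algebra
  assume h: "a - b \<in> uea_ideal" "c - d \<in> uea_ideal"
  have "a * c - b * d = 1 * (a - b) * c + b * (c - d) * 1"
    by (simp add: algebra_simps)
  then show "a * c - b * d \<in> uea_ideal"
    using h by (simp only: uea_ideal_add uea_ideal_mult)
qed

instance
proof
  fix a b c :: uvir
  show "a + b + c = a + (b + c)" by transfer (simp add: add.assoc uea_ideal.zero)
  show "a + b = b + a" by transfer (simp add: add.commute uea_ideal.zero)
  show "0 + a = a" by transfer (simp add: uea_ideal.zero)
  show "- a + a = 0" by transfer (simp add: uea_ideal.zero)
  show "a - b = a + - b" by transfer (simp add: uea_ideal.zero)
  show "a * b * c = a * (b * c)" by transfer (simp add: mult.assoc uea_ideal.zero)
  show "1 * a = a" by transfer (simp add: uea_ideal.zero)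
  show "a * 1 = a" by transfer (simp add: uea_ideal.zero)
  show "(a + b) * c = a * c + b * c" by transfer (simp add: distrib_right uea_ideal.zero)
  show "a * (b + c) = a * b + a * c" by transfer (simp add: distrib_left uea_ideal.zero)
  show "(0::uvir) \<noteq> 1"
  proof transfer
    show "0 - 1 \<notin> uea_ideal"
      using uea_ideal_lookup_0[of "0 - 1"] by (auto simp: lookup_one)
  qed
qed

end

definition u_of_vir :: "vir \<Rightarrow> uvir" where
  "u_of_vir x = abs_uvir (tensor_of_vir x)"

definition u_scale :: "complex \<Rightarrow> uvir \<Rightarrow> uvir" where
  "u_scale a u = abs_uvir (Poly_Mapping.single 0 a) * u"

definition uvir_module :: "(complex, uvir) module" where
  "uvir_module = \<lparr>carrier = UNIV, mult = (*), one = 1, zero = 0, add = (+), smult = u_scale\<rparr>"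


section \<open>Induced modules\<close>

text \<open>
  For a one-dimensional module \<open>\<complex>w\<close> of a Lie subalgebra \<open>P\<close>, \<open>x w = \<chi> x w\<close> for \<open>x \<in> P\<close>, the induced
  module \<open>U(Vir) \<otimes>\<^bsub>U(P)\<^esub> \<complex>w\<close> is the quotient of \<open>U(Vir) \<otimes> \<complex>w = U(Vir)\<close> by the span of the elements
  \<open>u x \<otimes> w - u \<otimes> x w = u x - \<chi> x u\<close>; as \<open>U(P)\<close> is generated by \<open>P\<close>, elements \<open>x\<close> of \<open>P\<close>
  suffice. \<open>E\<close> is the graph \<open>{(x, \<chi> x)}\<close>, and \<open>Vir\<close> acts by multiplication from the left.
\<close>

inductive_set balanced_rel :: "(vir \<times> complex) set \<Rightarrow> uvir set" for E where
  zero: "0 \<in> balanced_rel E"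
| step: "r \<in> balanced_rel E \<Longrightarrow> (x, \<chi>) \<in> E \<Longrightarrow>
    r + (u * u_of_vir x - u_scale \<chi> u) \<in> balanced_rel E"

definition induced_module :: "(vir \<times> complex) set \<Rightarrow> (complex, uvir set) module" where
  "induced_module E = quot_module uvir_module (balanced_rel E)"

definition induced_action :: "(vir \<times> complex) set \<Rightarrow> vir \<Rightarrow> uvir set \<Rightarrow> uvir set" where
  "induced_action E x A = (\<Union>u\<in>A. balanced_rel E +>\<^bsub>uvir_module\<^esub> (u_of_vir x * u))"

definition whittaker_char :: "complex \<Rightarrow> (vir \<Rightarrow> complex) \<Rightarrow> (vir \<times> complex) set" where
  "whittaker_char c \<Psi> = {(x + pm_scale z Cvir, \<Psi> x + z * c) |x z. x \<in> vir_pos}"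

definition Wh :: "complex \<Rightarrow> (vir \<Rightarrow> complex) \<Rightarrow> (complex, uvir set) module" where
  "Wh c \<Psi> = induced_module (whittaker_char c \<Psi>)"

text \<open>
  The underlying space of the universal Virasoro vertex operator algebra is the vacuum module,
  induced from the subalgebra spanned by \<open>L(n)\<close>, \<open>n \<ge> -1\<close>, and \<open>C\<close>; the vacuum is the class of 1 and
  the conformal vector is the class of \<open>L(-2)\<close>.
\<close>

definition vacuum_char :: "complex \<Rightarrow> (vir \<times> complex) set" where
  "vacuum_char c = {(x + pm_scale z Cvir, z * c) |x z. Poly_Mapping.keys x \<subseteq> Lgen ` {-1..}}"

definition Virc :: "complex \<Rightarrow> (complex, uvir set) module" where
  "Virc c = induced_module (vacuum_char c)"


section \<open>Vertex operators\<close>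

text \<open>
  Let \<open>M\<close> be a restricted Vir-module of central charge \<open>c\<close>, with \<open>T n\<close> the action of \<open>L(n)\<close>.
  The vertex operators \<open>Y(v,z) = \<Sum>m. v\<^sub>m z\<^bsup>-m-1\<^esup>\<close> on \<open>M\<close> of the elements \<open>v\<close> of the universal
  Virasoro vertex operator algebra are determined by \<open>1\<^sub>m = \<delta>\<^bsub>m,-1\<^esub>\<close>, \<open>\<omega>\<^bsub>n+1\<^esub> = L(n)\<close> and the
  Borcherds identity for iterates
    \<open>(u\<^sub>n v)\<^sub>m = \<Sum>i\<ge>0. (-1)\<^sup>i (n choose i) (u\<^bsub>n-i\<^esub> v\<^bsub>m+i\<^esub> - (-1)\<^sup>n v\<^bsub>n+m-i\<^esub> u\<^sub>i)\<close>
  which, for \<open>u = \<omega>\<close> and \<open>n = k + 1\<close>, gives the modes of \<open>L(k) v\<close>. On each vector only finitely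
  many terms of the series are nonzero. The word \<open>[p\<^sub>1, \<dots>, p\<^sub>r]\<close> stands for \<open>p\<^sub>1 \<cdots> p\<^sub>r 1\<close>.
  For \<open>M = Virc c\<close> these are the vertex operators of the vertex operator algebra itself.
\<close>

definition iterate_term ::
  "(complex, 'm) module \<Rightarrow> (int \<Rightarrow> 'm \<Rightarrow> 'm) \<Rightarrow> int \<Rightarrow> (int \<Rightarrow> 'm \<Rightarrow> 'm) \<Rightarrow> int \<Rightarrow> 'm \<Rightarrow> nat \<Rightarrow> 'm" where
  "iterate_term M T k Y m x i =
     ((-1) ^ i * (of_int (k + 1) gchoose i)) \<odot>\<^bsub>M\<^esub>
       (T (k - int i) (Y (m + int i) x)
        \<ominus>\<^bsub>M\<^esub> ((-1) powi (k + 1)) \<odot>\<^bsub>M\<^esub> Y (k + 1 + m - int i) (T (int i - 1) x))"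

primrec word_mode ::
  "(complex, 'm) module \<Rightarrow> complex \<Rightarrow> (int \<Rightarrow> 'm \<Rightarrow> 'm) \<Rightarrow> vir_basis list \<Rightarrow> int \<Rightarrow> 'm \<Rightarrow> 'm" where
  "word_mode M c T [] = (\<lambda>m x. if m = -1 then x else \<zero>\<^bsub>M\<^esub>)"
| "word_mode M c T (p # w) =
     (case p of
        Lgen k \<Rightarrow> (\<lambda>m x. \<Oplus>\<^bsub>M\<^esub> i \<in> {i. iterate_term M T k (word_mode M c T w) m x i \<noteq> \<zero>\<^bsub>M\<^esub>}.
                      iterate_term M T k (word_mode M c T w) m x i)
      | Cgen \<Rightarrow> (\<lambda>m x. c \<odot>\<^bsub>M\<^esub> word_mode M c T w m x))"

text \<open>
  The mode \<open>v\<^sub>m\<close> of an element \<open>v\<close> of \<open>Virc c\<close>, computed from a representative of \<open>v\<close> in the tensor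
  algebra, on which it does not depend.
\<close>

definition vir_mode ::
  "(complex, 'm) module \<Rightarrow> complex \<Rightarrow> (int \<Rightarrow> 'm \<Rightarrow> 'm) \<Rightarrow> uvir set \<Rightarrow> int \<Rightarrow> 'm \<Rightarrow> 'm" where
  "vir_mode M c T v m x =
     (let f = rep_uvir (SOME u. u \<in> v) in
      \<Oplus>\<^bsub>M\<^esub> w \<in> Poly_Mapping.keys f. Poly_Mapping.lookup f w \<odot>\<^bsub>M\<^esub> word_mode M c T (letters w) m x)"

definition Wh_mode ::
  "complex \<Rightarrow> (vir \<Rightarrow> complex) \<Rightarrow> uvir set \<Rightarrow> int \<Rightarrow> uvir set \<Rightarrow> uvir set" where
  "Wh_mode c \<Psi> = vir_mode (Wh c \<Psi>) c (\<lambda>n. induced_action (whittaker_char c \<Psi>) (Lvir n))"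

text \<open>
  The tensor product of modules \<open>M i\<close> of the vertex algebras \<open>V i\<close>, with modes \<open>Y i\<close>, has the vertex
  operators \<open>Y(v\<^sub>1,z) \<otimes> \<cdots> \<otimes> Y(v\<^sub>l,z)\<close>. The coefficient of \<open>z\<^bsup>-n-1\<^esup>\<close> collects the products of the modes
  \<open>(v\<^sub>i)\<^bsub>k\<^sub>i\<^esub>\<close> with \<open>\<Sum>i. k\<^sub>i + l = n + 1\<close>. Both arguments \<open>v\<close> and \<open>x\<close> are tensors, and the result does
  not depend on their representatives.
\<close>

definition tensor_mode ::
  "('n::finite \<Rightarrow> (complex, 'a) module) \<Rightarrow> ('n \<Rightarrow> 'v \<Rightarrow> int \<Rightarrow> 'a \<Rightarrow> 'a) \<Rightarrow>
   (('n \<Rightarrow> 'v) \<Rightarrow>\<^sub>0 complex) set \<Rightarrow> int \<Rightarrow> (('n \<Rightarrow> 'a) \<Rightarrow>\<^sub>0 complex) set \<Rightarrow>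
   (('n \<Rightarrow> 'a) \<Rightarrow>\<^sub>0 complex) set" where
  "tensor_mode M Y v n x =
     (let f = (SOME f. f \<in> v); h = (SOME h. h \<in> x) in
      tensor_class M
        (\<Sum>X\<in>Poly_Mapping.keys f. \<Sum>Z\<in>Poly_Mapping.keys h.
         \<Sum>k\<in>{k. (\<Sum>i\<in>UNIV. k i) + int (card (UNIV :: 'n set)) = n + 1 \<and>
                (\<forall>i. Y i (X i) (k i) (Z i) \<noteq> \<zero>\<^bsub>M i\<^esub>)}.
           Poly_Mapping.single (\<lambda>i. Y i (X i) (k i) (Z i))
             (Poly_Mapping.lookup f X * Poly_Mapping.lookup h Z)))"


section \<open>Permutation orbifolds and irreducibility\<close>

text \<open>
  A permutation \<open>g\<close> of the index type moves the \<open>i\<close>-th tensor factor to position \<open>g i\<close>.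
\<close>

definition perm_action ::
  "('n::finite \<Rightarrow> (complex, 'a) module) \<Rightarrow> ('n \<Rightarrow> 'n) \<Rightarrow>
   (('n \<Rightarrow> 'a) \<Rightarrow>\<^sub>0 complex) set \<Rightarrow> (('n \<Rightarrow> 'a) \<Rightarrow>\<^sub>0 complex) set" where
  "perm_action M g v =
     (let f = (SOME f. f \<in> v) in
      tensor_class M
        (\<Sum>X\<in>Poly_Mapping.keys f. Poly_Mapping.single (X \<circ> inv_into UNIV g) (Poly_Mapping.lookup f X)))"

definition Virc_tensor ::
  "complex \<Rightarrow> (complex, (('n::finite \<Rightarrow> uvir set) \<Rightarrow>\<^sub>0 complex) set) module" where
  "Virc_tensor c = tensor_module (\<lambda>i. Virc c)"

definition Virc_tensor_fixed ::
  "complex \<Rightarrow> ('n::finite \<Rightarrow> 'n) set \<Rightarrow> (('n \<Rightarrow> uvir set) \<Rightarrow>\<^sub>0 complex) set set" where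
  "Virc_tensor_fixed c G =
     {v \<in> carrier (Virc_tensor c). \<forall>g\<in>G. perm_action (\<lambda>i. Virc c) g v = v}"

definition Wh_tensor ::
  "complex \<Rightarrow> ('n::finite \<Rightarrow> vir \<Rightarrow> complex) \<Rightarrow>
   (complex, (('n \<Rightarrow> uvir set) \<Rightarrow>\<^sub>0 complex) set) module" where
  "Wh_tensor c \<Psi> = tensor_module (\<lambda>i. Wh c (\<Psi> i))"

definition Wh_tensor_mode ::
  "complex \<Rightarrow> ('n::finite \<Rightarrow> vir \<Rightarrow> complex) \<Rightarrow> (('n \<Rightarrow> uvir set) \<Rightarrow>\<^sub>0 complex) set \<Rightarrow> int \<Rightarrow>
   (('n \<Rightarrow> uvir set) \<Rightarrow>\<^sub>0 complex) set \<Rightarrow> (('n \<Rightarrow> uvir set) \<Rightarrow>\<^sub>0 complex) set" where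
  "Wh_tensor_mode c \<Psi> = tensor_mode (\<lambda>i. Wh c (\<Psi> i)) (\<lambda>i. Wh_mode c (\<Psi> i))"

definition irreducible_under ::
  "'v set \<Rightarrow> (complex, 'w) module \<Rightarrow> ('v \<Rightarrow> int \<Rightarrow> 'w \<Rightarrow> 'w) \<Rightarrow> bool" where
  "irreducible_under V W Y \<longleftrightarrow> carrier W \<noteq> {\<zero>\<^bsub>W\<^esub>} \<and>
     (\<forall>N. submodule N complex_field W \<and> (\<forall>v\<in>V. \<forall>n. \<forall>x\<in>N. Y v n x \<in> N)
        \<longrightarrow> N = {\<zero>\<^bsub>W\<^esub>} \<or> N = carrier W)"

end

theory Submission
  imports Defs "HOL-Computational_Algebra.Formal_Power_Series" "HOL-Library.Function_Algebras"
begin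

text \<open>
  Let \<open>W\<close> be the tensor product of the Whittaker modules and \<open>x \<noteq> 0\<close> a vector of \<open>W\<close>. For every tensor
  \<open>v\<close> the orbit sum of \<open>v\<close> is fixed by \<open>G\<close>, and its \<open>n\<close>-th mode sends \<open>x\<close> to \<open>\<Sum>g. (g v)\<^sub>n x\<close>. The idea is to
  keep the summands apart: consider the families \<open>F : G \<rightarrow> W\<close> on which the \<open>i\<close>-th copy of Vir acts on the
  component \<open>g\<close> as its copy number \<open>g i\<close>; this is the direct sum of the twists of \<open>W\<close> by \<open>G\<close>. The span
  of the families \<open>g \<mapsto> (g v)\<^sub>n x\<close> (\<open>diagonal_span\<close>) is stable under all copies of Vir. This is weak
  associativity: products \<open>L(p) v\<^sub>m\<close> are combinations of modes of the iterates \<open>(L(k) v)\<^sub>n\<close>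
  (\<open>operator_mode_in_iterates\<close>).

  For \<open>n > 0\<close> the operator \<open>L(n) - \<Psi>(L(n))\<close> is locally nilpotent on a Whittaker module
  (\<open>locally_nilpotent\<close>). Hence the \<open>j\<close>-th \<open>L(n)\<close> has on the component \<open>g\<close> only the generalized eigenvalue
  \<open>\<Psi> (g j) (L(n))\<close>. If \<open>g \<noteq> 1\<close>, it differs from the one on the component of the identity for some \<open>j\<close> and some
  \<open>n\<close> in \<open>{1, 2}\<close>, and a power of \<open>L(n) - \<Psi> (g j) (L(n))\<close> kills the component \<open>g\<close> and is injective on
  the component of the identity. So some family in the span is supported at the identity and nonzero there
  (\<open>diagonal_span_isolate\<close>). As \<open>W\<close> is irreducible under the copies of Vir, its value there can be
  made arbitrary; the sum over \<open>G\<close> of that family is then an arbitrary vector of \<open>W\<close>, and it lies in the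
  submodule generated by \<open>x\<close> over the fixed points.

  The irreducibility of \<open>W\<close> is proved for all tensor factors at once (\<open>irreducible\<close>). Let \<open>s\<close> be the
  largest index with \<open>\<Psi>(L(s)) \<noteq> 0\<close>, and give \<open>L(k)\<close> the weight \<open>s - k\<close>. On leading terms, which are
  polynomials in the letters \<open>L(k)\<close>, \<open>k \<le> 0\<close>, the operator \<open>L(s - m) - \<Psi>(L(s - m))\<close> acts as a nonzero
  multiple of the derivative with respect to \<open>L(m)\<close> if \<open>m\<close> is the smallest index that occurs
  (\<open>T_act_derivative\<close>). Repeating this turns any nonzero vector into a multiple of the Whittaker vector.
  That the Whittaker vector itself is not zero is a Poincare-Birkhoff-Witt statement: reordering words
  in the generators defines a linear form on the enveloping algebra (\<open>straighten_commute\<close>).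

  Vertex operators are given on representatives, of elements of the enveloping algebra, of cosets and
  of tensors. Independence of the representatives amounts to the fact that the iterate formula
  makes the fields on a restricted module a Vir-module (\<open>iterate_bracket\<close>) in which the identity field is
  a vacuum vector (\<open>iterate_vacuum\<close>), and to multilinearity. To compute with elements of a type
  instead of cosets, every quotient is embedded by a linear projection along the relations
  (\<open>projection_along\<close>).
\<close>

section \<open>Linear extension and quotients of vector spaces\<close>

lemma lookup_pm_scale [simp]: "Poly_Mapping.lookup (pm_scale a f) x = a * Poly_Mapping.lookup f x"
  by (simp add: pm_scale_def Poly_Mapping.map.rep_eq when_def)

lemma vector_space_pm_scale: "vector_space (pm_scale :: complex \<Rightarrow> ('x \<Rightarrow>\<^sub>0 complex) \<Rightarrow> _)"
  by unfold_locales (auto intro!: poly_mapping_eqI simp: lookup_add algebra_simps)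

lemma keys_pm_scale: "Poly_Mapping.keys (pm_scale a f) \<subseteq> Poly_Mapping.keys f"
  by (auto simp: in_keys_iff)

lemma pm_scale_single [simp]: "pm_scale a (Poly_Mapping.single x b) = Poly_Mapping.single x (a * b)"
  by (rule poly_mapping_eqI) (simp add: lookup_single when_def)

definition lin_ext :: "(complex \<Rightarrow> 'v \<Rightarrow> 'v) \<Rightarrow> ('x \<Rightarrow> 'v) \<Rightarrow> ('x \<Rightarrow>\<^sub>0 complex) \<Rightarrow> 'v::comm_monoid_add" where
  "lin_ext s F f = (\<Sum>x\<in>Poly_Mapping.keys f. s (Poly_Mapping.lookup f x) (F x))"

context
  fixes s :: "complex \<Rightarrow> 'v::ab_group_add \<Rightarrow> 'v"
  assumes vs: "vector_space s"
begin

interpretation vector_space s by (rule vs)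

lemma lin_ext_superset:
  "finite A \<Longrightarrow> Poly_Mapping.keys f \<subseteq> A \<Longrightarrow> lin_ext s F f = (\<Sum>x\<in>A. s (Poly_Mapping.lookup f x) (F x))"
  unfolding lin_ext_def by (rule sum.mono_neutral_left) (auto simp: in_keys_iff)

lemma lin_ext_add: "lin_ext s F (f + g) = lin_ext s F f + lin_ext s F g"
proof -
  let ?A = "Poly_Mapping.keys f \<union> Poly_Mapping.keys g"
  have "Poly_Mapping.keys (f + g) \<subseteq> ?A" by (rule Poly_Mapping.keys_add)
  then show ?thesis
    by (simp add: lin_ext_superset[of ?A] lookup_add scale_left_distrib sum.distrib)
qed

lemma lin_ext_scale: "lin_ext s F (pm_scale a f) = s a (lin_ext s F f)"
  by (simp add: lin_ext_superset[of "Poly_Mapping.keys f"] keys_pm_scale scale_sum_right)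

lemma module_hom_lin_ext: "module_hom pm_scale s (lin_ext s F)"
  using vector_space_pm_scale vs
  by (intro module_hom.intro module_hom_axioms.intro)
    (simp_all add: lin_ext_add lin_ext_scale module_iff_vector_space vector_space_pm_scale)

lemma lin_ext_single [simp]: "lin_ext s F (Poly_Mapping.single x a) = s a (F x)"
  by (simp add: lin_ext_def)

lemma lin_ext_zero [simp]: "lin_ext s F 0 = 0"
  by (simp add: lin_ext_def)

lemma lin_ext_diff: "lin_ext s F (f - g) = lin_ext s F f - lin_ext s F g"
  by (rule module_hom.diff[OF module_hom_lin_ext])

lemma lin_ext_sum: "lin_ext s F (sum f A) = (\<Sum>i\<in>A. lin_ext s F (f i))"
  by (rule module_hom.sum[OF module_hom_lin_ext])

lemma lin_ext_add_fun: "lin_ext s (\<lambda>x. F x + G x) f = lin_ext s F f + lin_ext s G f"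
  by (simp add: lin_ext_def scale_right_distrib sum.distrib)

lemma lin_ext_scale_fun: "lin_ext s (\<lambda>x. s a (F x)) f = s a (lin_ext s F f)"
  by (simp add: lin_ext_def scale_sum_right mult.commute)

lemma module_hom_lin_ext_comp: "module_hom s t h \<Longrightarrow> h (lin_ext s F f) = lin_ext t (\<lambda>x. h (F x)) f"
  by (simp add: lin_ext_def module_hom.sum module_hom.scale)

text \<open>
  The values of \<open>\<pi>\<close> are canonical representatives of the cosets of \<open>R\<close>: a basis of \<open>R\<close> is extended to a basis
  of the whole space, and \<open>\<pi>\<close> forgets the coordinates that belong to \<open>R\<close>.
\<close>
lemma projection_along:
  assumes R: "subspace R"
  obtains \<pi> where "module_hom s s \<pi>" "\<And>x. \<pi> x = 0 \<longleftrightarrow> x \<in> R" "\<And>x. x - \<pi> x \<in> R" "\<And>x. \<pi> (\<pi> x) = \<pi> x"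
proof -
  interpret vp: vector_space_pair s s by unfold_locales
  obtain B where B: "B \<subseteq> R" "independent B" "R \<subseteq> span B" using basis_exists by metis
  define E where "E = extend_basis B"
  have E: "B \<subseteq> E" "independent E" "span E = UNIV"
    using extend_basis_superset independent_extend_basis span_extend_basis B(2) E_def by auto
  define \<pi> where "\<pi> = vp.construct E (\<lambda>b. if b \<in> B then 0 else b)"
  have lin: "Vector_Spaces.linear s s \<pi>" unfolding \<pi>_def by (rule vp.linear_construct[OF E(2)])
  interpret h: Vector_Spaces.linear s s \<pi> by (rule lin)
  have bas: "\<pi> b = (if b \<in> B then 0 else b)" if "b \<in> E" for b
    unfolding \<pi>_def by (rule vp.construct_basis[OF E(2) that])
  have "x \<in> span E \<Longrightarrow> x - \<pi> x \<in> R" for x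
  proof (induction rule: span_induct)
    case base
    show ?case
      using R by (auto simp: subspace_def h.add h.scale scale_right_diff_distrib[symmetric] add_diff_add)
  next
    case (step b)
    then show ?case using bas[OF step] B(1) subspace_0[OF R] by auto
  qed
  then have 1: "x - \<pi> x \<in> R" for x using E(3) by simp
  have "x \<in> span B \<Longrightarrow> \<pi> x = 0" for x
  proof (induction rule: span_induct)
    case base
    show ?case by (auto simp: subspace_def h.add h.scale h.zero)
  next
    case (step b)
    then show ?case using bas E(1) by auto
  qed
  then have 2: "\<pi> x = 0" if "x \<in> R" for x using B(3) that by blast
  have 3: "x \<in> R" if "\<pi> x = 0" for x using 1[of x] that by simp
  have 4: "\<pi> (\<pi> x) = \<pi> x" for x using 2[OF 1[of x]] by (simp add: h.diff)
  show thesis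
    by (rule that[of \<pi>]) (use 1 2 3 4 h.module_hom_axioms in auto)
qed

end

text \<open>
  The coset spaces of the definitions, for relations \<open>R\<close> inside a subspace of a type. The record \<open>U\<close> is
  constrained only in the fields that coset spaces use, since the multiplicative fields of
  the enveloping algebra and of free modules differ.
\<close>
locale quotient_space = vector_space s for s :: "complex \<Rightarrow> 'v::ab_group_add \<Rightarrow> 'v" +
  fixes U :: "(complex, 'v) module" and R :: "'v set"
  assumes carrier_sub: "subspace (carrier U)" and R_sub: "subspace R" and R_carrier: "R \<subseteq> carrier U"
    and add_U: "add U = (+)" and zero_U: "zero U = 0" and smult_U: "smult U = s"
begin

definition cls :: "'v \<Rightarrow> 'v set" where "cls x = R +>\<^bsub>U\<^esub> x"

abbreviation "Q \<equiv> quot_module U R"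

lemma cls_eq: "cls x = (\<lambda>r. r + x) ` R"
  by (auto simp: cls_def a_r_coset_def r_coset_def add_U)

lemma mem_cls: "y \<in> cls x \<longleftrightarrow> y - x \<in> R"
  unfolding cls_eq by (auto simp: image_iff) (metis diff_add_cancel)

lemma cls_eq_iff: "cls x = cls y \<longleftrightarrow> x - y \<in> R"
proof
  assume "cls x = cls y"
  moreover have "x \<in> cls x" by (simp add: mem_cls subspace_0[OF R_sub])
  ultimately show "x - y \<in> R" by (simp add: mem_cls)
next
  assume xy: "x - y \<in> R"
  have "z - x \<in> R \<longleftrightarrow> z - y \<in> R" for z
    using subspace_add[OF R_sub _ xy, of "z - x"] subspace_diff[OF R_sub _ xy, of "z - y"] by auto
  then show "cls x = cls y" by (auto simp: mem_cls)
qed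

lemma carrier_Q: "carrier Q = cls ` carrier U"
  unfolding quot_module_def by (auto simp: A_RCOSETS_def RCOSETS_def cls_def a_r_coset_def)

lemma cls_in_Q: "x \<in> carrier U \<Longrightarrow> cls x \<in> carrier Q"
  by (simp add: carrier_Q)

lemma zero_Q: "\<zero>\<^bsub>Q\<^esub> = cls 0"
  by (simp add: quot_module_def cls_eq)

lemma add_Q: "cls x \<oplus>\<^bsub>Q\<^esub> cls y = cls (x + y)"
proof -
  have "cls x \<oplus>\<^bsub>Q\<^esub> cls y = {a + b |a b. a \<in> cls x \<and> b \<in> cls y}"
    by (auto simp: quot_module_def set_add_def set_mult_def add_U)
  also have "\<dots> = cls (x + y)"
  proof (intro equalityI subsetI)
    fix z assume "z \<in> {a + b |a b. a \<in> cls x \<and> b \<in> cls y}"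
    then obtain a b where ab: "z = a + b" "a - x \<in> R" "b - y \<in> R" by (auto simp: mem_cls)
    then show "z \<in> cls (x + y)"
      using subspace_add[OF R_sub ab(2,3)] by (simp add: mem_cls algebra_simps)
  next
    fix z assume "z \<in> cls (x + y)"
    then have "z = (z - y) + y \<and> z - y \<in> cls x \<and> y \<in> cls y"
      by (simp add: mem_cls algebra_simps subspace_0[OF R_sub])
    then show "z \<in> {a + b |a b. a \<in> cls x \<and> b \<in> cls y}" by blast
  qed
  finally show ?thesis .
qed

lemma smult_Q: "a \<odot>\<^bsub>Q\<^esub> cls x = cls (s a x)"
proof -
  have "a \<odot>\<^bsub>Q\<^esub> cls x = (\<Union>y\<in>cls x. cls (s a y))"
    by (simp add: quot_module_def smult_U cls_def)
  also have "\<dots> = cls (s a x)"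
  proof -
    have "cls (s a y) = cls (s a x)" if "y \<in> cls x" for y
      using that subspace_scale[OF R_sub, of "y - x" a] by (simp add: cls_eq_iff mem_cls scale_right_diff_distrib)
    moreover have "x \<in> cls x" by (simp add: mem_cls subspace_0[OF R_sub])
    ultimately show ?thesis by blast
  qed
  finally show ?thesis .
qed

sublocale Q: abelian_group Q
proof (rule abelian_groupI)
  fix x y z assume "x \<in> carrier Q" "y \<in> carrier Q" "z \<in> carrier Q"
  then obtain a b c where abc: "x = cls a" "y = cls b" "z = cls c" "a \<in> carrier U" "b \<in> carrier U"
    by (auto simp: carrier_Q)
  show "x \<oplus>\<^bsub>Q\<^esub> y \<in> carrier Q" using abc by (simp add: add_Q cls_in_Q subspace_add[OF carrier_sub])
  show "x \<oplus>\<^bsub>Q\<^esub> y \<oplus>\<^bsub>Q\<^esub> z = x \<oplus>\<^bsub>Q\<^esub> (y \<oplus>\<^bsub>Q\<^esub> z)" using abc by (simp add: add_Q add.assoc)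
  show "x \<oplus>\<^bsub>Q\<^esub> y = y \<oplus>\<^bsub>Q\<^esub> x" using abc by (simp add: add_Q add.commute)
next
  show "\<zero>\<^bsub>Q\<^esub> \<in> carrier Q" by (simp add: zero_Q cls_in_Q subspace_0[OF carrier_sub])
next
  fix x assume "x \<in> carrier Q"
  then obtain a where a: "x = cls a" "a \<in> carrier U" by (auto simp: carrier_Q)
  show "\<zero>\<^bsub>Q\<^esub> \<oplus>\<^bsub>Q\<^esub> x = x" using a by (simp add: add_Q zero_Q)
  show "\<exists>y\<in>carrier Q. y \<oplus>\<^bsub>Q\<^esub> x = \<zero>\<^bsub>Q\<^esub>"
    using a by (intro bexI[of _ "cls (- a)"]) (simp_all add: add_Q zero_Q cls_in_Q subspace_neg[OF carrier_sub])
qed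

lemma uminus_Q: "x \<in> carrier U \<Longrightarrow> \<ominus>\<^bsub>Q\<^esub> cls x = cls (- x)"
  by (rule Q.minus_equality) (simp_all add: add_Q zero_Q cls_in_Q subspace_neg[OF carrier_sub])

lemma minus_Q: "y \<in> carrier U \<Longrightarrow> cls x \<ominus>\<^bsub>Q\<^esub> cls y = cls (x - y)"
  by (simp add: a_minus_def uminus_Q add_Q)

lemma finsum_Q: "(\<And>i. i \<in> A \<Longrightarrow> f i \<in> carrier U) \<Longrightarrow> finsum Q (\<lambda>i. cls (f i)) A = cls (sum f A)"
proof (induction A rule: infinite_finite_induct)
  case (infinite A)
  then show ?case by (simp add: finsum_def finprod_def zero_Q)
next
  case empty
  then show ?case by (simp add: zero_Q)
next
  case (insert x A)
  then have "finsum Q (\<lambda>i. cls (f i)) (insert x A) = cls (f x) \<oplus>\<^bsub>Q\<^esub> finsum Q (\<lambda>i. cls (f i)) A"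
    by (intro Q.finsum_insert) (auto simp: cls_in_Q)
  then show ?case using insert by (simp add: add_Q)
qed

definition rep :: "'v set \<Rightarrow> 'v" where "rep A = (SOME x. x \<in> A)"

lemma rep_cls: "rep (cls x) - x \<in> R"
proof -
  have "x \<in> cls x" by (simp add: mem_cls subspace_0[OF R_sub])
  then have "rep (cls x) \<in> cls x" unfolding rep_def by (rule someI)
  then show ?thesis by (simp add: mem_cls)
qed

lemma rep_carrier: 
  assumes "A \<in> carrier Q" shows "rep A \<in> carrier U" "cls (rep A) = A"
proof -
  obtain x where x: "A = cls x" "x \<in> carrier U" using assms by (auto simp: carrier_Q)
  show "cls (rep A) = A" using x rep_cls[of x] by (simp add: cls_eq_iff)
  show "rep A \<in> carrier U"
    using subspace_add[OF carrier_sub _ x(2), of "rep A - x"] rep_cls[of x] R_carrier x by auto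
qed

end

section \<open>Straightening words in the Virasoro generators\<close>

definition vir_cocycle :: "int \<Rightarrow> complex" where
  "vir_cocycle k = of_int (k ^ 3 - k) / 12"

fun inversions :: "int list \<Rightarrow> nat" where
  "inversions [] = 0"
| "inversions (x # xs) = length (filter (\<lambda>y. y < x) xs) + inversions xs"

lemma inversions_swap: "l < k \<Longrightarrow> inversions (u @ l # k # v) < inversions (u @ k # l # v)"
  by (induction u) auto

lemma not_sorted_descent: "\<not> sorted w \<Longrightarrow> \<exists>u k l v. w = u @ k # l # v \<and> l < (k::int)"
proof (induction w)
  case (Cons x xs)
  show ?case
  proof (cases "sorted xs")
    case True
    with Cons.prems have "\<exists>y ys. xs = y # ys \<and> y < x"
      by (cases xs) (auto simp: not_le)
    then show ?thesis by (metis append_Nil)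
  next
    case False
    with Cons.IH show ?thesis by (metis append_Cons)
  qed
qed simp

text \<open>
  Words in the \<open>L(k)\<close> are rewritten by \<open>L(k) L(l) = L(l) L(k) + [L(k), L(l)]\<close> at a chosen descent. The
  number of letters or, for the swapped word, the number of inversions drops.
\<close>
definition descent :: "int list \<Rightarrow> int list \<times> int \<times> int \<times> int list" where
  "descent w = (SOME (u, k, l, v). w = u @ k # l # v \<and> l < k)"

lemma descent: 
  assumes "\<not> sorted w" "descent w = (u, k, l, v)"
  shows "w = u @ k # l # v" "l < k"
proof -
  have "\<exists>p. case p of (u, k, l, v) \<Rightarrow> w = u @ k # l # v \<and> l < k"
    using not_sorted_descent[OF assms(1)] by auto
  from someI_ex[OF this] assms(2) show "w = u @ k # l # v" "l < k"
    unfolding descent_def by auto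
qed

lemma descent_smaller:
  "(u, k, l, v) = descent w \<Longrightarrow> \<not> sorted w \<Longrightarrow>
     length w = Suc (Suc (length u + length v)) \<and> inversions (u @ l # k # v) < inversions w"
  using descent[of w u k l v] inversions_swap[of l k u v] by simp

text \<open>
  The linear form on words that agrees with \<open>s\<close> on sorted words and respects the commutation relations of
  central charge \<open>c\<close>. It is computed at one descent per word; independence of the
  choice is proved below.
\<close>
function straighten :: "complex \<Rightarrow> (int list \<Rightarrow> complex) \<Rightarrow> int list \<Rightarrow> complex" where
  "straighten c s w = (if sorted w then s w else
     (case descent w of (u, k, l, v) \<Rightarrow>
        straighten c s (u @ l # k # v) + of_int (k - l) * straighten c s (u @ (k + l) # v)
        + (if k + l = 0 then vir_cocycle k * c * straighten c s (u @ v) else 0)))"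
  by pat_completeness auto
termination
  by (relation "measures [\<lambda>(c, s, w). length w, \<lambda>(c, s, w). inversions w]")
    (auto dest: descent_smaller)

declare straighten.simps [simp del]

lemma vir_cocycle_uminus: "vir_cocycle (- k) = - vir_cocycle k"
  by (simp add: vir_cocycle_def field_simps)

definition straighten_step ::
  "complex \<Rightarrow> (int list \<Rightarrow> complex) \<Rightarrow> int list \<Rightarrow> int \<Rightarrow> int \<Rightarrow> int list \<Rightarrow> complex" where
  "straighten_step c s u k l v =
     straighten c s (u @ l # k # v) + of_int (k - l) * straighten c s (u @ (k + l) # v)
     + (if k + l = 0 then vir_cocycle k * c * straighten c s (u @ v) else 0)"

lemma straighten_step_cases:
  assumes "\<And>a b. b < a \<Longrightarrow> {a, b} = {k, l} \<Longrightarrow> straighten c s (u @ a # b # v) = straighten_step c s u a b v"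
  shows "straighten c s (u @ k # l # v) = straighten_step c s u k l v"
proof (cases k l rule: linorder_cases)
  case less
  have "straighten c s (u @ l # k # v) = straighten_step c s u l k v" using assms less by blast
  moreover have "k + l = 0 \<Longrightarrow> vir_cocycle k = - vir_cocycle l" 
    using vir_cocycle_uminus[of l] by (simp add: add_eq_0_iff)
  ultimately show ?thesis by (auto simp: straighten_step_def algebra_simps add.commute[of l k])
next
  case equal
  then show ?thesis by (auto simp: straighten_step_def vir_cocycle_def)
next
  case greater
  then show ?thesis using assms by blast
qed

text \<open>
  The overlap \<open>x > y > z\<close> of two descents. Both ways of sorting the three letters lead to \<open>z y x\<close>, and the
  remainders differ by a Jacobi sum, which vanishes. The central parts cancel by the cocycle identity.
\<close>
lemma straighten_step_overlap:
  fixes x y z :: int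
  assumes short: "\<And>a p q b. length a + length b < length u + length v + 1 \<Longrightarrow>
        straighten c s (a @ p # q # b) = straighten_step c s a p q b"
    and yxz: "straighten c s (u @ y # x # z # v) = straighten_step c s (u @ [y]) x z v"
    and yzx: "straighten c s (u @ y # z # x # v) = straighten_step c s u y z (x # v)"
    and xzy: "straighten c s (u @ x # z # y # v) = straighten_step c s u x z (y # v)"
    and zxy: "straighten c s (u @ z # x # y # v) = straighten_step c s (u @ [z]) x y v"
  shows "straighten_step c s u x y (z # v) = straighten_step c s (u @ [x]) y z v"
proof -
  define S where "S = straighten c s (u @ (x + y + z) # v)"
  define S0 where "S0 = c * straighten c s (u @ v)"
  have comm: "straighten c s (u @ p # q # v) = straighten c s (u @ q # p # v) + of_int (p - q) * S
      + (if x + y + z = 0 then vir_cocycle p * S0 else 0)" if "p + q = x + y + z" for p q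
    using short[of u v p q] that by (simp add: straighten_step_def S_def S0_def)
  have c1: "straighten c s (u @ (x + y) # z # v) = straighten c s (u @ z # (x + y) # v)
      + of_int (x + y - z) * S + (if x + y + z = 0 then vir_cocycle (x + y) * S0 else 0)"
    by (rule comm) simp
  have c2: "straighten c s (u @ (y + z) # x # v) = straighten c s (u @ x # (y + z) # v)
      + of_int (y + z - x) * S + (if x + y + z = 0 then vir_cocycle (y + z) * S0 else 0)"
    by (rule comm) simp
  have c3: "straighten c s (u @ (x + z) # y # v) = straighten c s (u @ y # (x + z) # v)
      + of_int (x + z - y) * S + (if x + y + z = 0 then vir_cocycle (x + z) * S0 else 0)"
    by (rule comm) simp
  \<comment> \<open>the cocycle identity\<close>
  have jac: "of_int (x - y) * vir_cocycle (x + y) + of_int (y - z) * vir_cocycle (y + z)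
      = of_int (x - z) * vir_cocycle (x + z)" if "x + y + z = 0"
  proof -
    have x: "x = - y - z" using that by simp
    show ?thesis unfolding vir_cocycle_def x by (simp add: field_simps power3_eq_cube)
  qed
  have "straighten_step c s u x y (z # v) - straighten_step c s (u @ [x]) y z v
     = of_int (x - y) * (of_int (x + y - z) * S + (if x + y + z = 0 then vir_cocycle (x + y) * S0 else 0))
     + of_int (y - z) * (of_int (y + z - x) * S + (if x + y + z = 0 then vir_cocycle (y + z) * S0 else 0))
     - of_int (x - z) * (of_int (x + z - y) * S + (if x + y + z = 0 then vir_cocycle (x + z) * S0 else 0))"
    using yxz yzx xzy zxy c1 c2 c3
    by (simp add: straighten_step_def ring_distribs del: of_int_diff of_int_add)
  also have "\<dots> = (if x + y + z = 0 then
       (of_int (x - y) * vir_cocycle (x + y) + of_int (y - z) * vir_cocycle (y + z)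
       - of_int (x - z) * vir_cocycle (x + z)) * S0 else 0)"
    by (simp add: algebra_simps)
  also have "\<dots> = 0" using jac by simp
  finally show ?thesis by simp
qed

text \<open>
  The confluence argument of the Poincare-Birkhoff-Witt theorem, by induction on length and
  inversions: two descents of a word are equal, overlap, or are disjoint. For disjoint
  descents both rewriting steps can be carried out in either order.
\<close>
lemma straighten_descent:
  assumes "l < k" 
  shows "straighten c s (u @ k # l # v) = straighten_step c s u k l v"
proof -
  have "\<forall>u k l v. w = u @ k # l # v \<and> l < k \<longrightarrow> straighten c s w = straighten_step c s u k l v" for w
  proof (induction w rule: wf_induct[OF wf_measures[of "[length, inversions]"]])
    case (1 w)
    have small: "straighten c s (a @ p # q # b) = straighten_step c s a p q b"
      if "q < p" "length (a @ p # q # b) < length w \<or>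
         length (a @ p # q # b) = length w \<and> inversions (a @ p # q # b) < inversions w" for a p q b
    proof -
      have "(a @ p # q # b, w) \<in> measures [length, inversions]" using that(2) by auto
      with 1 that(1) show ?thesis by blast
    qed
    have short: "straighten c s (a @ p # q # b) = straighten_step c s a p q b"
      if "length a + length b + 2 < length w" for a p q b
      by (rule straighten_step_cases, rule small) (use that in auto)
    have eq: "straighten_step c s u k l v = straighten_step c s u' k' l' v'"
      if w: "w = u @ k # l # v" "l < k" and w': "w = u' @ k' # l' # v'" "l' < k'"
        and le: "length u \<le> length u'" for u k l v u' k' l' v'
    proof -
      consider "u' = u" | "u' = u @ [k]" | m where "u' = u @ k # l # m"
      proof -
        have "\<exists>t. u' = u @ t \<and> k # l # v = t @ k' # l' # v'"
          using w(1) w'(1) le by (auto simp: append_eq_append_conv2)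
        then obtain t where "u' = u @ t" "k # l # v = t @ k' # l' # v'" by blast
        then show thesis using that by (cases t; cases "tl t") (auto simp: Cons_eq_append_conv)
      qed
      then show ?thesis
      proof cases
        case 1 then show ?thesis using w w' by simp
      next
        case 2
        then have [simp]: "k' = l" and v: "v = l' # v'" using w w' by simp_all
        have i1: "inversions (u @ l # k # l' # v') < inversions w"
          using inversions_swap[of l k u "l' # v'"] w v by simp
        have i2: "inversions (u @ l # l' # k # v') < inversions w"
          using inversions_swap[of l' k "u @ [l]" "v'"] i1 w w' by simp
        have i3: "inversions (u @ k # l' # l # v') < inversions w"
          using inversions_swap[of l' l "u @ [k]" "v'"] w w' v by simp
        have i4: "inversions (u @ l' # k # l # v') < inversions w"
          using inversions_swap[of l' k "u" "l # v'"] i3 w w' v by simp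
        show ?thesis unfolding 2 v \<open>k' = l\<close>
        proof (rule straighten_step_overlap)
          show "straighten c s (a @ p # q # b) = straighten_step c s a p q b"
            if "length a + length b < length u + length v' + 1" for a p q b
            using that w v by (intro short) simp
          show "straighten c s (u @ l # k # l' # v') = straighten_step c s (u @ [l]) k l' v'"
            using small[of l' k "u @ [l]" v'] i1 w w' v by simp
          show "straighten c s (u @ l # l' # k # v') = straighten_step c s u l l' (k # v')"
            using small[of l' l "u" "k # v'"] i2 w w' v by simp
          show "straighten c s (u @ k # l' # l # v') = straighten_step c s u k l' (l # v')"
            using small[of l' k "u" "l # v'"] i3 w w' v by simp
          show "straighten c s (u @ l' # k # l # v') = straighten_step c s (u @ [l']) k l v'"
            using small[of l k "u @ [l']" v'] i4 w w' v by simp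
        qed
      next
        case (3 m)
        then have v: "v = m @ k' # l' # v'" using w w' by simp
        have i1: "inversions (u @ l # k # m @ k' # l' # v') < inversions w"
          using inversions_swap[of l k u v] w v by simp
        have i2: "inversions (u @ k # l # m @ l' # k' # v') < inversions w"
          using inversions_swap[of l' k' u' v'] w' 3 by simp
        have "straighten c s (u @ l # k # m @ k' # l' # v') = straighten_step c s (u @ l # k # m) k' l' v'"
          using small[of l' k' "u @ l # k # m" v'] i1 w w' v by simp
        moreover have "straighten c s (u @ (k + l) # m @ k' # l' # v') = straighten_step c s (u @ (k + l) # m) k' l' v'"
          using small[of l' k' "u @ (k + l) # m" v'] w w' v by simp
        moreover have "straighten c s (u @ m @ k' # l' # v') = straighten_step c s (u @ m) k' l' v'"
          using small[of l' k' "u @ m" v'] w w' v by simp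
        moreover have "straighten c s (u @ k # l # m @ l' # k' # v') = straighten_step c s u k l (m @ l' # k' # v')"
          using small[of l k u "m @ l' # k' # v'"] i2 w w' v by simp
        moreover have "straighten c s (u @ k # l # m @ (k' + l') # v') = straighten_step c s u k l (m @ (k' + l') # v')"
          using small[of l k u "m @ (k' + l') # v'"] w w' v by simp
        moreover have "straighten c s (u @ k # l # m @ v') = straighten_step c s u k l (m @ v')"
          using small[of l k u "m @ v'"] w w' v by simp
        ultimately show ?thesis unfolding 3 v
          by (simp add: straighten_step_def ring_distribs del: of_int_diff of_int_add)
      qed
    qed
    show ?case
    proof (intro allI impI, elim conjE)
      fix u k l v assume w: "w = u @ k # l # v" "l < k"
      then have ns: "\<not> sorted w" by (auto simp: sorted_append)
      obtain u' k' l' v' where d: "descent w = (u', k', l', v')" by (metis prod_cases4)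
      note dd = descent[OF ns d]
      have "straighten c s w = straighten_step c s u' k' l' v'"
        using ns d straighten.simps[of c s w] by (simp add: straighten_step_def)
      also have "\<dots> = straighten_step c s u k l v"
        using eq[OF w dd] eq[OF dd w] by (metis nat_le_linear)
      finally show "straighten c s w = straighten_step c s u k l v" .
    qed
  qed
  with assms show ?thesis by blast
qed

lemma straighten_commute: "straighten c s (u @ k # l # v) = straighten_step c s u k l v"
  by (rule straighten_step_cases) (rule straighten_descent)

text \<open>
  The value on sorted words of the linear form "coefficient of the Whittaker vector": in a sorted word
  all positive letters stand on the right, where they act by \<open>\<psi>\<close>.
\<close>
definition whittaker_weight :: "(int \<Rightarrow> complex) \<Rightarrow> int list \<Rightarrow> complex" where
  "whittaker_weight \<psi> w = (if \<forall>k\<in>set w. 0 < k then prod_list (map \<psi> w) else 0)"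

text \<open>
  Moving a positive letter \<open>n\<close> to its place creates, apart from \<open>\<psi> n\<close>, only brackets of distinct
  positive letters. These have index at least 3, where \<open>\<psi>\<close> vanishes.
\<close>
lemma straighten_whittaker:
  assumes \<psi>: "\<And>k. 3 \<le> k \<Longrightarrow> \<psi> k = 0" and "0 < n"
  shows "straighten c (whittaker_weight \<psi>) (u @ [n]) = \<psi> n * straighten c (whittaker_weight \<psi>) u"
proof -
  let ?f = "straighten c (whittaker_weight \<psi>)"
  have "\<forall>u n. w = u @ [n] \<and> 0 < n \<longrightarrow> ?f w = \<psi> n * ?f u" for w
  proof (induction w rule: wf_induct[OF wf_measures[of "[length, inversions]"]])
    case (1 w)
    have small: "?f (u @ [n]) = \<psi> n * ?f u" if "0 < n" "length (u @ [n]) < length w \<or>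
         length (u @ [n]) = length w \<and> inversions (u @ [n]) < inversions w" for u n
    proof -
      have "(u @ [n], w) \<in> measures [length, inversions]" using that(2) by auto
      with 1 that(1) show ?thesis by blast
    qed
    show ?case
    proof (intro allI impI, elim conjE)
      fix u n assume w: "w = u @ [n]" "(0::int) < n"
      show "?f w = \<psi> n * ?f u"
      proof (cases "sorted w")
        case True
        then have "sorted u" using w by (simp add: sorted_append)
        with True show ?thesis using w by (simp add: straighten.simps whittaker_weight_def)
      next
        case False
        then obtain a k l b where ab: "w = a @ k # l # b" "l < k" using not_sorted_descent by blast
        note i = inversions_swap[of l k a b, OF ab(2)]
        show ?thesis
        proof (cases b rule: rev_cases)
          case Nil
          then have u: "u = a @ [k]" "n = l" using ab w by auto
          have "?f w = ?f (a @ l # [k]) + of_int (k - l) * ?f (a @ [k + l])"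
            using straighten_descent[of l k c _ a b] ab Nil w u by (simp add: straighten_step_def)
          also have "?f (a @ [k + l]) = 0"
            using small[of "k + l" a] \<psi>[of "k + l"] ab Nil w u by simp
          also have "?f (a @ l # [k]) = \<psi> k * ?f (a @ [l])"
            using small[of k "a @ [l]"] i ab Nil w u by simp
          also have "?f (a @ [l]) = \<psi> l * ?f a"
            using small[of l a] i ab Nil w u by simp
          also have "\<psi> k * (\<psi> l * ?f a) = \<psi> l * ?f (a @ [k])"
            using small[of k a] i ab Nil w u by simp
          finally show ?thesis using u by simp
        next
          case (snoc b' n')
          then have u: "u = a @ k # l # b'" "n' = n" using ab w by auto
          have "?f (a @ l # k # b' @ [n]) = \<psi> n * ?f (a @ l # k # b')"
            using small[of n "a @ l # k # b'"] i ab w snoc u by simp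
          moreover have "?f (a @ (k + l) # b' @ [n]) = \<psi> n * ?f (a @ (k + l) # b')"
            using small[of n "a @ (k + l) # b'"] i ab w snoc u by simp
          moreover have "?f (a @ b' @ [n]) = \<psi> n * ?f (a @ b')"
            using small[of n "a @ b'"] i ab w snoc u by simp
          ultimately show ?thesis
            using straighten_descent[of l k c "whittaker_weight \<psi>" a "b' @ [n]"]
              straighten_descent[of l k c "whittaker_weight \<psi>" a "b'"] w ab u
            by (simp add: straighten_step_def ring_distribs del: of_int_diff of_int_add)
        qed
      qed
    qed
  qed
  with assms show ?thesis by blast
qed

section \<open>Iterates of fields\<close>

lemma vir_cocycle_factors: "vir_cocycle k = of_int (k + 1) * (of_int k * of_int (k - 1)) / 12"
  by (simp add: vir_cocycle_def field_simps power3_eq_cube)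

text \<open>
  The coefficients of \<open>(z - w)\<^sup>s\<close>, expanded in powers of \<open>w\<close>.
\<close>
definition sbinom :: "int \<Rightarrow> nat \<Rightarrow> complex" where
  "sbinom s i = (-1) ^ i * (of_int s gchoose i)"

lemma sbinom_0 [simp]: "sbinom s 0 = 1"
  by (simp add: sbinom_def)

lemma sbinom_Suc: "sbinom (s + 1) (Suc i) = sbinom s (Suc i) - sbinom s i"
  using gbinomial_addition_formula[of "of_int (s + 1) :: complex" i]
  by (simp add: sbinom_def algebra_simps)

lemma sbinom_Vandermonde: "(\<Sum>i\<le>n. sbinom s i * sbinom t (n - i)) = sbinom (s + t) n"
proof -
  have "(\<Sum>i\<le>n. sbinom s i * sbinom t (n - i))
      = (\<Sum>i\<le>n. (-1) ^ n * ((of_int s gchoose i) * (of_int t gchoose (n - i))))"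
    by (intro sum.cong) (auto simp: sbinom_def power_add[symmetric] mult.left_commute mult.assoc[symmetric])
  then show ?thesis
    using gbinomial_Vandermonde[of "of_int s :: complex" "of_int t" n]
    by (simp add: sbinom_def sum_distrib_left[symmetric] atMost_atLeast0)
qed

lemma sbinom_absorb_comp: "of_int (s - int i) * sbinom s i = of_int s * sbinom (s - 1) i"
  using gbinomial_absorb_comp[of "of_int s :: complex" i] by (simp add: sbinom_def)

lemma sbinom_absorb: "of_nat i * sbinom s i = (if i = 0 then 0 else - of_int s * sbinom (s - 1) (i - 1))"
  using gbinomial_absorption[of "i - 1" "of_int s :: complex"]
  by (cases i) (auto simp: sbinom_def)

lemma sum_rev_atMost: "(\<Sum>i\<le>n. f i (n - i)) = (\<Sum>i\<le>n::nat. f (n - i) i)"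
  by (rule sum.reindex_bij_witness[of _ "\<lambda>i. n - i" "\<lambda>i. n - i"]) auto

text \<open>
  Together with \<open>sbinom_witt\<close> this says that multiplication by \<open>(z - w)\<^sup>k\<^sup>+\<^sup>1\<close> is compatible with the brackets of
  the vector fields \<open>z\<^sup>k\<^sup>+\<^sup>1 d/dz\<close>, for the two expansions of a power of \<open>z - w\<close>. Both follow
  from Vandermonde's identity after an index has been absorbed into a binomial coefficient.
\<close>
lemma sbinom_witt_comp:
  "(\<Sum>i\<le>n. sbinom (k + 1) i * sbinom (l + 1) (n - i) * of_int ((k - int i) - (l - int (n - i))))
     = of_int (k - l) * sbinom (k + l + 1) n"
proof -
  have "(\<Sum>i\<le>n. sbinom (k + 1) i * sbinom (l + 1) (n - i) * of_int ((k - int i) - (l - int (n - i))))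
     = (\<Sum>i\<le>n. (of_int (k + 1 - int i) * sbinom (k + 1) i) * sbinom (l + 1) (n - i)
              - sbinom (k + 1) i * (of_int (l + 1 - int (n - i)) * sbinom (l + 1) (n - i)))"
    by (intro sum.cong refl) (simp add: algebra_simps)
  also have "\<dots> = of_int (k + 1) * (\<Sum>i\<le>n. sbinom k i * sbinom (l + 1) (n - i))
      - of_int (l + 1) * (\<Sum>i\<le>n. sbinom (k + 1) i * sbinom l (n - i))"
    unfolding sbinom_absorb_comp by (simp add: sum_subtractf sum_distrib_left mult_ac)
  also have "\<dots> = of_int (k - l) * sbinom (k + l + 1) n"
    unfolding sbinom_Vandermonde by (simp add: algebra_simps)
  finally show ?thesis .
qed

lemma sbinom_witt:
  "(\<Sum>i\<le>n. sbinom (k + 1) i * sbinom (l + 1) (n - i) * of_int (int (n - i) - int i))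
     = (if n = 0 then 0 else of_int (k - l) * sbinom (k + l + 1) (n - 1))"
proof (cases n)
  case (Suc m)
  have a: "(\<Sum>i\<le>n. (of_nat i * sbinom s i) * sbinom t (n - i)) = - of_int s * sbinom (s + t - 1) m" for s t
  proof -
    have "(\<Sum>i\<le>n. (of_nat i * sbinom s i) * sbinom t (n - i))
        = (\<Sum>i\<le>m. - of_int s * (sbinom (s - 1) i * sbinom t (m - i)))"
      unfolding Suc sum.atMost_Suc_shift by (simp add: sbinom_absorb mult.assoc del: of_nat_Suc)
    also have "\<dots> = - of_int s * sbinom (s - 1 + t) m"
      unfolding sum_distrib_left[symmetric] sbinom_Vandermonde ..
    finally show ?thesis by (simp add: algebra_simps)
  qed
  have "(\<Sum>i\<le>n. sbinom (k + 1) i * sbinom (l + 1) (n - i) * of_int (int (n - i) - int i))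
     = (\<Sum>i\<le>n. sbinom (k + 1) i * (of_nat (n - i) * sbinom (l + 1) (n - i)))
     - (\<Sum>i\<le>n. (of_nat i * sbinom (k + 1) i) * sbinom (l + 1) (n - i))"
    unfolding sum_subtractf[symmetric] by (intro sum.cong refl) (simp add: algebra_simps)
  also have "(\<Sum>i\<le>n. sbinom (k + 1) i * (of_nat (n - i) * sbinom (l + 1) (n - i)))
     = (\<Sum>i\<le>n. (of_nat i * sbinom (l + 1) i) * sbinom (k + 1) (n - i))"
    by (subst sum_rev_atMost) (simp add: mult_ac)
  finally show ?thesis unfolding a using Suc by (simp add: algebra_simps)
qed simp

text \<open>
  The cocycle is \<open>1/2\<close> times a binomial coefficient of order 3, so that it can be absorbed into \<open>sbinom\<close>;
  what remains is a coefficient of \<open>(z - w)\<^sup>n\<^sup>-\<^sup>1\<close> in degree \<open>n\<close>.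
\<close>
lemma sbinom_cocycle:
  assumes "k + l = int n"
  shows "(\<Sum>i\<le>n. sbinom (k + 1) i * sbinom (l + 1) (n - i) * vir_cocycle (k - int i))
     = (if n = 0 then vir_cocycle k else 0)"
proof -
  have e: "sbinom (k + 1) i * vir_cocycle (k - int i) = vir_cocycle k * sbinom (k - 2) i" for i
  proof -
    have "of_int (k + 1) * (of_int k * (of_int (k - 1) * sbinom (k - 1 - 1) i))
      = of_int (k - 1 - int i) * (of_int (k - int i) * (of_int (k + 1 - int i) * sbinom (k + 1) i))"
      using sbinom_absorb_comp[of "k + 1" i] sbinom_absorb_comp[of k i] sbinom_absorb_comp[of "k - 1" i]
      by (simp del: of_int_add of_int_diff add: mult.left_commute)
    moreover have "sbinom (k + 1) i * vir_cocycle (k - int i)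
        = of_int (k - 1 - int i) * (of_int (k - int i) * (of_int (k + 1 - int i) * sbinom (k + 1) i)) / 12"
      by (simp add: vir_cocycle_factors algebra_simps)
    moreover have "vir_cocycle k * sbinom (k - 2) i
        = of_int (k + 1) * (of_int k * (of_int (k - 1) * sbinom (k - 1 - 1) i)) / 12"
      by (simp add: vir_cocycle_factors algebra_simps)
    ultimately show ?thesis by metis
  qed
  have "(\<Sum>i\<le>n. sbinom (k + 1) i * sbinom (l + 1) (n - i) * vir_cocycle (k - int i))
      = (\<Sum>i\<le>n. vir_cocycle k * (sbinom (k - 2) i * sbinom (l + 1) (n - i)))"
    using e by (intro sum.cong refl) (metis mult.assoc mult.commute)
  also have "\<dots> = vir_cocycle k * sbinom (int n - 1) n"
    unfolding sum_distrib_left[symmetric] sbinom_Vandermonde using assms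
    by (simp add: algebra_simps)
  also have "sbinom (int n - 1) n = (if n = 0 then 1 else 0)"
  proof (cases n)
    case (Suc m)
    then have "(of_int (int n - 1) :: complex) = of_nat m" by simp
    then show ?thesis using Suc by (simp add: sbinom_def binomial_gbinomial[symmetric] del: of_int_diff)
  qed simp
  finally show ?thesis by simp
qed

lemma Sum_any_lessThan:
  assumes "\<And>i. N \<le> i \<Longrightarrow> f i = 0"
  shows "Sum_any f = (\<Sum>i<N. f (i::nat))"
  by (rule Sum_any.expand_superset) (use assms in \<open>auto simp: not_le[symmetric]\<close>)

lemma sum_square_triangle:
  fixes f :: "nat \<Rightarrow> nat \<Rightarrow> 'a::comm_monoid_add"
  assumes "\<And>i j. N \<le> i \<or> N \<le> j \<Longrightarrow> f i j = 0"
  shows "(\<Sum>i<N. \<Sum>j<N. f i j) = (\<Sum>n<2*N. \<Sum>i\<le>n. f i (n - i))"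
proof -
  have "(\<Sum>i<N. \<Sum>j<N. f i j) = (\<Sum>(i, j)\<in>{..<N} \<times> {..<N}. f i j)"
    by (rule sum.cartesian_product)
  also have "\<dots> = (\<Sum>(i, j)\<in>{(i, j). i + j < 2 * N}. f i j)"
  proof (rule sum.mono_neutral_left)
    show "finite {(i, j). i + j < 2 * N}"
      by (rule finite_subset[of _ "{..2*N} \<times> {..2*N}"]) auto
    have "f a b = 0" if "\<not> (a < N \<and> b < N)" for a b
      using assms[of a b] that by (auto simp: not_less)
    then show "\<forall>p\<in>{(i, j). i + j < 2 * N} - {..<N} \<times> {..<N}. (case p of (i, j) \<Rightarrow> f i j) = 0"
      by auto
  qed auto
  also have "\<dots> = (\<Sum>n<2*N. \<Sum>i\<le>n. f i (n - i))"
    by (rule sum.triangle_reindex)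
  finally show ?thesis .
qed

text \<open>
  Only linearity and restrictedness of the operators enter weak associativity, which makes it
  applicable to the families of vectors indexed by \<open>G\<close>.
\<close>
locale restricted_operators = vector_space scale
  for scale :: "complex \<Rightarrow> 'v::ab_group_add \<Rightarrow> 'v" (infixr \<open>*s\<close> 75) +
  fixes T :: "int \<Rightarrow> 'v \<Rightarrow> 'v"
  assumes T_hom: "module_hom scale scale (T k)"
    and T_restricted: "\<exists>N. \<forall>n\<ge>N. T n x = 0"
begin

definition iterate :: "int \<Rightarrow> (int \<Rightarrow> 'v \<Rightarrow> 'v) \<Rightarrow> int \<Rightarrow> 'v \<Rightarrow> 'v" where
  "iterate k Y m x = (\<Sum>i. sbinom (k + 1) i *s
     (T (k - int i) (Y (m + int i) x)
      - ((-1) powi (k + 1)) *s Y (k + 1 + m - int i) (T (int i - 1) x)))"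

definition annihilated :: "(int \<Rightarrow> 'v \<Rightarrow> 'v) \<Rightarrow> 'v \<Rightarrow> bool" where
  "annihilated Y x \<longleftrightarrow> (\<exists>N. \<forall>m\<ge>N. Y m x = 0)"

definition is_field :: "(int \<Rightarrow> 'v \<Rightarrow> 'v) \<Rightarrow> bool" where
  "is_field Y \<longleftrightarrow> (\<forall>m. module_hom scale scale (Y m)) \<and> (\<forall>x. annihilated Y x)"

text \<open>
  The two halves of the iterate formula with an additional factor \<open>z\<^sup>r\<close>, i.e. the coefficients of
  \<open>(z - w)\<^sup>s z\<^sup>r T(z) Y(w)\<close> and of \<open>(z - w)\<^sup>s z\<^sup>r Y(w) T(z)\<close>.
\<close>
definition left_part :: "nat \<Rightarrow> int \<Rightarrow> (int \<Rightarrow> 'v \<Rightarrow> 'v) \<Rightarrow> int \<Rightarrow> 'v \<Rightarrow> 'v" where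
  "left_part r s Y m x = (\<Sum>i. sbinom s i *s T (s - 1 + int r - int i) (Y (m + int i) x))"

definition right_part :: "nat \<Rightarrow> int \<Rightarrow> (int \<Rightarrow> 'v \<Rightarrow> 'v) \<Rightarrow> int \<Rightarrow> 'v \<Rightarrow> 'v" where
  "right_part r s Y m x = ((-1) powi s) *s (\<Sum>i. sbinom s i *s Y (s + m - int i) (T (int i + int r - 1) x))"

lemma T_0 [simp]: "T k 0 = 0"
  using module_hom.zero[OF T_hom] .

lemma T_add: "T k (x + y) = T k x + T k y"
  using module_hom.add[OF T_hom] .

lemma T_scale: "T k (a *s x) = a *s T k x"
  using module_hom.scale[OF T_hom] .

lemma T_sum: "T k (sum f A) = (\<Sum>i\<in>A. T k (f i))"
  using module_hom.sum[OF T_hom] .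

lemma field_hom: "is_field Y \<Longrightarrow> module_hom scale scale (Y m)"
  by (simp add: is_field_def)

lemma T_bound: obtains N :: nat where "\<And>i. N \<le> i \<Longrightarrow> T (int i - 1) x = 0"
proof -
  obtain N where N: "\<forall>n\<ge>N. T n x = 0" using T_restricted by blast
  show ?thesis by (rule that[of "nat (N + 1)"]) (use N in auto)
qed

lemma annihilated_bound:
  assumes "annihilated Y x" obtains N :: nat where "\<And>i. m + int N \<le> i \<Longrightarrow> Y i x = 0"
proof -
  obtain N where N: "\<forall>n\<ge>N. Y n x = 0" using assms annihilated_def by blast
  have "N \<le> i" if "m + int (nat (N - m)) \<le> i" for i using that by linarith
  then show ?thesis using that[of "nat (N - m)"] N by blast
qed

lemma iterate_parts:
  assumes "annihilated Y x" "\<And>n. Y n 0 = 0"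
  shows "iterate k Y m x = left_part 0 (k + 1) Y m x - right_part 0 (k + 1) Y m x"
proof -
  obtain N where N: "\<And>i. m + int N \<le> i \<Longrightarrow> Y i x = 0" using annihilated_bound assms by blast
  obtain K where K: "\<And>i. K \<le> i \<Longrightarrow> T (int i - 1) x = 0" using T_bound by blast
  define P where "P = max N K"
  have "iterate k Y m x = (\<Sum>i<P. sbinom (k + 1) i *s
     (T (k - int i) (Y (m + int i) x)
      - ((-1) powi (k + 1)) *s Y (k + 1 + m - int i) (T (int i - 1) x)))"
    unfolding iterate_def by (rule Sum_any_lessThan) (simp add: P_def N K assms(2))
  moreover have "left_part 0 (k + 1) Y m x = (\<Sum>i<P. sbinom (k + 1) i *s T (k - int i) (Y (m + int i) x))"
    unfolding left_part_def by (subst Sum_any_lessThan[of P]) (simp_all add: P_def N K assms(2))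
  moreover have "right_part 0 (k + 1) Y m x =
     ((-1) powi (k + 1)) *s (\<Sum>i<P. sbinom (k + 1) i *s Y (k + 1 + m - int i) (T (int i - 1) x))"
    unfolding right_part_def by (subst Sum_any_lessThan[of P]) (simp_all add: P_def N K assms(2))
  ultimately show ?thesis
    by (simp add: sum_subtractf[symmetric] scale_right_diff_distrib scale_sum_right mult.commute)
qed

text \<open>
  \<open>(z - w)\<^sup>s\<^sup>+\<^sup>1 = (z - w)\<^sup>s z - (z - w)\<^sup>s w\<close> in coefficients.
\<close>
lemma Sum_any_sbinom_Suc:
  assumes "\<And>i. N \<le> i \<Longrightarrow> f i = 0"
  shows "(\<Sum>i. sbinom (s + 1) i *s f i) = (\<Sum>i. sbinom s i *s f i) - (\<Sum>i. sbinom s i *s f (Suc i))"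
proof -
  have "(\<Sum>i. sbinom (s + 1) i *s f i) = (\<Sum>i<Suc N. sbinom (s + 1) i *s f i)"
    "(\<Sum>i. sbinom s i *s f i) = (\<Sum>i<Suc N. sbinom s i *s f i)"
    "(\<Sum>i. sbinom s i *s f (Suc i)) = (\<Sum>i<N. sbinom s i *s f (Suc i))"
    by (rule Sum_any_lessThan, simp add: assms)+
  then show ?thesis
    by (simp only: sum.lessThan_Suc_shift)
      (simp add: sbinom_Suc scale_left_diff_distrib sum_subtractf)
qed

lemma left_part_Suc:
  assumes "annihilated Y x" 
  shows "left_part (Suc r) s Y m x = left_part r (s + 1) Y m x + left_part r s Y (m + 1) x"
proof -
  obtain N where N: "\<And>i. m + int N \<le> i \<Longrightarrow> Y i x = 0" using annihilated_bound assms by blast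
  show ?thesis
    using Sum_any_sbinom_Suc[of N "\<lambda>i. T (s + int r - int i) (Y (m + int i) x)" s] N
    unfolding left_part_def by (simp add: algebra_simps)
qed

lemma right_part_Suc:
  assumes "\<And>n. Y n 0 = 0"
  shows "right_part (Suc r) s Y m x = right_part r (s + 1) Y m x + right_part r s Y (m + 1) x"
proof -
  obtain K where K: "\<And>i. K \<le> i \<Longrightarrow> T (int i - 1) x = 0" using T_bound by blast
  have "T (int i + int r - 1) x = 0" if "K \<le> i" for i
    using K[of "i + r"] that by simp
  then have "(\<Sum>i. sbinom (s + 1) i *s Y (s + 1 + m - int i) (T (int i + int r - 1) x))
      = (\<Sum>i. sbinom s i *s Y (s + 1 + m - int i) (T (int i + int r - 1) x))
        - (\<Sum>i. sbinom s i *s Y (s + 1 + m - int (Suc i)) (T (int (Suc i) + int r - 1) x))"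
    using assms by (intro Sum_any_sbinom_Suc[of K]) auto
  from arg_cong[OF this, of "\<lambda>v. ((-1) powi s) *s v"] show ?thesis
    unfolding right_part_def by (simp add: algebra_simps power_int_add scale_right_diff_distrib)
qed

text \<open>
  Weak associativity. By the recursion \<open>z = (z - w) + w\<close>, the difference of left and right part stays in \<open>S\<close> when a
  factor \<open>z\<^sup>r\<close> is inserted. For large \<open>r\<close> the right part vanishes on \<open>x\<close>, since \<open>z\<^sup>r T(z) x\<close> has no poles.
  The left part is \<open>T p (Y m x)\<close> plus terms with larger modes of \<open>Y\<close>, which are removed by
  downward induction on \<open>m\<close>.
\<close>
lemma operator_mode_in_iterates:
  assumes S: "subspace S" and iter: "\<And>k m. iterate k Y m x \<in> S"
    and Y: "annihilated Y x" "\<And>n. Y n 0 = 0"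
  shows "T p (Y m x) \<in> S"
proof -
  have parts: "left_part r s Y m x - right_part r s Y m x \<in> S" for r s m
  proof (induction r arbitrary: s m)
    case 0
    show ?case using iter[of "s - 1" m] iterate_parts[OF Y, of "s - 1" m] by simp
  next
    case (Suc r)
    show ?case
      unfolding left_part_Suc[OF Y(1)] right_part_Suc[of Y, OF Y(2)]
      using subspace_add[OF S Suc.IH[of "s + 1" m] Suc.IH[of s "m + 1"]] by (simp add: algebra_simps)
  qed
  obtain K where K: "\<And>i. K \<le> i \<Longrightarrow> T (int i - 1) x = 0" using T_bound by blast
  have "right_part K s Y m x = 0" for s m
  proof -
    have "T (int i + int K - 1) x = 0" for i using K[of "i + K"] by simp
    then show ?thesis by (simp add: right_part_def Y(2))
  qed
  with parts[of K] have left: "left_part K s Y m x \<in> S" for s m by (metis diff_zero)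
  obtain N where N: "\<And>i. 0 + int N \<le> i \<Longrightarrow> Y i x = 0" using annihilated_bound[OF Y(1)] by blast
  have "int N - int j \<le> m \<longrightarrow> T p (Y m x) \<in> S" for j m p
  proof (induction j arbitrary: m p)
    case 0
    show ?case using N S subspace_0 by auto
  next
    case (Suc j)
    show ?case
    proof
      assume m: "int N - int (Suc j) \<le> m"
      have "Y (m + int i) x = 0" if "Suc j \<le> i" for i
        using N[of "m + int i"] m that by simp
      then have "left_part K (p + 1 - int K) Y m x
          = (\<Sum>i<Suc j. sbinom (p + 1 - int K) i *s T (p - int i) (Y (m + int i) x))"
        unfolding left_part_def by (subst Sum_any_lessThan[of "Suc j"]) simp_all
      also have "\<dots> = T p (Y m x) + (\<Sum>i<j. sbinom (p + 1 - int K) (Suc i) *s T (p - int (Suc i)) (Y (m + int (Suc i)) x))"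
        by (simp only: sum.lessThan_Suc_shift) simp
      finally have "T p (Y m x) = left_part K (p + 1 - int K) Y m x
          - (\<Sum>i<j. sbinom (p + 1 - int K) (Suc i) *s T (p - int (Suc i)) (Y (m + int (Suc i)) x))" by simp
      also have "\<dots> \<in> S"
        using m by (intro subspace_diff[OF S] left subspace_sum[OF S] subspace_scale[OF S] Suc.IH[rule_format]) auto
      finally show "T p (Y m x) \<in> S" .
    qed
  qed
  from this[of "nat (int N - m)" m p] show ?thesis by simp
qed

end

section \<open>The Virasoro action on fields\<close>

context restricted_operators
begin

lemma field_0: "is_field Y \<Longrightarrow> Y m 0 = 0"
  using module_hom.zero[OF field_hom] .

lemma field_annihilated: "is_field Y \<Longrightarrow> annihilated Y x"
  by (simp add: is_field_def)

lemma left_part_sum: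
  assumes "\<And>i. N \<le> i \<Longrightarrow> Y (m + int i) x = 0"
  shows "left_part 0 s Y m x = (\<Sum>i<N. sbinom s i *s T (s - 1 - int i) (Y (m + int i) x))"
  unfolding left_part_def by (subst Sum_any_lessThan[of N]) (simp_all add: assms)

lemma right_part_sum:
  assumes "\<And>i. K \<le> i \<Longrightarrow> T (int i - 1) x = 0" "\<And>n. Y n 0 = 0"
  shows "right_part 0 s Y m x =
    ((-1) powi s) *s (\<Sum>i<K. sbinom s i *s Y (s + m - int i) (T (int i - 1) x))"
  unfolding right_part_def by (subst Sum_any_lessThan[of K]) (simp_all add: assms)

lemma iterate_field:
  assumes "is_field Y"
  shows "iterate k Y m x = left_part 0 (k + 1) Y m x - right_part 0 (k + 1) Y m x"
  by (rule iterate_parts) (simp_all add: assms field_0 field_annihilated)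

lemma is_field_left_part:
  assumes Y: "is_field Y"
  shows "is_field (left_part 0 s Y)"
  unfolding is_field_def
proof (intro conjI allI)
  fix m
  show "module_hom scale scale (left_part 0 s Y m)"
  proof (unfold_locales)
    fix x y :: 'v and a
    obtain N where N: "\<And>i. m + int N \<le> i \<Longrightarrow> Y i x = 0"
      using annihilated_bound[OF field_annihilated[OF Y]] by blast
    obtain N' where N': "\<And>i. m + int N' \<le> i \<Longrightarrow> Y i y = 0"
      using annihilated_bound[OF field_annihilated[OF Y]] by blast
    let ?P = "max N N'"
    note hom = module_hom.add[OF field_hom[OF Y]] module_hom.scale[OF field_hom[OF Y]]
    show "left_part 0 s Y m (x + y) = left_part 0 s Y m x + left_part 0 s Y m y"
      by (simp add: left_part_sum[of ?P] N N' hom T_add scale_right_distrib sum.distrib)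
    show "left_part 0 s Y m (a *s x) = a *s left_part 0 s Y m x"
      by (simp add: left_part_sum[of ?P] N N' hom T_scale scale_sum_right mult.commute)
  qed
next
  fix x
  obtain N where N: "\<And>i. 0 + int N \<le> i \<Longrightarrow> Y i x = 0"
    using annihilated_bound[OF field_annihilated[OF Y]] by blast
  show "annihilated (left_part 0 s Y) x"
    unfolding annihilated_def
    by (intro exI[of _ "int N"]) (simp add: left_part_sum[of 0] N)
qed

lemma is_field_right_part:
  assumes Y: "is_field Y"
  shows "is_field (right_part 0 s Y)"
  unfolding is_field_def
proof (intro conjI allI)
  note hom = module_hom.add[OF field_hom[OF Y]] module_hom.scale[OF field_hom[OF Y]]
  fix m
  show "module_hom scale scale (right_part 0 s Y m)"
  proof (unfold_locales)
    fix x y :: 'v and a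
    obtain N where N: "\<And>i. N \<le> i \<Longrightarrow> T (int i - 1) x = 0" using T_bound by blast
    obtain N' where N': "\<And>i. N' \<le> i \<Longrightarrow> T (int i - 1) y = 0" using T_bound by blast
    let ?P = "max N N'"
    show "right_part 0 s Y m (x + y) = right_part 0 s Y m x + right_part 0 s Y m y"
      by (simp add: right_part_sum[of ?P] N N' hom T_add scale_right_distrib sum.distrib field_0[OF Y])
    show "right_part 0 s Y m (a *s x) = a *s right_part 0 s Y m x"
      by (simp add: right_part_sum[of ?P] N N' hom T_scale scale_sum_right mult.commute mult.left_commute field_0[OF Y])
  qed
next
  fix x
  obtain K where K: "\<And>i. K \<le> i \<Longrightarrow> T (int i - 1) x = 0" using T_bound by blast
  have "\<forall>i. \<exists>N::nat. \<forall>n. 0 + int N \<le> n \<longrightarrow> Y n (T (int i - 1) x) = 0"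
    using annihilated_bound[OF field_annihilated[OF Y]] by metis
  then obtain N where N: "\<And>i n. int (N i) \<le> n \<Longrightarrow> Y n (T (int i - 1) x) = 0" by auto metis
  have "right_part 0 s Y m x = 0" if m: "int (\<Sum>i<K. N i) + int K - s \<le> m" for m
  proof -
    have "Y (s + m - int i) (T (int i - 1) x) = 0" if "i < K" for i
    proof (rule N)
      have "N i \<le> (\<Sum>i<K. N i)" using that by (intro member_le_sum) auto
      then show "int (N i) \<le> s + m - int i" using m that by linarith
    qed
    then show ?thesis by (simp add: right_part_sum[of K] K field_0[OF Y])
  qed
  then show "annihilated (right_part 0 s Y) x" unfolding annihilated_def by blast
qed

lemma is_field_iterate:
  assumes Y: "is_field Y"
  shows "is_field (iterate k Y)"
proof -
  note L = is_field_left_part[OF Y, of "k + 1"] and R = is_field_right_part[OF Y, of "k + 1"]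
  have eq: "iterate k Y = (\<lambda>m x. left_part 0 (k + 1) Y m x - right_part 0 (k + 1) Y m x)"
    using iterate_field[OF Y] by blast
  show ?thesis unfolding is_field_def
  proof (intro conjI allI)
    fix m
    show "module_hom scale scale (iterate k Y m)"
      unfolding eq
      by (unfold_locales)
        (simp_all add: module_hom.add[OF field_hom[OF L]] module_hom.add[OF field_hom[OF R]]
          module_hom.scale[OF field_hom[OF L]] module_hom.scale[OF field_hom[OF R]] scale_right_diff_distrib)
    fix x
    obtain N1 where N1: "\<forall>m\<ge>N1. left_part 0 (k + 1) Y m x = 0"
      using field_annihilated[OF L] annihilated_def by blast
    obtain N2 where N2: "\<forall>m\<ge>N2. right_part 0 (k + 1) Y m x = 0"
      using field_annihilated[OF R] annihilated_def by blast
    show "annihilated (iterate k Y) x"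
      unfolding annihilated_def eq by (intro exI[of _ "max N1 N2"]) (simp add: N1 N2)
  qed
qed

text \<open>
  Composition with an operator on the left commutes with composition on the right; the only issue is a
  common truncation of the two sums.
\<close>
lemma left_right_commute:
  assumes Y: "is_field Y"
  shows "left_part 0 s (right_part 0 t Y) m x = right_part 0 t (left_part 0 s Y) m x"
proof -
  obtain K where K: "\<And>i. K \<le> i \<Longrightarrow> T (int i - 1) x = 0" using T_bound by blast
  have "\<forall>j. \<exists>N::nat. \<forall>n. (t + m - int j) + int N \<le> n \<longrightarrow> Y n (T (int j - 1) x) = 0"
    using annihilated_bound[OF field_annihilated[OF Y]] by metis
  then obtain N where N: "\<And>j n. (t + m - int j) + int (N j) \<le> n \<Longrightarrow> Y n (T (int j - 1) x) = 0"
    by metis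
  obtain M where M: "\<And>i. m + int M \<le> i \<Longrightarrow> right_part 0 t Y i x = 0"
    using annihilated_bound[OF field_annihilated[OF is_field_right_part[OF Y]]] by blast
  \<comment> \<open>a truncation of the outer sum that works for all j < K at once\<close>
  define P where "P = max M (\<Sum>j<K. N j)"
  have P: "N j \<le> P" if "j < K" for j
  proof -
    have "N j \<le> (\<Sum>i<K. N i)" using that by (intro member_le_sum) auto
    then show ?thesis unfolding P_def by simp
  qed
  have "left_part 0 s (right_part 0 t Y) m x
      = (\<Sum>i<P. sbinom s i *s T (s - 1 - int i) (right_part 0 t Y (m + int i) x))"
    by (rule left_part_sum) (rule M, simp add: P_def)
  also have "\<dots> = (\<Sum>i<P. \<Sum>j<K. (sbinom s i * ((-1) powi t * sbinom t j)) *s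
      T (s - 1 - int i) (Y (t + (m + int i) - int j) (T (int j - 1) x)))"
    by (simp add: right_part_sum[of K] K field_0[OF Y] T_scale T_sum scale_sum_right mult.assoc)
  also have "\<dots> = (\<Sum>j<K. \<Sum>i<P. (sbinom s i * ((-1) powi t * sbinom t j)) *s
      T (s - 1 - int i) (Y (t + (m + int i) - int j) (T (int j - 1) x)))"
    by (rule sum.swap)
  also have "\<dots> = ((-1) powi t) *s (\<Sum>j<K. sbinom t j *s (left_part 0 s Y (t + m - int j) (T (int j - 1) x)))"
  proof -
    have "left_part 0 s Y (t + m - int j) (T (int j - 1) x)
      = (\<Sum>i<P. sbinom s i *s T (s - 1 - int i) (Y (t + m - int j + int i) (T (int j - 1) x)))"
      if "j < K" for j
      by (rule left_part_sum) (rule N, use P[OF that] in simp)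
    then show ?thesis
      by (simp add: scale_sum_right mult_ac algebra_simps)
  qed
  also have "\<dots> = right_part 0 t (left_part 0 s Y) m x"
    by (rule right_part_sum[symmetric]) (simp_all add: K field_0[OF is_field_left_part[OF Y]])
  finally show ?thesis .
qed

lemma iterate_lincomb:
  assumes "is_field Y" "is_field Y1" "is_field Y2" "is_field Y3"
    and "\<And>m x. Y m x = Y1 m x + (a *s Y2 m x + b *s Y3 m x)"
  shows "iterate k Y m x = iterate k Y1 m x + (a *s iterate k Y2 m x + b *s iterate k Y3 m x)"
proof -
  obtain N1 where N1: "\<And>i. m + int N1 \<le> i \<Longrightarrow> Y1 i x = 0" using annihilated_bound field_annihilated assms by metis
  obtain N2 where N2: "\<And>i. m + int N2 \<le> i \<Longrightarrow> Y2 i x = 0" using annihilated_bound field_annihilated assms by metis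
  obtain N3 where N3: "\<And>i. m + int N3 \<le> i \<Longrightarrow> Y3 i x = 0" using annihilated_bound field_annihilated assms by metis
  obtain K where K: "\<And>i. K \<le> i \<Longrightarrow> T (int i - 1) x = 0" using T_bound by blast
  define P where "P = N1 + N2 + N3"
  have z: "Y1 (m + int i) x = 0" "Y2 (m + int i) x = 0" "Y3 (m + int i) x = 0" if "P \<le> i" for i
    using that N1[of "m + int i"] N2[of "m + int i"] N3[of "m + int i"] by (auto simp: P_def)
  then have "Y (m + int i) x = 0" if "P \<le> i" for i using that by (simp add: assms(5))
  note l = left_part_sum[of P Y1 m x, OF z(1)] left_part_sum[of P Y2 m x, OF z(2)]
    left_part_sum[of P Y3 m x, OF z(3)] left_part_sum[of P Y m x, OF this]
  have "left_part 0 (k + 1) Y m x = left_part 0 (k + 1) Y1 m x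
      + (a *s left_part 0 (k + 1) Y2 m x + b *s left_part 0 (k + 1) Y3 m x)"
    by (simp add: l assms(5) T_add T_scale scale_right_distrib
        sum.distrib scale_sum_right mult.commute)
  moreover have "right_part 0 (k + 1) Y m x = right_part 0 (k + 1) Y1 m x
      + (a *s right_part 0 (k + 1) Y2 m x + b *s right_part 0 (k + 1) Y3 m x)"
    using assms(1-4)[THEN field_0]
    by (simp add: right_part_sum[of K] K assms(5) scale_right_distrib
        sum.distrib scale_sum_right mult_ac)
  ultimately show ?thesis
    unfolding assms(1-4)[THEN iterate_field] by (simp add: scale_right_diff_distrib)
qed

definition vacuum_field :: "int \<Rightarrow> 'v \<Rightarrow> 'v" where
  "vacuum_field m x = (if m = -1 then x else 0)"

lemma is_field_vacuum: "is_field vacuum_field"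
  unfolding is_field_def annihilated_def vacuum_field_def
proof (intro conjI allI)
  show "module_hom scale scale (\<lambda>x. if m = -1 then x else 0)" for m :: int
    by unfold_locales auto
  show "\<exists>N. \<forall>m\<ge>N. (if m = (-1::int) then x else 0) = 0" for x :: 'v
    by (rule exI[of _ "0::int"]) auto
qed

text \<open>
  For \<open>k + 1 \<ge> 0\<close> the two expansions of \<open>(z - w)\<^sup>k\<^sup>+\<^sup>1\<close> agree, so that the left and the right part are equal: this
  is the symmetry of the binomial coefficients.
\<close>
lemma iterate_vacuum:
  assumes "-1 \<le> k"
  shows "iterate k vacuum_field m x = 0"
proof -
  obtain K where K: "\<And>i. K \<le> i \<Longrightarrow> T (int i - 1) x = 0" using T_bound by blast
  define s where "s = nat (k + 1)"
  have s: "k + 1 = int s" using assms s_def by simp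
  have [simp]: "T j (if b then x else 0) = (if b then T j x else 0)" for b j by simp
  have b: "sbinom (int s) i = (-1) ^ i * of_nat (s choose i)" for i
    by (simp add: sbinom_def binomial_gbinomial)
  have left: "left_part 0 (int s) vacuum_field m x
      = (if m \<le> -1 then sbinom (int s) (nat (- 1 - m)) *s T (int s + m) x else 0)"
  proof (cases "m \<le> -1")
    case True
    have "left_part 0 (int s) vacuum_field m x
      = (\<Sum>i<Suc (nat (-1 - m)). sbinom (int s) i *s T (int s - 1 - int i) (vacuum_field (m + int i) x))"
      by (rule left_part_sum) (auto simp: vacuum_field_def)
    also have "\<dots> = (\<Sum>i<Suc (nat (-1 - m)). if i = nat (-1 - m) then sbinom (int s) i *s T (int s - 1 - int i) x else 0)"
      by (intro sum.cong refl) (use True in \<open>auto simp: vacuum_field_def\<close>)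
    also have "\<dots> = sbinom (int s) (nat (- 1 - m)) *s T (int s + m) x"
      using True by (simp add: algebra_simps)
    finally show ?thesis using True by simp
  next
    case False
    then show ?thesis by (subst left_part_sum[of 0]) (auto simp: vacuum_field_def)
  qed
  have right: "right_part 0 (int s) vacuum_field m x
      = (if - 1 \<le> int s + m then ((-1) ^ s * sbinom (int s) (nat (int s + m + 1))) *s T (int s + m) x else 0)"
  proof (cases "- 1 \<le> int s + m")
    case True
    define n where "n = nat (int s + m + 1)"
    have n: "int n = int s + m + 1" using True n_def by simp
    define P where "P = max K (Suc n)"
    have "right_part 0 (int s) vacuum_field m x
      = ((-1) powi int s) *s (\<Sum>i<P. sbinom (int s) i *s vacuum_field (int s + m - int i) (T (int i - 1) x))"
      by (rule right_part_sum) (auto simp: vacuum_field_def P_def K)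
    also have "(\<Sum>i<P. sbinom (int s) i *s vacuum_field (int s + m - int i) (T (int i - 1) x))
      = (\<Sum>i<P. if i = n then sbinom (int s) i *s T (int i - 1) x else 0)"
      by (intro sum.cong refl) (use n in \<open>auto simp: vacuum_field_def\<close>)
    also have "\<dots> = sbinom (int s) n *s T (int s + m) x"
    proof -
      have "n < P" "int n - 1 = int s + m" using n by (auto simp: P_def)
      then show ?thesis by simp
    qed
    finally show ?thesis using True n_def by simp
  next
    case False
    then have "vacuum_field (int s + m - int i) (T (int i - 1) x) = 0" for i
      by (simp add: vacuum_field_def)
    then show ?thesis using False
      by (subst right_part_sum[of K]) (auto simp: K vacuum_field_def)
  qed
  have "left_part 0 (int s) vacuum_field m x = right_part 0 (int s) vacuum_field m x"
  proof (cases "m \<le> -1 \<and> -1 \<le> int s + m")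
    case True
    define n where "n = nat (- 1 - m)"
    show ?thesis
    proof (cases "n \<le> s")
      case True': True
      have "int n = - 1 - m" using True n_def by simp
      then have e: "nat (int s + m + 1) = s - n" using True' by linarith
      have "(-1::complex) ^ s * (-1) ^ (s - n) = (-1) ^ n"
        using True' by (metis (no_types, opaque_lifting) add.commute le_add_diff_inverse2 minus_one_power_iff odd_add power_add mult_minus1 mult.right_neutral mult_minus1_right minus_minus)
      then show ?thesis unfolding left right e n_def[symmetric]
        using True binomial_symmetric[OF True'] by (simp add: b mult.assoc[symmetric])
    qed (use True n_def in auto)
  next
    case False
    then show ?thesis unfolding left right by (auto simp: b)
  qed
  then show ?thesis unfolding iterate_field[OF is_field_vacuum] s by simp
qed


end

text \<open>
  The central element is an operator \<open>Z\<close> and not a scalar, because the operators will be obtained by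
  composing with a projection \<open>\<pi>\<close> and then satisfy the relations on the whole type with \<open>Z\<close> equal to
  \<open>c \<pi>\<close>.
\<close>
locale restricted_virasoro = restricted_operators scale T
  for scale :: "complex \<Rightarrow> 'v::ab_group_add \<Rightarrow> 'v" (infixr \<open>*s\<close> 75) and T +
  fixes Z :: "'v \<Rightarrow> 'v"
  assumes Z_hom: "module_hom scale scale Z"
    and bracket: "T k (T l x) = T l (T k x) + (of_int (k - l) *s T (k + l) x
       + (if k + l = 0 then vir_cocycle k *s Z x else 0))"
    and Z_T: "Z (T k x) = T k (Z x)"
begin

lemma left_part_bracket:
  assumes Y: "is_field Y"
  shows "left_part 0 (k + 1) (left_part 0 (l + 1) Y) m x = left_part 0 (l + 1) (left_part 0 (k + 1) Y) m x
    + (of_int (k - l) *s left_part 0 (k + l + 1) Y m x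
       + (if k + l = 0 then vir_cocycle k *s Z (Y m x) else 0))"
proof -
  obtain N where N': "\<And>i. m + int N \<le> i \<Longrightarrow> Y i x = 0"
    using annihilated_bound[OF field_annihilated[OF Y]] by blast
  then have N: "Y (m + int i) x = 0" if "N \<le> i" for i using that by simp
  have ll: "left_part 0 (k + 1) (left_part 0 (l + 1) Y) m x
     = (\<Sum>n<2*N. \<Sum>i\<le>n. (sbinom (k + 1) i * sbinom (l + 1) (n - i)) *s
          T (k - int i) (T (l - int (n - i)) (Y (m + int n) x)))" for k l
  proof -
    have i: "left_part 0 (l + 1) Y (m + int i) x
        = (\<Sum>j<N. sbinom (l + 1) j *s T (l + 1 - 1 - int j) (Y (m + int i + int j) x))" for i
      by (rule left_part_sum) (use N[of "i + _"] in \<open>simp add: algebra_simps\<close>)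
    have i0: "left_part 0 (l + 1) Y (m + int i) x = 0" if "N \<le> i" for i
      unfolding i using N[of "i + _"] that by (simp add: algebra_simps)
    have "left_part 0 (k + 1) (left_part 0 (l + 1) Y) m x
        = (\<Sum>i<N. \<Sum>j<N. (sbinom (k + 1) i * sbinom (l + 1) j) *s
          T (k - int i) (T (l - int j) (Y (m + int (i + j)) x)))"
      by (subst left_part_sum[of N], rule i0, assumption)
        (simp add: i T_sum T_scale scale_sum_right add.assoc)
    also have "\<dots> = (\<Sum>n<2*N. \<Sum>i\<le>n. (sbinom (k + 1) i * sbinom (l + 1) (n - i)) *s
          T (k - int i) (T (l - int (n - i)) (Y (m + int (i + (n - i))) x)))"
      by (rule sum_square_triangle) (auto simp: N simp del: of_nat_add)
    finally show ?thesis by simp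
  qed
  have single: "left_part 0 (k + l + 1) Y m x = (\<Sum>n<2*N. sbinom (k + l + 1) n *s T (k + l - int n) (Y (m + int n) x))"
    by (subst left_part_sum[of "2 * N"]) (simp_all add: N)
  \<comment> \<open>central terms occur for n = k + l only, and there the cocycle sum vanishes unless n = 0\<close>
  have cent: "(\<Sum>n<2*N. if k + l = int n then (if n = 0 then vir_cocycle k else 0) *s Z (Y (m + int n) x) else 0)
     = (if k + l = 0 then vir_cocycle k *s Z (Y m x) else 0)"
  proof -
    have "(\<Sum>n<2*N. if k + l = int n then (if n = 0 then vir_cocycle k else 0) *s Z (Y (m + int n) x) else 0)
      = (\<Sum>n<2*N. if n = 0 then (if k + l = 0 then vir_cocycle k *s Z (Y m x) else 0) else 0)"
      by (intro sum.cong) auto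
    also have "\<dots> = (if k + l = 0 then vir_cocycle k *s Z (Y m x) else 0)"
      using N[of 0] module_hom.zero[OF Z_hom] by (cases "N = 0") auto
    finally show ?thesis .
  qed
  have "(\<Sum>i\<le>n. (sbinom (k + 1) i * sbinom (l + 1) (n - i)) *s T (k - int i) (T (l - int (n - i)) y))
     = (\<Sum>i\<le>n. (sbinom (l + 1) i * sbinom (k + 1) (n - i)) *s T (l - int i) (T (k - int (n - i)) y))
       + ((of_int (k - l) * sbinom (k + l + 1) n) *s T (k + l - int n) y
         + (if k + l = int n then (if n = 0 then vir_cocycle k else 0) *s Z y else 0))" for n y
  proof -
    have "(\<Sum>i\<le>n. (sbinom (k + 1) i * sbinom (l + 1) (n - i)) *s T (k - int i) (T (l - int (n - i)) y))
      = (\<Sum>i\<le>n. (sbinom (k + 1) i * sbinom (l + 1) (n - i)) *s T (l - int (n - i)) (T (k - int i) y))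
        + ((\<Sum>i\<le>n. (sbinom (k + 1) i * sbinom (l + 1) (n - i) * of_int ((k - int i) - (l - int (n - i)))) *s
             T (k + l - int n) y)
        + (if k + l = int n then (\<Sum>i\<le>n. (sbinom (k + 1) i * sbinom (l + 1) (n - i) * vir_cocycle (k - int i)) *s Z y) else 0))"
    proof -
      have "(sbinom (k + 1) i * sbinom (l + 1) (n - i)) *s T (k - int i) (T (l - int (n - i)) y)
        = (sbinom (k + 1) i * sbinom (l + 1) (n - i)) *s T (l - int (n - i)) (T (k - int i) y)
        + ((sbinom (k + 1) i * sbinom (l + 1) (n - i) * of_int ((k - int i) - (l - int (n - i)))) *s T (k + l - int n) y
        + (if k + l = int n then (sbinom (k + 1) i * sbinom (l + 1) (n - i) * vir_cocycle (k - int i)) *s Z y else 0))"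
        if "i \<le> n" for i
      proof -
        have e: "k - int i + (l - int (n - i)) = k + l - int n" using that by simp
        have e': "k + l - int n = 0 \<longleftrightarrow> k + l = int n" by simp
        show ?thesis
          unfolding bracket[of "k - int i" "l - int (n - i)" y] e e'
          by (simp only: scale_right_distrib scale_scale scale_zero_right if_distrib[of "scale _"] cong: if_cong)
      qed
      then show ?thesis by (simp add: sum.distrib)
    qed
    also have "(\<Sum>i\<le>n. (sbinom (k + 1) i * sbinom (l + 1) (n - i)) *s T (l - int (n - i)) (T (k - int i) y))
      = (\<Sum>i\<le>n. (sbinom (l + 1) i * sbinom (k + 1) (n - i)) *s T (l - int i) (T (k - int (n - i)) y))"
      by (subst sum_rev_atMost) (simp add: mult.commute)
    finally show ?thesis
      by (simp only: scale_sum_left[symmetric] sbinom_witt_comp sbinom_cocycle cong: if_cong)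
  qed
  then show ?thesis
    unfolding ll single cent[symmetric] by (simp add: sum.distrib scale_sum_right mult_ac)
qed

lemma right_part_bracket:
  assumes Y: "is_field Y"
  shows "right_part 0 (k + 1) (right_part 0 (l + 1) Y) m x = right_part 0 (l + 1) (right_part 0 (k + 1) Y) m x
    - of_int (k - l) *s right_part 0 (k + l + 1) Y m x"
proof -
  obtain K where K: "\<And>i. K \<le> i \<Longrightarrow> T (int i - 1) x = 0" using T_bound by blast
  have "\<forall>i. \<exists>N::nat. \<forall>j\<ge>N. T (int j - 1) (T (int i - 1) x) = 0"
    using T_bound by metis
  then obtain M where M: "\<And>i j. M i \<le> j \<Longrightarrow> T (int j - 1) (T (int i - 1) x) = 0" by metis
  define N where "N = Suc (max K (\<Sum>i<K. M i))"
  have N2: "T (int j - 1) (T (int i - 1) x) = 0" if "N \<le> j" for i j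
  proof (cases "i < K")
    case True
    then have "M i \<le> (\<Sum>i<K. M i)" by (intro member_le_sum) auto
    then show ?thesis using that by (intro M) (simp add: N_def)
  qed (simp add: K)
  have N1: "T (int i - 1) x = 0" if "N \<le> i" for i
    using that by (intro K) (simp add: N_def)
  note Yhom = field_hom[OF Y] and Y0 = field_0[OF Y]
  have ll: "right_part 0 (k + 1) (right_part 0 (l + 1) Y) m x
     = (((-1) powi (k + l))) *s (\<Sum>n<2*N. \<Sum>i\<le>n. (sbinom (k + 1) i * sbinom (l + 1) (n - i)) *s
          Y (k + l + 2 + m - int n) (T (int (n - i) - 1) (T (int i - 1) x)))" for k l
  proof -
    have "right_part 0 (k + 1) (right_part 0 (l + 1) Y) m x
      = ((-1) powi (k + 1)) *s (\<Sum>i<N. sbinom (k + 1) i *s ((-1) powi (l + 1)) *s (\<Sum>j<N. sbinom (l + 1) j *s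
          Y (l + 1 + (k + 1 + m - int i) - int j) (T (int j - 1) (T (int i - 1) x))))"
      by (simp add: right_part_sum[of N] N1 N2 Y0 field_0[OF is_field_right_part[OF Y]])
    also have "\<dots> = ((-1) powi (k + l)) *s (\<Sum>i<N. \<Sum>j<N. (sbinom (k + 1) i * sbinom (l + 1) j) *s
          Y (k + l + 2 + m - int (i + j)) (T (int j - 1) (T (int i - 1) x)))"
      by (simp add: scale_sum_right power_int_add algebra_simps)
    also have "(\<Sum>i<N. \<Sum>j<N. (sbinom (k + 1) i * sbinom (l + 1) j) *s
          Y (k + l + 2 + m - int (i + j)) (T (int j - 1) (T (int i - 1) x)))
      = (\<Sum>n<2*N. \<Sum>i\<le>n. (sbinom (k + 1) i * sbinom (l + 1) (n - i)) *s
          Y (k + l + 2 + m - int (i + (n - i))) (T (int (n - i) - 1) (T (int i - 1) x)))"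
      by (rule sum_square_triangle) (auto simp: N1 N2 Y0)
    finally show ?thesis by simp
  qed
  have single: "right_part 0 (k + l + 1) Y m x = - (((-1) powi (k + l)) *s
    (\<Sum>n<2*N. (if n = 0 then 0 else sbinom (k + l + 1) (n - 1)) *s Y (k + l + 2 + m - int n) (T (int n - 2) x)))"
  proof -
    have N': "2 * N = Suc (2 * N - 1)" by (simp add: N_def)
    have "right_part 0 (k + l + 1) Y m x = ((-1) powi (k + l + 1)) *s
       (\<Sum>n<2*N-1. sbinom (k + l + 1) n *s Y (k + l + 1 + m - int n) (T (int n - 1) x))"
      by (rule right_part_sum) (auto simp: Y0 intro!: N1)
    also have "(\<Sum>n<2*N-1. sbinom (k + l + 1) n *s Y (k + l + 1 + m - int n) (T (int n - 1) x))
       = (\<Sum>n<2*N. (if n = 0 then 0 else sbinom (k + l + 1) (n - 1)) *s Y (k + l + 2 + m - int n) (T (int n - 2) x))"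
      by (subst N', subst sum.lessThan_Suc_shift) (simp add: algebra_simps)
    finally show ?thesis by (simp add: power_int_add)
  qed
  have "(\<Sum>i\<le>n. (sbinom (k + 1) i * sbinom (l + 1) (n - i)) *s Y q (T (int (n - i) - 1) (T (int i - 1) x)))
     = (\<Sum>i\<le>n. (sbinom (l + 1) i * sbinom (k + 1) (n - i)) *s Y q (T (int (n - i) - 1) (T (int i - 1) x)))
       + of_int (k - l) *s (if n = 0 then 0 else sbinom (k + l + 1) (n - 1)) *s Y q (T (int n - 2) x)" for n q
  proof -
    have "(sbinom (k + 1) i * sbinom (l + 1) (n - i)) *s Y q (T (int (n - i) - 1) (T (int i - 1) x))
       = (sbinom (k + 1) i * sbinom (l + 1) (n - i)) *s Y q (T (int i - 1) (T (int (n - i) - 1) x))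
       + (sbinom (k + 1) i * sbinom (l + 1) (n - i) * of_int (int (n - i) - int i)) *s Y q (T (int n - 2) x)"
      if "i \<le> n" for i
    proof -
      have idx: "int (n - i) - 1 + (int i - 1) = int n - 2" "int (n - i) - 1 - (int i - 1) = int (n - i) - int i"
        using that by simp_all
      \<comment> \<open>n = 2 leaves the modes -1, 0, 1 only, on which the cocycle vanishes\<close>
      have "vir_cocycle (int (n - i) - 1) = 0" if "int n - 2 = 0"
      proof -
        have "n - i = 0 \<or> n - i = 1 \<or> n - i = 2" using that by linarith
        then show ?thesis by (auto simp: vir_cocycle_def)
      qed
      then have "T (int (n - i) - 1) (T (int i - 1) x) = T (int i - 1) (T (int (n - i) - 1) x)
        + of_int (int (n - i) - int i) *s T (int n - 2) x"
        unfolding bracket[of "int (n - i) - 1" "int i - 1" x] idx by simp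
      then show ?thesis
        by (simp add: module_hom.add[OF Yhom] module_hom.scale[OF Yhom] scale_right_distrib)
    qed
    then have "(\<Sum>i\<le>n. (sbinom (k + 1) i * sbinom (l + 1) (n - i)) *s Y q (T (int (n - i) - 1) (T (int i - 1) x)))
      = (\<Sum>i\<le>n. (sbinom (k + 1) i * sbinom (l + 1) (n - i)) *s Y q (T (int i - 1) (T (int (n - i) - 1) x)))
      + (\<Sum>i\<le>n. sbinom (k + 1) i * sbinom (l + 1) (n - i) * of_int (int (n - i) - int i)) *s Y q (T (int n - 2) x)"
      by (simp add: sum.distrib scale_sum_left)
    also have "(\<Sum>i\<le>n. (sbinom (k + 1) i * sbinom (l + 1) (n - i)) *s Y q (T (int i - 1) (T (int (n - i) - 1) x)))
      = (\<Sum>i\<le>n. (sbinom (l + 1) i * sbinom (k + 1) (n - i)) *s Y q (T (int (n - i) - 1) (T (int i - 1) x)))"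
      by (subst sum_rev_atMost) (simp add: mult.commute)
    finally show ?thesis unfolding sbinom_witt by simp
  qed
  then have swap: "(\<Sum>n<2*N. \<Sum>i\<le>n. (sbinom (k + 1) i * sbinom (l + 1) (n - i)) *s
          Y (k + l + 2 + m - int n) (T (int (n - i) - 1) (T (int i - 1) x)))
     = (\<Sum>n<2*N. \<Sum>i\<le>n. (sbinom (l + 1) i * sbinom (k + 1) (n - i)) *s
          Y (k + l + 2 + m - int n) (T (int (n - i) - 1) (T (int i - 1) x)))
     + of_int (k - l) *s (\<Sum>n<2*N. (if n = 0 then 0 else sbinom (k + l + 1) (n - 1)) *s
          Y (k + l + 2 + m - int n) (T (int n - 2) x))"
    by (simp only: sum.distrib scale_sum_right)
  show ?thesis
    unfolding ll single swap add.commute[of l k]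
    by (simp only: scale_right_distrib scale_left_commute[of "of_int (k - l)"] scale_minus_right diff_minus_eq_add)
qed

text \<open>
  Left and right parts commute, so the commutator is that of the left parts plus that of the right parts. The
  central term comes from the left parts alone: in the right parts only modes \<open>-1, 0, 1\<close> of \<open>T\<close> can
  produce it, and there the cocycle vanishes.
\<close>
lemma iterate_bracket:
  assumes Y: "is_field Y"
  shows "iterate k (iterate l Y) m x = iterate l (iterate k Y) m x
    + (of_int (k - l) *s iterate (k + l) Y m x
       + (if k + l = 0 then vir_cocycle k *s Z (Y m x) else 0))"
proof -
  note L = is_field_left_part[OF Y] and R = is_field_right_part[OF Y]
  have ii: "iterate k (iterate l Y) m x = left_part 0 (k + 1) (left_part 0 (l + 1) Y) m x
      - left_part 0 (k + 1) (right_part 0 (l + 1) Y) m x - left_part 0 (l + 1) (right_part 0 (k + 1) Y) m x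
      + right_part 0 (k + 1) (right_part 0 (l + 1) Y) m x" for k l
  proof -
    have "iterate k (iterate l Y) m x
        = iterate k (left_part 0 (l + 1) Y) m x + ((-1) *s iterate k (right_part 0 (l + 1) Y) m x + 0 *s iterate k Y m x)"
      by (rule iterate_lincomb[OF is_field_iterate[OF Y] L R Y]) (simp add: iterate_field[OF Y])
    then show ?thesis
      using iterate_field[OF L, of k "l + 1" m x] iterate_field[OF R, of k "l + 1" m x]
        left_right_commute[OF Y, of "l + 1" "k + 1" m x] by simp
  qed
  have "k + (l + 1) = k + l + 1" by simp
  then show ?thesis
    unfolding ii left_part_bracket[OF Y, of k l] right_part_bracket[OF Y, of k l] iterate_field[OF Y]
    by (simp add: scale_right_diff_distrib)
qed

definition letter_field :: "vir_basis \<Rightarrow> (int \<Rightarrow> 'v \<Rightarrow> 'v) \<Rightarrow> int \<Rightarrow> 'v \<Rightarrow> 'v" where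
  "letter_field p Y = (case p of Lgen k \<Rightarrow> iterate k Y | Cgen \<Rightarrow> (\<lambda>m x. Z (Y m x)))"

primrec word_field :: "vir_basis list \<Rightarrow> int \<Rightarrow> 'v \<Rightarrow> 'v" where
  "word_field [] = vacuum_field"
| "word_field (p # w) = letter_field p (word_field w)"

lemma is_field_letter: 
  assumes "is_field Y" shows "is_field (letter_field p Y)"
proof (cases p)
  case Cgen
  note hom = module_hom.add[OF field_hom[OF assms]] module_hom.scale[OF field_hom[OF assms]]
    module_hom.add[OF Z_hom] module_hom.scale[OF Z_hom] module_hom.zero[OF Z_hom]
  have "module_hom scale scale (\<lambda>x. Z (Y m x))" for m
    by unfold_locales (simp_all add: hom)
  moreover have "annihilated (\<lambda>m x. Z (Y m x)) x" for x
    using field_annihilated[OF assms, of x] hom(5) by (metis annihilated_def)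
  ultimately show ?thesis using Cgen by (simp add: letter_field_def is_field_def)
qed (use assms in \<open>simp add: letter_field_def is_field_iterate\<close>)

lemma is_field_word: "is_field (word_field w)"
  by (induction w) (simp_all add: is_field_vacuum is_field_letter)

lemma letter_field_lincomb:
  assumes "is_field Y" "is_field Y1" "is_field Y2" "is_field Y3"
    and "\<And>m x. Y m x = Y1 m x + (a *s Y2 m x + b *s Y3 m x)"
  shows "letter_field p Y m x = letter_field p Y1 m x + (a *s letter_field p Y2 m x + b *s letter_field p Y3 m x)"
proof (cases p)
  case (Lgen k)
  show ?thesis unfolding letter_field_def Lgen vir_basis.case by (rule iterate_lincomb[OF assms])
next
  case Cgen
  show ?thesis unfolding letter_field_def Cgen vir_basis.case assms(5)
    by (simp only: module_hom.add[OF Z_hom] module_hom.scale[OF Z_hom])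
qed

lemma word_field_lincomb:
  assumes "\<And>m x. word_field u m x = word_field u1 m x + (a *s word_field u2 m x + b *s word_field u3 m x)"
  shows "word_field (s @ u) m x = word_field (s @ u1) m x
     + (a *s word_field (s @ u2) m x + b *s word_field (s @ u3) m x)"
proof (induction s arbitrary: m x)
  case (Cons p s)
  show ?case
    using letter_field_lincomb[OF is_field_word is_field_word is_field_word is_field_word Cons.IH] by simp
qed (simp add: assms)

text \<open>
  This and the next lemmas say that the field of a word depends only on the element of the vacuum
  module that the word represents.
\<close>
lemma word_field_bracket:
  "word_field (s @ Lgen k # Lgen l # t) m x = word_field (s @ Lgen l # Lgen k # t) m x
     + (of_int (k - l) *s word_field (s @ Lgen (k + l) # t) m x
       + (if k + l = 0 then vir_cocycle k else 0) *s word_field (s @ Cgen # t) m x)"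
proof (rule word_field_lincomb)
  fix m x
  show "word_field (Lgen k # Lgen l # t) m x = word_field (Lgen l # Lgen k # t) m x
     + (of_int (k - l) *s word_field (Lgen (k + l) # t) m x
       + (if k + l = 0 then vir_cocycle k else 0) *s word_field (Cgen # t) m x)"
    using iterate_bracket[OF is_field_word, of k l t m x] by (simp add: letter_field_def)
qed

lemma iterate_Z:
  assumes Y: "is_field Y"
  shows "iterate k (\<lambda>m x. Z (Y m x)) m x = Z (iterate k Y m x)"
proof -
  obtain N where N: "\<And>i. m + int N \<le> i \<Longrightarrow> Y i x = 0"
    using annihilated_bound[OF field_annihilated[OF Y]] by blast
  obtain K where K: "\<And>i. K \<le> i \<Longrightarrow> T (int i - 1) x = 0" using T_bound by blast
  define P where "P = max N K"
  note Zs = module_hom.zero[OF Z_hom] module_hom.sum[OF Z_hom] module_hom.scale[OF Z_hom] module_hom.diff[OF Z_hom]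
  have "iterate k Y m x = (\<Sum>i<P. sbinom (k + 1) i *s
     (T (k - int i) (Y (m + int i) x) - ((-1) powi (k + 1)) *s Y (k + 1 + m - int i) (T (int i - 1) x)))"
    unfolding iterate_def by (rule Sum_any_lessThan) (simp add: P_def N K field_0[OF Y])
  moreover have "iterate k (\<lambda>m x. Z (Y m x)) m x = (\<Sum>i<P. sbinom (k + 1) i *s
     (T (k - int i) (Z (Y (m + int i) x)) - ((-1) powi (k + 1)) *s Z (Y (k + 1 + m - int i) (T (int i - 1) x))))"
    unfolding iterate_def by (rule Sum_any_lessThan) (simp add: P_def N K field_0[OF Y] Zs)
  ultimately show ?thesis by (simp add: Zs Z_T)
qed

lemma word_field_Cgen: "word_field (s @ Cgen # p # t) m x = word_field (s @ p # Cgen # t) m x"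
proof -
  have "word_field (Cgen # p # t) m x = word_field (p # Cgen # t) m x" for m x
    by (cases p) (simp_all add: letter_field_def iterate_Z is_field_word)
  then show ?thesis
    using word_field_lincomb[of "Cgen # p # t" "p # Cgen # t" 0 "[]" 0 "[]"] by simp
qed

lemma word_field_vacuum_L:
  assumes "-1 \<le> k" shows "word_field (s @ [Lgen k]) m x = 0"
  using word_field_lincomb[of "[Lgen k]" "[]" "-1" "[]" 0 "[]" s m x] iterate_vacuum[OF assms]
  by (simp add: letter_field_def)

lemma iterate_at_Z:
  "iterate k (\<lambda>m x. Y m (Z x)) m x = iterate k Y m (Z x)"
  unfolding iterate_def by (simp add: Z_T)

lemma word_field_vacuum_C: "word_field (s @ [Cgen]) m x = word_field s m (Z x)"
proof (induction s arbitrary: m x)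
  case Nil
  then show ?case using module_hom.zero[OF Z_hom] by (simp add: letter_field_def vacuum_field_def)
next
  case (Cons p s)
  then have e: "word_field (s @ [Cgen]) = (\<lambda>m x. word_field s m (Z x))" by blast
  show ?case
    by (cases p) (simp_all add: letter_field_def e iterate_at_Z)
qed

end

section \<open>Irreducibility and nilpotency for Whittaker vectors\<close>

text \<open>
  Commuting copies of Vir, indexed by \<open>'n\<close>, with a common Whittaker vector \<open>w\<close>; the index \<open>s i\<close> is the largest
  one at which the \<open>i\<close>-th Whittaker function does not vanish.
\<close>
locale whittaker_system = vector_space scale
  for scale :: "complex \<Rightarrow> 'v::ab_group_add \<Rightarrow> 'v" (infixr \<open>*s\<close> 75) +
  fixes T :: "'n \<Rightarrow> int \<Rightarrow> 'v \<Rightarrow> 'v" and Z :: "'n \<Rightarrow> 'v \<Rightarrow> 'v" and c :: complex and w :: 'v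
    and \<psi> :: "'n \<Rightarrow> int \<Rightarrow> complex" and s :: "'n \<Rightarrow> int"
  assumes T_hom: "module_hom scale scale (T i k)"
    and Z_hom: "module_hom scale scale (Z i)"
    and T_T: "T i k (T j l x) = T j l (T i k x) + (if i = j then of_int (k - l) *s T i (k + l) x
       + (if k + l = 0 then vir_cocycle k *s Z i x else 0) else 0)"
    and Z_T: "Z i (T j k x) = T j k (Z i x)"
    and Z_w: "Z i w = c *s w"
    and T_w: "0 < k \<Longrightarrow> T i k w = \<psi> i k *s w"
    and s_pos: "0 < s i" and \<psi>_s: "\<psi> i (s i) \<noteq> 0" and \<psi>_beyond: "s i < k \<Longrightarrow> \<psi> i k = 0"
begin

definition act :: "('n \<times> int) list \<Rightarrow> 'v \<Rightarrow> 'v" where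
  "act u = foldr (\<lambda>(i, k). T i k) u"

definition wt :: "('n \<times> int) list \<Rightarrow> int" where
  "wt u = (\<Sum>(i, k)\<leftarrow>u. s i - k)"

text \<open>
  The letter \<open>L(k)\<close> of the \<open>i\<close>-th copy has weight \<open>s i - k\<close>. So \<open>L(s i)\<close>, which acts on \<open>w\<close> by a nonzero
  scalar, has weight 0, letters \<open>L(k)\<close> with \<open>k \<le> 0\<close> have positive weight, and a bracket weighs less than
  the product, by \<open>s i\<close>.
\<close>
definition W :: "int \<Rightarrow> 'v set" where
  "W d = span {act u w |u. (\<forall>(i, k)\<in>set u. k \<le> 0) \<and> wt u \<le> d}"

lemma act_simps [simp]: "act [] x = x" "act ((i, k) # u) x = T i k (act u x)"
  "act (u @ v) x = act u (act v x)"
  by (simp_all add: act_def)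

lemma wt_simps [simp]: "wt [] = 0" "wt ((i, k) # u) = s i - k + wt u" "wt (u @ v) = wt u + wt v"
  by (simp_all add: wt_def)

lemma act_hom: "module_hom scale scale (act u)"
proof (induction u)
  case Nil
  show ?case by unfold_locales simp_all
next
  case (Cons a u)
  obtain i k where a: "a = (i, k)" by (cases a)
  have "act (a # u) = T i k \<circ> act u" by (auto simp: a)
  then show ?case using module_hom_compose[OF Cons T_hom[of i k]] by (simp only:)
qed

lemmas T_lin = module_hom.add[OF T_hom] module_hom.scale[OF T_hom] module_hom.diff[OF T_hom]
  module_hom.zero[OF T_hom] module_hom.neg[OF T_hom]
lemmas act_lin = module_hom.add[OF act_hom] module_hom.scale[OF act_hom] module_hom.diff[OF act_hom]
  module_hom.zero[OF act_hom]

lemma Z_act: "Z i (act u w) = c *s act u w"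
  by (induction u) (auto simp: Z_w Z_T T_lin)

lemma subspace_W: "subspace (W d)"
  by (simp add: W_def subspace_span)

lemma W_mono: "d \<le> e \<Longrightarrow> W d \<subseteq> W e"
  unfolding W_def by (rule span_mono) auto

lemma W_memD: "x \<in> W d \<Longrightarrow> d \<le> e \<Longrightarrow> x \<in> W e"
  using W_mono by blast

text \<open>
  Positive letters are moved to the right, where they act on \<open>w\<close> by a scalar that vanishes for letters
  of negative weight. The brackets on the way have fewer letters and smaller weight.
\<close>
lemma act_in_W: "act u w \<in> W (wt u)"
proof (induction u rule: length_induct)
  case (1 u)
  note short = 1
  show ?case
  proof (cases "\<forall>(i, k)\<in>set u. k \<le> 0")
    case True
    then show ?thesis unfolding W_def by (intro span_base) blast
  next
    case False
    then obtain i k p q where u: "u = p @ (i, k) # q" and k: "0 < k"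
      by (auto dest!: split_list)
    have "length (p @ (i, k) # q) \<le> length u \<Longrightarrow> act (p @ (i, k) # q) w \<in> W (wt (p @ (i, k) # q))" for p q
    proof (induction q arbitrary: p)
      case Nil
      have "act p w \<in> W (wt p)" using 1 Nil by simp
      then have "\<psi> i k *s act p w \<in> W (wt (p @ [(i, k)]))"
      proof (cases "k \<le> s i")
        case True
        then have "act p w \<in> W (wt (p @ [(i, k)]))"
          by (intro W_memD[OF \<open>act p w \<in> W (wt p)\<close>]) simp
        then show ?thesis by (rule subspace_scale[OF subspace_W])
      qed (simp add: \<psi>_beyond subspace_0[OF subspace_W])
      then show ?case by (simp add: T_w k act_lin)
    next
      case (Cons b q)
      obtain j l where b: "b = (j, l)" by (cases b)
      have 1: "act (p @ (j, l) # (i, k) # q) w \<in> W (wt (p @ (i, k) # b # q))"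
        using Cons.IH[of "p @ [(j, l)]"] Cons.prems by (simp add: b algebra_simps)
      have 2: "act (p @ (i, k + l) # q) w \<in> W (wt (p @ (i, k) # b # q))" if "i = j"
        using that s_pos[of i]
        by (intro W_memD[OF short[rule_format, of "p @ (i, k + l) # q"]]) (use Cons.prems in \<open>auto simp: b\<close>)
      have 3: "act (p @ q) w \<in> W (wt (p @ (i, k) # b # q))" if "i = j" "k + l = 0"
        using that s_pos[of i]
        by (intro W_memD[OF short[rule_format, of "p @ q"]]) (use Cons.prems in \<open>auto simp: b\<close>)
      have "act (p @ (i, k) # b # q) w = act (p @ (j, l) # (i, k) # q) w
        + (if i = j then of_int (k - l) *s act (p @ (i, k + l) # q) w
            + (if k + l = 0 then (vir_cocycle k * c) *s act (p @ q) w else 0) else 0)"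
        by (simp add: b T_T[of i k j l] Z_act act_lin)
      also have "\<dots> \<in> W (wt (p @ (i, k) # b # q))"
      proof (intro subspace_add[OF subspace_W] 1)
        show "(if i = j then of_int (k - l) *s act (p @ (i, k + l) # q) w
            + (if k + l = 0 then (vir_cocycle k * c) *s act (p @ q) w else 0) else 0) \<in> W (wt (p @ (i, k) # b # q))"
          using 2 3 by (simp add: subspace_add[OF subspace_W] subspace_scale[OF subspace_W] subspace_0[OF subspace_W] del: wt_simps act_simps)
      qed
      finally show ?case .
    qed
    then show ?thesis by (simp add: u)
  qed
qed

lemma act_W: "x \<in> W d \<Longrightarrow> act u x \<in> W (d + wt u)"
  unfolding W_def[of d]
proof (induction rule: span_induct)
  case base
  show ?case
    by (simp add: subspace_def act_lin subspace_add[OF subspace_W] subspace_scale[OF subspace_W] subspace_0[OF subspace_W])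
next
  case (step x)
  then obtain v where v: "x = act v w" "wt v \<le> d" by blast
  have "act (u @ v) w \<in> W (d + wt u)"
    by (rule W_memD[OF act_in_W]) (use v in simp)
  then show ?case using v by simp
qed

lemma T_W: "x \<in> W d \<Longrightarrow> T i k x \<in> W (d + (s i - k))"
  using act_W[of x d "[(i, k)]"] by simp

text \<open>
  The difference is the commutator with the word, a sum of words in which one letter \<open>L(l)\<close> has become
  \<open>L(n + l)\<close>.
\<close>
lemma T_act_lower:
  assumes "0 < n"
  shows "T i n (act u w) - \<psi> i n *s act u w \<in> W (wt u - n)"
proof (induction u)
  case Nil
  then show ?case using assms by (simp add: T_w subspace_0[OF subspace_W])
next
  case (Cons b u)
  obtain j l where b: "b = (j, l)" by (cases b)
  have 1: "T j l (T i n (act u w) - \<psi> i n *s act u w) \<in> W (wt (b # u) - n)"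
    using T_W[OF Cons.IH, of j l] by (simp add: b algebra_simps)
  have 2: "T i (n + l) (act u w) \<in> W (wt (b # u) - n)" if "i = j"
    using act_in_W[of "(i, n + l) # u"] that by (simp add: b algebra_simps)
  have 3: "act u w \<in> W (wt (b # u) - n)" if "i = j" "n + l = 0"
    using that s_pos[of i] by (intro W_memD[OF act_in_W[of u]]) (auto simp: b)
  have "T i n (act (b # u) w) - \<psi> i n *s act (b # u) w
     = T j l (T i n (act u w) - \<psi> i n *s act u w) + (if i = j then of_int (n - l) *s T i (n + l) (act u w)
            + (if n + l = 0 then (vir_cocycle n * c) *s act u w else 0) else 0)"
    by (simp add: b T_T[of i n j l] Z_act T_lin)
  also have "\<dots> \<in> W (wt (b # u) - n)"
    using 1 2 3 by (simp add: subspace_add[OF subspace_W] subspace_scale[OF subspace_W] subspace_0[OF subspace_W] del: wt_simps act_simps)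
  finally show ?case .
qed

lemma T_lower:
  assumes "0 < n" "x \<in> W d"
  shows "T i n x - \<psi> i n *s x \<in> W (d - n)"
  using assms(2) unfolding W_def[of d]
proof (induction rule: span_induct)
  case base
  have "module_hom scale scale (\<lambda>x. T i n x - \<psi> i n *s x)"
    by unfold_locales (simp_all add: T_lin scale_right_distrib scale_right_diff_distrib mult.commute)
  from module_hom.subspace_vimage[OF this subspace_W] show ?case by (simp add: vimage_def)
next
  case (step x)
  then obtain v where v: "x = act v w" "wt v \<le> d" by blast
  show ?case unfolding v(1) by (rule W_memD[OF T_act_lower[OF assms(1)]]) (use v in simp)
qed

lemma T_T_lower:
  assumes "x \<in> W d"
  shows "T i k (T j l x) - T j l (T i k x) \<in> W (d + (s i - k) + (s j - l) - 1)"
proof (cases "i = j")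
  case True
  have "Z i x = c *s x" 
    using assms unfolding W_def
    by (induction rule: span_induct)
      (auto simp: subspace_def Z_act module_hom.add[OF Z_hom] module_hom.scale[OF Z_hom] module_hom.zero[OF Z_hom]
         scale_right_distrib mult.commute)
  moreover have "T i (k + l) x \<in> W (d + (s i - k) + (s j - l) - 1)"
    using True s_pos[of i] by (intro W_memD[OF T_W[OF assms]]) auto
  moreover have "x \<in> W (d + (s i - k) + (s j - l) - 1)" if "k + l = 0"
    using True that s_pos[of i] by (intro W_memD[OF assms]) auto
  ultimately show ?thesis
    using True by (simp add: T_T[of j k j l] subspace_add[OF subspace_W] subspace_scale[OF subspace_W] subspace_0[OF subspace_W])
next
  case False
  then show ?thesis by (simp add: T_T[of i k j l] subspace_0[OF subspace_W])
qed

lemma act_move: "act (a # u @ v) w - act (u @ a # v) w \<in> W (wt (a # u @ v) - 1)"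
proof (induction u)
  case Nil
  show ?case by (simp add: subspace_0[OF subspace_W])
next
  case (Cons b u)
  obtain i k where a: "a = (i, k)" by (cases a)
  obtain j l where b: "b = (j, l)" by (cases b)
  have "T i k (T j l (act (u @ v) w)) - T j l (T i k (act (u @ v) w)) \<in> W (wt (a # (b # u) @ v) - 1)"
    using T_T_lower[OF act_in_W[of "u @ v"], of i k j l] by (simp add: a b algebra_simps)
  moreover have "T j l (act (a # u @ v) w - act (u @ a # v) w) \<in> W (wt (a # (b # u) @ v) - 1)"
    using T_W[OF Cons.IH, of j l] by (simp add: a b algebra_simps)
  ultimately have "(T i k (T j l (act (u @ v) w)) - T j l (T i k (act (u @ v) w)))
     + T j l (act (a # u @ v) w - act (u @ a # v) w) \<in> W (wt (a # (b # u) @ v) - 1)"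
    by (rule subspace_add[OF subspace_W])
  then show ?case by (simp add: a b T_lin)
qed

lemma wt_mset: "mset u = mset v \<Longrightarrow> wt u = wt v"
  unfolding wt_def sum_mset_sum_list[symmetric] mset_map by simp

lemma act_perm: "mset u = mset v \<Longrightarrow> act u w - act v w \<in> W (wt u - 1)"
proof (induction u arbitrary: v)
  case (Cons a u)
  obtain i k where a: "a = (i, k)" by (cases a)
  have "a \<in> set v" using Cons.prems by (metis list.set_intros(1) set_mset_mset)
  then obtain p q where v: "v = p @ a # q" by (meson split_list)
  have m: "mset u = mset (p @ q)" using Cons.prems v by simp
  have "T i k (act u w - act (p @ q) w) \<in> W (wt (a # u) - 1)"
    using T_W[OF Cons.IH[OF m], of i k] by (simp add: a algebra_simps)
  moreover have "act (a # p @ q) w - act v w \<in> W (wt (a # u) - 1)"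
    using act_move[of a p q] wt_mset[OF m] v by (simp add: a algebra_simps)
  ultimately have "T i k (act u w - act (p @ q) w) + (act (a # p @ q) w - act v w) \<in> W (wt (a # u) - 1)"
    by (rule subspace_add[OF subspace_W])
  then show ?case by (simp add: a T_lin)
qed (simp add: subspace_0[OF subspace_W])

definition word_of :: "('n \<times> int) multiset \<Rightarrow> ('n \<times> int) list" where
  "word_of m = (SOME u. mset u = m)"

lemma mset_word_of [simp]: "mset (word_of m) = m"
  unfolding word_of_def by (rule someI_ex) (rule ex_mset)

abbreviation mon :: "('n \<times> int) multiset \<Rightarrow> 'v" where "mon m \<equiv> act (word_of m) w"
abbreviation mwt :: "('n \<times> int) multiset \<Rightarrow> int" where "mwt m \<equiv> wt (word_of m)"

lemma mwt_mset [simp]: "mwt (mset u) = wt u"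
  by (rule wt_mset) simp

lemma mwt_add_mset [simp]: "mwt (add_mset (i, k) m) = s i - k + mwt m"
  using wt_mset[of "word_of (add_mset (i, k) m)" "(i, k) # word_of m"] by simp

lemma act_mon: "act u w - mon (mset u) \<in> W (wt u - 1)"
  by (rule act_perm) simp

text \<open>
  Modulo lower weight the letters commute, and \<open>L(s i - M)\<close> acts as a derivation that sends \<open>L(k)\<close> to a
  multiple of \<open>L(s i - M + k)\<close>. For \<open>k > M\<close> the index exceeds \<open>s i\<close> and the result has lower weight; for
  \<open>k = M\<close> it is \<open>L(s i)\<close>, which acts as the nonzero scalar \<open>\<psi> i (s i)\<close>.
\<close>
lemma T_act_derivative:
  assumes M: "M \<le> 0" and u: "\<forall>(j, k)\<in>set u. k \<le> 0 \<and> (j = i \<longrightarrow> M \<le> k)"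
  defines "n \<equiv> s i - M" and "b \<equiv> (i, M)"
  shows "T i n (act u w) - \<psi> i n *s act u w
      - (of_nat (count (mset u) b) * (of_int (n - M) * \<psi> i (s i))) *s mon (mset u - {#b#})
     \<in> W (wt u - n - 1)"
  using u
proof (induction u)
  case Nil
  have "0 < n" using M s_pos[of i] by (simp add: n_def)
  then show ?case by (simp add: T_w subspace_0[OF subspace_W])
next
  case (Cons a u)
  obtain j k where a: "a = (j, k)" by (cases a)
  have k: "k \<le> 0" "j = i \<Longrightarrow> M \<le> k" using Cons.prems a by auto
  define C where "C = of_int (n - M) * \<psi> i (s i)"
  let ?m = "mset u - {#b#}"
  let ?W = "W (wt (a # u) - n - 1)"
  note sub = subspace_add[OF subspace_W] subspace_diff[OF subspace_W] subspace_scale[OF subspace_W] subspace_0[OF subspace_W]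
  have "T j k (T i n (act u w) - \<psi> i n *s act u w - (of_nat (count (mset u) b) * C) *s mon ?m) \<in> ?W"
    using T_W[OF Cons.IH[folded C_def], of j k] Cons.prems by (simp add: a algebra_simps)
  moreover have "(of_nat (count (mset u) b) * C) *s (T j k (mon ?m) - mon (add_mset a ?m)) \<in> ?W"
  proof (cases "b \<in># mset u")
    case True
    then have "mset u = add_mset b ?m" by simp
    then have "wt u = n + mwt ?m" by (metis mwt_mset mwt_add_mset b_def n_def)
    moreover have "T j k (mon ?m) - mon (add_mset a ?m) \<in> W (wt (a # word_of ?m) - 1)"
      using act_mon[of "a # word_of ?m"] by (simp add: a)
    ultimately show ?thesis by (intro sub(3), elim W_memD) (simp add: a)
  next
    case False
    then have "count (mset u) b = 0" by (simp add: count_eq_zero_iff)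
    then show ?thesis by (simp only: of_nat_0 mult_zero_left scale_zero_left sub)
  qed
  moreover have "T i n (T j k (act u w)) - T j k (T i n (act u w))
      - (if a = b then C *s mon (mset u) else 0) \<in> ?W"
  proof (cases "j = i")
    case True
    then have nk: "0 < n + k" using k s_pos[of i] by (simp add: n_def)
    have low: "T i (n + k) (act u w) - \<psi> i (n + k) *s act u w \<in> ?W"
      using True s_pos[of i] by (intro W_memD[OF T_act_lower[OF nk]]) (auto simp: a)
    have e: "T i n (T j k (act u w)) - T j k (T i n (act u w)) = of_int (n - k) *s T i (n + k) (act u w)"
      using nk True by (simp add: T_T[of i n i k])
    show ?thesis
    proof (cases "k = M")
      case True': True
      have "act u w - mon (mset u) \<in> ?W"
        using act_mon[of u] True True' by (simp add: a n_def)
      then have "of_int (n - k) *s (T i (n + k) (act u w) - \<psi> i (n + k) *s act u w)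
         + C *s (act u w - mon (mset u)) \<in> ?W" by (rule sub(1)[OF sub(3)[OF low] sub(3)])
      then show ?thesis unfolding e using True True'
        by (simp add: a b_def n_def C_def scale_right_diff_distrib)
    next
      case False
      then have "\<psi> i (n + k) = 0" using k True by (intro \<psi>_beyond) (simp add: n_def)
      then show ?thesis unfolding e using low False sub(3)[OF low, of "of_int (n - k)"]
        by (simp add: a b_def del: wt_simps)
    qed
  next
    case False
    then show ?thesis by (simp add: T_T[of i n j k] a b_def sub)
  qed
  ultimately have mem: "T j k (T i n (act u w) - \<psi> i n *s act u w - (of_nat (count (mset u) b) * C) *s mon ?m)
     + (of_nat (count (mset u) b) * C) *s (T j k (mon ?m) - mon (add_mset a ?m))
     + (T i n (T j k (act u w)) - T j k (T i n (act u w)) - (if a = b then C *s mon (mset u) else 0)) \<in> ?W"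
    by (intro subspace_add[OF subspace_W])
  have eq: "(of_nat (count (mset (a # u)) b) * C) *s mon (mset (a # u) - {#b#})
     = (of_nat (count (mset u) b) * C) *s mon (add_mset a ?m) + (if a = b then C *s mon (mset u) else 0)"
  proof (cases "a = b")
    case True
    then show ?thesis
    proof (cases "b \<in># mset u")
      case False
      then have c0: "count (mset u) b = 0" by (simp add: count_eq_zero_iff)
      show ?thesis unfolding True mset.simps count_add_mset c0 by simp
    qed (simp add: True algebra_simps)
  next
    case False
    then show ?thesis by simp
  qed
  have "T i n (act (a # u) w) - \<psi> i n *s act (a # u) w - (of_nat (count (mset (a # u)) b) * C) *s mon (mset (a # u) - {#b#})
     = T j k (T i n (act u w) - \<psi> i n *s act u w - (of_nat (count (mset u) b) * C) *s mon ?m)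
     + (of_nat (count (mset u) b) * C) *s (T j k (mon ?m) - mon (add_mset a ?m))
     + (T i n (T j k (act u w)) - T j k (T i n (act u w)) - (if a = b then C *s mon (mset u) else 0))"
    unfolding eq by (simp add: a T_lin scale_right_diff_distrib split del: if_split)
  with mem show ?case unfolding C_def[symmetric] by (simp only:)
qed

lemma W_negative: "d < 0 \<Longrightarrow> W d = {0}"
proof -
  assume "d < 0"
  moreover have "0 \<le> wt u" if "\<forall>(i, k)\<in>set u. k \<le> 0" for u
  proof -
    have "k \<le> s i" if "k \<le> 0" for k i using that s_pos[of i] by linarith
    with that show ?thesis by (induction u) (auto intro!: add_nonneg_nonneg)
  qed
  ultimately have "{act u w |u. (\<forall>(i, k)\<in>set u. k \<le> 0) \<and> wt u \<le> d} = {}" by force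
  then show ?thesis unfolding W_def by (simp only: span_empty)
qed

definition homogeneous :: "int \<Rightarrow> ('n \<times> int) multiset set" where
  "homogeneous d = {m. (\<forall>(i, k)\<in>#m. k \<le> 0) \<and> mwt m = d}"

lemma mwt_pos:
  assumes "\<forall>(i, k)\<in>#m. k \<le> 0" "m \<noteq> {#}"
  shows "0 < mwt m"
  using assms
proof (induction m)
  case (add a m)
  obtain i k where a: "a = (i, k)" by (cases a)
  have "0 \<le> mwt m" using add by (cases "m = {#}") (auto simp: wt_mset[of "word_of {#}" "[]"])
  then show ?case using add s_pos[of i] by (simp add: a)
qed simp

abbreviation sym :: "(('n \<times> int) multiset \<Rightarrow>\<^sub>0 complex) \<Rightarrow> 'v" where
  "sym p \<equiv> lin_ext scale mon p"

lemmas vs = vector_space_axioms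

lemma leading_term:
  assumes "x \<in> W d"
  obtains p where "Poly_Mapping.keys p \<subseteq> homogeneous d" "x - sym p \<in> W (d - 1)"
proof -
  note sub = subspace_add[OF subspace_W] subspace_scale[OF subspace_W] subspace_0[OF subspace_W]
  let ?P = "\<lambda>x p. Poly_Mapping.keys p \<subseteq> homogeneous d \<and> x - sym p \<in> W (d - 1)"
  have "\<exists>p. ?P x p"
    using assms unfolding W_def[of d]
  proof (induction rule: span_induct)
    case base
    show ?case
      unfolding subspace_def mem_Collect_eq
    proof (intro conjI ballI allI impI)
      show "\<exists>p. ?P 0 p" by (rule exI[of _ 0]) (simp add: sub lin_ext_zero[OF vs])
    next
      fix x y assume "x \<in> {x. \<exists>p. ?P x p}" "y \<in> {x. \<exists>p. ?P x p}"
      then obtain p q where p: "?P x p" and q: "?P y q" by auto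
      have "(x - sym p) + (y - sym q) \<in> W (d - 1)" using p q by (intro sub) auto
      moreover have "Poly_Mapping.keys (p + q) \<subseteq> homogeneous d"
        using Poly_Mapping.keys_add[of p q] p q by auto
      ultimately show "\<exists>p. ?P (x + y) p"
        by (intro exI[of _ "p + q"]) (simp add: lin_ext_add[OF vs] algebra_simps)
    next
      fix a x assume "x \<in> {x. \<exists>p. ?P x p}"
      then obtain p where p: "?P x p" by auto
      have "a *s (x - sym p) \<in> W (d - 1)" using p by (intro sub) auto
      moreover have "Poly_Mapping.keys (pm_scale a p) \<subseteq> homogeneous d"
        using keys_pm_scale[of a p] p by auto
      ultimately show "\<exists>p. ?P (a *s x) p"
        by (intro exI[of _ "pm_scale a p"]) (simp add: lin_ext_scale[OF vs] scale_right_diff_distrib)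
    qed
  next
    case (step x)
    then obtain u where u: "x = act u w" "\<forall>(i, k)\<in>set u. k \<le> 0" "wt u \<le> d" by blast
    show ?case
    proof (cases "wt u = d")
      case True
      then show ?thesis
        using u act_mon[of u]
        by (intro exI[of _ "Poly_Mapping.single (mset u) 1"]) (auto simp: lin_ext_single[OF vs] homogeneous_def)
    next
      case False
      then show ?thesis
        using u by (intro exI[of _ 0]) (auto simp: lin_ext_zero[OF vs] intro!: W_memD[OF act_in_W])
    qed
  qed
  then show thesis using that by blast
qed

text \<open>
  Differentiation with respect to the lowest letter \<open>(i, M)\<close> that occurs in \<open>p\<close> for some \<open>i\<close>. Monomials
  with that letter stay distinct when one copy of it is removed, hence the derivative is not zero.
\<close>
lemma lower_leading_term:
  assumes p: "Poly_Mapping.keys p \<subseteq> homogeneous d" "p \<noteq> 0" and x: "x - sym p \<in> W (d - 1)" and d: "0 < d"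
  obtains i n q e where "0 < n" "e < d" "0 \<le> e" "Poly_Mapping.keys q \<subseteq> homogeneous e" "q \<noteq> 0"
    "(T i n x - \<psi> i n *s x) - sym q \<in> W (e - 1)"
proof -
  obtain m0 where m0: "m0 \<in> Poly_Mapping.keys p" using p(2) by (metis all_not_in_conv keys_eq_empty)
  then have "m0 \<noteq> {#}" using p(1) d by (auto simp: homogeneous_def wt_mset[of "word_of {#}" "[]"])
  then obtain i k0 where ik: "(i, k0) \<in># m0" by (metis multiset_nonemptyE surj_pair)
  define K where "K = (\<Union>m\<in>Poly_Mapping.keys p. {k. (i, k) \<in># m})"
  have "finite {k. (i, k) \<in># m}" for m
    by (rule finite_subset[of _ "snd ` set_mset m"]) force+
  then have K: "finite K" "K \<noteq> {}" using m0 ik by (auto simp: K_def)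
  \<comment> \<open>the lowest letter of the copy i that occurs in p\<close>
  define M where "M = Min K"
  have MK: "M \<in> K" using Min_in[OF K] by (simp add: M_def)
  have M_le: "M \<le> k" if "m \<in> Poly_Mapping.keys p" "(i, k) \<in># m" for m k
    unfolding M_def by (rule Min_le[OF K(1)]) (use that K_def in auto)
  obtain m1 where m1: "m1 \<in> Poly_Mapping.keys p" "(i, M) \<in># m1" using MK by (auto simp: K_def)
  have M0: "M \<le> 0" using m1 p(1) by (fastforce simp: homogeneous_def)
  define n where "n = s i - M"
  define b where "b = (i, M)"
  define C where "C = of_int (n - M) * \<psi> i (s i)"
  have n: "0 < n" using M0 s_pos[of i] by (simp add: n_def)
  \<comment> \<open>the structure constant of the bracket of L(s i - M) and L(M)\<close>
  have "n - M \<noteq> 0" using M0 n by simp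
  then have C: "C \<noteq> 0" using \<psi>_s[of i] by (simp add: C_def del: of_int_diff)
  define A where "A = {m \<in> Poly_Mapping.keys p. b \<in># m}"
  define q where "q = (\<Sum>m\<in>A. Poly_Mapping.single (m - {#b#}) (Poly_Mapping.lookup p m * (of_nat (count m b) * C)))"
  have finA: "finite A" by (simp add: A_def)
  have split: "mwt (m - {#b#}) = d - n" "\<forall>(j, k)\<in>#m - {#b#}. k \<le> 0" if "m \<in> A" for m
  proof -
    have "m = add_mset b (m - {#b#})" using that by (simp add: A_def)
    then have "mwt m = n + mwt (m - {#b#})" by (metis mwt_add_mset b_def n_def)
    moreover have "mwt m = d" using that p(1) by (auto simp: A_def homogeneous_def)
    ultimately show "mwt (m - {#b#}) = d - n" by simp
    show "\<forall>(j, k)\<in>#m - {#b#}. k \<le> 0"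
      using that p(1) by (fastforce simp: A_def homogeneous_def dest: in_diffD)
  qed
  have keys_q: "Poly_Mapping.keys q \<subseteq> homogeneous (d - n)"
  proof
    fix m assume "m \<in> Poly_Mapping.keys q"
    then have "m \<in> (\<Union>m\<in>A. {m - {#b#}})"
      using keys_sum[of "\<lambda>m. Poly_Mapping.single (m - {#b#}) (Poly_Mapping.lookup p m * (of_nat (count m b) * C))" A]
      unfolding q_def by (auto split: if_splits)
    then obtain m' where "m' \<in> A" "m = m' - {#b#}" by blast
    then show "m \<in> homogeneous (d - n)" using split[of m'] by (simp add: homogeneous_def)
  qed
  have "Poly_Mapping.lookup q (m1 - {#b#}) = Poly_Mapping.lookup p m1 * (of_nat (count m1 b) * C)"
  proof -
    have m1A: "m1 \<in> A" using m1 by (simp add: A_def b_def)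
    have "m - {#b#} = m1 - {#b#} \<longleftrightarrow> m = m1" if "m \<in> A" for m
      using that m1A by (auto simp: A_def) (metis insert_DiffM)
    then have "Poly_Mapping.lookup q (m1 - {#b#})
      = (\<Sum>m\<in>A. if m = m1 then Poly_Mapping.lookup p m * (of_nat (count m b) * C) else 0)"
      unfolding q_def lookup_sum lookup_single by (intro sum.cong refl) (auto simp: when_def)
    then show ?thesis using finA m1A by simp
  qed
  moreover have "0 < count m1 b" using m1 by (simp add: b_def)
  ultimately have q0: "q \<noteq> 0" using m1(1) C by (auto simp: in_keys_iff simp del: count_greater_zero_iff)
  have Tm: "(T i n (mon m) - \<psi> i n *s mon m) - (of_nat (count m b) * C) *s mon (m - {#b#}) \<in> W (d - n - 1)"
    if "m \<in> Poly_Mapping.keys p" for m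
  proof -
    have "set (word_of m) = set_mset m" by (metis mset_word_of set_mset_mset)
    then have "\<forall>(j, k)\<in>set (word_of m). k \<le> 0 \<and> (j = i \<longrightarrow> M \<le> k)" "mwt m = d"
      using that p(1) M_le[OF that] by (auto simp: homogeneous_def)
    then show ?thesis
      using T_act_derivative[OF M0, of "word_of m" i]
      unfolding n_def[symmetric] b_def[symmetric] C_def[symmetric] by simp
  qed
  have hom: "module_hom scale scale (\<lambda>x. T i n x - \<psi> i n *s x)"
    by unfold_locales (simp_all add: T_lin scale_right_distrib scale_right_diff_distrib mult.commute)
  have symq: "sym q = (\<Sum>m\<in>Poly_Mapping.keys p. Poly_Mapping.lookup p m *s ((of_nat (count m b) * C) *s mon (m - {#b#})))"
  proof -
    have "sym q = (\<Sum>m\<in>A. Poly_Mapping.lookup p m *s ((of_nat (count m b) * C) *s mon (m - {#b#})))"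
      by (simp add: q_def lin_ext_sum[OF vs] lin_ext_single[OF vs])
    also have "\<dots> = (\<Sum>m\<in>Poly_Mapping.keys p. Poly_Mapping.lookup p m *s ((of_nat (count m b) * C) *s mon (m - {#b#})))"
      by (rule sum.mono_neutral_left) (auto simp: A_def not_in_iff)
    finally show ?thesis .
  qed
  have e: "T i n (sym p) - \<psi> i n *s sym p = lin_ext scale (\<lambda>m. T i n (mon m) - \<psi> i n *s mon m) p"
    by (rule module_hom_lin_ext_comp[OF vs hom])
  have "(T i n (sym p) - \<psi> i n *s sym p) - sym q
     = (\<Sum>m\<in>Poly_Mapping.keys p. Poly_Mapping.lookup p m *s
         ((T i n (mon m) - \<psi> i n *s mon m) - (of_nat (count m b) * C) *s mon (m - {#b#})))"
    unfolding e symq unfolding lin_ext_def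
    by (simp only: sum_subtractf[symmetric] scale_right_diff_distrib)
  also have "\<dots> \<in> W (d - n - 1)"
    by (intro subspace_sum[OF subspace_W] subspace_scale[OF subspace_W] Tm)
  finally have 1: "(T i n (sym p) - \<psi> i n *s sym p) - sym q \<in> W (d - n - 1)" .
  have 2: "T i n (x - sym p) - \<psi> i n *s (x - sym p) \<in> W (d - n - 1)"
    using T_lower[OF n x, of i] by (simp add: algebra_simps)
  have "(T i n x - \<psi> i n *s x) - sym q \<in> W (d - n - 1)"
    using subspace_add[OF subspace_W 1 2] by (simp add: T_lin scale_right_diff_distrib algebra_simps)
  moreover have "0 \<le> d - n"
  proof -
    have "mwt (m1 - {#b#}) = d - n" "\<forall>(j, k)\<in>#m1 - {#b#}. k \<le> 0"
      using split m1 by (auto simp: A_def b_def)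
    then show ?thesis using mwt_pos[of "m1 - {#b#}"]
      by (cases "m1 - {#b#} = {#}") (auto simp: wt_mset[of "word_of {#}" "[]"])
  qed
  ultimately show thesis using that[of n "d - n" q i] n keys_q q0 by simp
qed

text \<open>
  Induction on the degree of the leading term. In degree 0 the vector is a multiple of \<open>w\<close>, because
  \<open>W (-1)\<close> is zero.
\<close>
lemma leading_term_generates:
  assumes "Poly_Mapping.keys p \<subseteq> homogeneous d" "p \<noteq> 0" "x - sym p \<in> W (d - 1)" "0 \<le> d"
    and S: "subspace S" "\<And>i k y. y \<in> S \<Longrightarrow> T i k y \<in> S" and "x \<in> S"
  shows "w \<in> S"
proof -
  have "\<forall>p x. Poly_Mapping.keys p \<subseteq> homogeneous (int n) \<and> p \<noteq> 0 \<and> x - sym p \<in> W (int n - 1) \<and> x \<in> S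
      \<longrightarrow> w \<in> S" for n
  proof (induction n rule: less_induct)
    case (less n)
    show ?case
    proof (intro allI impI, elim conjE)
      fix p x assume p: "Poly_Mapping.keys p \<subseteq> homogeneous (int n)" "p \<noteq> 0" and x: "x - sym p \<in> W (int n - 1)" "x \<in> S"
      show "w \<in> S"
      proof (cases "n = 0")
        case True
        have "m = {#}" if "m \<in> Poly_Mapping.keys p" for m
          using that p(1) mwt_pos[of m] True by (fastforce simp: homogeneous_def)
        then have "Poly_Mapping.keys p = {{#}}" using p(2) by (metis empty_iff keys_eq_empty subsetI subset_singleton_iff singletonI)
        then have "sym p = Poly_Mapping.lookup p {#} *s w" "Poly_Mapping.lookup p {#} \<noteq> 0"
          by (auto simp: lin_ext_def word_of_def in_keys_iff[symmetric])
        moreover have "x = sym p" using x(1) True by (simp add: W_negative)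
        ultimately have "w = (1 / Poly_Mapping.lookup p {#}) *s x" by simp
        then show ?thesis using subspace_scale[OF S(1) x(2)] by metis
      next
        case False
        then have "0 < int n" by simp
        from lower_leading_term[OF p x(1) this]
        obtain i l q e where q: "e < int n" "0 \<le> e" "Poly_Mapping.keys q \<subseteq> homogeneous e" "q \<noteq> 0"
          "(T i l x - \<psi> i l *s x) - sym q \<in> W (e - 1)" by metis
        moreover have "T i l x - \<psi> i l *s x \<in> S"
          by (intro subspace_diff[OF S(1)] subspace_scale[OF S(1)] S(2) x(2))
        moreover have "nat e < n" "int (nat e) = e" using q(1,2) False by linarith+
        ultimately show ?thesis using less.IH[of "nat e"] by auto
      qed
    qed
  qed
  from this[of "nat d"] show ?thesis using assms by auto
qed

definition module_space :: "'v set" where "module_space = (\<Union>d. W d)"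

theorem irreducible:
  assumes S: "subspace S" "\<And>i k y. y \<in> S \<Longrightarrow> T i k y \<in> S" and x: "x \<in> S" "x \<in> module_space" "x \<noteq> 0"
  shows "module_space \<subseteq> S"
proof -
  obtain d where d: "x \<in> W d" using x(2) by (auto simp: module_space_def)
  have "x \<in> W (int n) \<Longrightarrow> w \<in> S" for n
  proof (induction n)
    case 0
    from leading_term[OF 0] obtain p where p: "Poly_Mapping.keys p \<subseteq> homogeneous 0" "x - sym p \<in> W (0 - 1)"
      by auto
    then have "p \<noteq> 0" using x(3) by (auto simp: W_negative lin_ext_zero[OF vs])
    then show ?case using leading_term_generates[OF p(1) _ p(2) _ S x(1)] by simp
  next
    case (Suc n)
    from leading_term[OF Suc.prems] obtain p where p: "Poly_Mapping.keys p \<subseteq> homogeneous (int (Suc n))"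
      "x - sym p \<in> W (int (Suc n) - 1)" by blast
    show ?case
    proof (cases "p = 0")
      case True
      then show ?thesis using Suc.IH p by (simp add: lin_ext_zero[OF vs])
    next
      case False
      then show ?thesis using leading_term_generates[OF p(1) _ p(2) _ S x(1)] by simp
    qed
  qed
  from this[of "nat d"] have "w \<in> S" using W_memD[OF d, of "int (nat d)"] by simp
  then have "act u w \<in> S" for u by (induction u) (auto simp: S(2))
  then have "W d \<subseteq> S" for d unfolding W_def by (intro span_minimal[OF _ S(1)]) auto
  then show ?thesis by (auto simp: module_space_def)
qed

lemma locally_nilpotent:
  assumes "x \<in> module_space" "0 < n"
  shows "\<exists>N. ((\<lambda>x. T i n x - \<psi> i n *s x) ^^ N) x = 0"
proof -
  obtain d where d: "x \<in> W d" using assms(1) by (auto simp: module_space_def)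
  have "((\<lambda>x. T i n x - \<psi> i n *s x) ^^ N) x \<in> W (d - int N * n)" for N
  proof (induction N)
    case (Suc N)
    then show ?case using T_lower[OF assms(2) Suc, of i] by (simp add: algebra_simps)
  qed (use d in simp)
  moreover have "d - int (nat (d + 1)) * n < 0"
  proof -
    have "int (nat (d + 1)) * 1 \<le> int (nat (d + 1)) * n" using assms(2) by (intro mult_left_mono) auto
    then show ?thesis by linarith
  qed
  ultimately show ?thesis using W_negative by blast
qed

lemma module_space_eq: "module_space = span (range (\<lambda>u. act u w))"
proof
  have "W d \<subseteq> span (range (\<lambda>u. act u w))" for d unfolding W_def by (rule span_mono) auto
  then show "module_space \<subseteq> span (range (\<lambda>u. act u w))" by (auto simp: module_space_def)
  have "subspace module_space"
    unfolding subspace_def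
  proof (intro conjI ballI allI impI)
    show "0 \<in> module_space" using subspace_0[OF subspace_W] by (auto simp: module_space_def)
    fix x y assume "x \<in> module_space" "y \<in> module_space"
    then obtain d e where "x \<in> W d" "y \<in> W e" by (auto simp: module_space_def)
    then have "x + y \<in> W (max d e)" by (intro subspace_add[OF subspace_W]) (simp_all add: W_memD[where e = "max d e"])
    then show "x + y \<in> module_space" by (auto simp: module_space_def)
  next
    fix a x assume "x \<in> module_space"
    then show "a *s x \<in> module_space" using subspace_scale[OF subspace_W] by (fastforce simp: module_space_def)
  qed
  then show "span (range (\<lambda>u. act u w)) \<subseteq> module_space"
    using act_in_W by (intro span_minimal) (auto simp: module_space_def)
qed

end

section \<open>The universal enveloping algebra and its induced modules\<close>

lemma poly_mapping_singles_induct: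
  fixes f :: "'x \<Rightarrow>\<^sub>0 complex"
  assumes "\<And>x a. P (Poly_Mapping.single x a)" "\<And>f g. P f \<Longrightarrow> P g \<Longrightarrow> P (f + g)"
  shows "P f"
proof -
  have f: "f = (\<Sum>x\<in>Poly_Mapping.keys f. Poly_Mapping.single x (Poly_Mapping.lookup f x))"
    by (rule poly_mapping_eqI) (auto simp: lookup_sum lookup_single when_def in_keys_iff)
  have "P 0" using assms(1)[of _ 0] by simp
  have "finite A \<Longrightarrow> P (\<Sum>x\<in>A. Poly_Mapping.single x (Poly_Mapping.lookup f x))" for A
    by (induction A rule: finite_induct) (auto simp: assms \<open>P 0\<close>)
  then show ?thesis by (subst f) simp
qed

lemmas vs_pm = vector_space_pm_scale

lemma pm_scale_add: "pm_scale a (f + g) = pm_scale a f + pm_scale a g"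
  by (rule poly_mapping_eqI) (simp add: lookup_add algebra_simps)

lemma pm_scale_zero [simp]: "pm_scale a 0 = 0"
  by (rule poly_mapping_eqI) simp

lemma tensor_of_vir_lin_ext: "tensor_of_vir x = lin_ext pm_scale (\<lambda>p. Poly_Mapping.single (Word [p]) 1) x"
  by (simp add: tensor_of_vir_def lin_ext_def)

lemma vir_bracket_lin_ext:
  "vir_bracket x y = lin_ext pm_scale (\<lambda>p. lin_ext pm_scale (basis_bracket p) y) x"
proof -
  interpret vector_space "pm_scale :: complex \<Rightarrow> vir \<Rightarrow> vir" by (rule vs_pm)
  show ?thesis by (simp add: vir_bracket_def lin_ext_def scale_sum_right)
qed

lemma tensor_of_vir_add: "tensor_of_vir (x + y) = tensor_of_vir x + tensor_of_vir y"
  by (simp add: tensor_of_vir_lin_ext lin_ext_add[OF vs_pm])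

lemma tensor_of_vir_scale: "tensor_of_vir (pm_scale a x) = pm_scale a (tensor_of_vir x)"
  by (simp add: tensor_of_vir_lin_ext lin_ext_scale[OF vs_pm])

lemma tensor_of_vir_zero [simp]: "tensor_of_vir 0 = 0"
  by (simp add: tensor_of_vir_lin_ext lin_ext_zero[OF vs_pm])

lemma tensor_of_vir_single [simp]: "tensor_of_vir (Poly_Mapping.single p a) = Poly_Mapping.single (Word [p]) a"
  by (simp add: tensor_of_vir_lin_ext lin_ext_single[OF vs_pm])

lemma vir_bracket_add_left: "vir_bracket (x + x') y = vir_bracket x y + vir_bracket x' y"
  by (simp add: vir_bracket_lin_ext lin_ext_add[OF vs_pm])

lemma vir_bracket_add_right: "vir_bracket x (y + y') = vir_bracket x y + vir_bracket x y'"
  by (simp add: vir_bracket_lin_ext lin_ext_add[OF vs_pm] lin_ext_add_fun[OF vs_pm])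

lemma vir_bracket_single: "vir_bracket (Poly_Mapping.single p a) (Poly_Mapping.single q b)
    = pm_scale (a * b) (basis_bracket p q)"
proof -
  interpret vector_space "pm_scale :: complex \<Rightarrow> vir \<Rightarrow> vir" by (rule vs_pm)
  show ?thesis by (simp add: vir_bracket_lin_ext lin_ext_single[OF vs_pm])
qed

lemma basis_bracket_Lgen: "basis_bracket (Lgen k) (Lgen l) =
    Poly_Mapping.single (Lgen (k + l)) (of_int (k - l)) + Poly_Mapping.single Cgen (if k + l = 0 then vir_cocycle k else 0)"
  by (simp add: vir_cocycle_def)

lemma basis_bracket_Cgen [simp]: "basis_bracket Cgen p = 0" "basis_bracket p Cgen = 0"
  by (cases p; simp)+

lemma word_plus: "Word u + Word v = Word (u @ v)"
  by (simp add: plus_vir_word_def)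

text \<open>
  It suffices to check the relations of the enveloping algebra on words, by bilinearity of the bracket.
\<close>
lemma lin_ext_uea_ideal:
  assumes vs: "vector_space s"
    and L: "\<And>u k l v. G (u @ Lgen k # Lgen l # v) = G (u @ Lgen l # Lgen k # v)
       + (s (of_int (k - l)) (G (u @ Lgen (k + l) # v)) + s (if k + l = 0 then vir_cocycle k else 0) (G (u @ Cgen # v)))"
    and C: "\<And>u p v. G (u @ Cgen # p # v) = G (u @ p # Cgen # v)"
    and r: "r \<in> uea_ideal"
  shows "lin_ext s (\<lambda>w. G (letters w)) r = 0"
proof -
  interpret vector_space s by (rule vs)
  let ?F = "lin_ext s (\<lambda>w. G (letters w))"
  define D where "D x y = tensor_of_vir x * tensor_of_vir y - tensor_of_vir y * tensor_of_vir x
             - tensor_of_vir (vir_bracket x y)" for x y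
  have D_add: "D (x + x') y = D x y + D x' y" "D x (y + y') = D x y + D x y'" for x x' y y'
    by (simp_all add: D_def tensor_of_vir_add vir_bracket_add_left vir_bracket_add_right algebra_simps)
  note F = lin_ext_add[OF vs] lin_ext_diff[OF vs] lin_ext_single[OF vs]
  have D1: "?F (Poly_Mapping.single (Word u) a * D (Poly_Mapping.single p \<alpha>) (Poly_Mapping.single q \<beta>) * Poly_Mapping.single (Word v) b) = 0"
    for u v a b p q \<alpha> \<beta>
  proof (cases "\<exists>k l. p = Lgen k \<and> q = Lgen l")
    case True
    then obtain k l where pq: "p = Lgen k" "q = Lgen l" by blast
    show ?thesis
      unfolding D_def pq vir_bracket_single basis_bracket_Lgen
      by (simp add: mult_single word_plus F tensor_of_vir_scale tensor_of_vir_add pm_scale_add algebra_simps L[of u k l v] scale_right_distrib)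
  next
    case False
    then have pq: "p = Cgen \<or> q = Cgen" by (metis vir_basis.exhaust)
    then have "basis_bracket p q = 0" by auto
    moreover have "G (u @ p # q # v) = G (u @ q # p # v)" using pq C by metis
    ultimately show ?thesis
      unfolding D_def vir_bracket_single
      by (simp add: mult_single word_plus F algebra_simps)
  qed
  have D2: "?F (Poly_Mapping.single (Word u) a * D x y * Poly_Mapping.single (Word v) b) = 0" for u v a b x y
  proof (induction x rule: poly_mapping_singles_induct)
    case (1 p \<alpha>)
    show ?case
      by (induction y rule: poly_mapping_singles_induct) (simp_all add: D1 D_add distrib_left distrib_right F)
  qed (simp add: D_add distrib_left distrib_right F)
  have D3: "?F (f * D x y * g) = 0" for f g x y
  proof (induction f rule: poly_mapping_singles_induct)
    case (1 u a)
    show ?case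
    proof (induction g rule: poly_mapping_singles_induct)
      case (1 v b)
      show ?case using D2[of "letters u" a x y "letters v" b] by simp
    qed (simp add: distrib_left F)
  qed (simp add: distrib_right F)
  show ?thesis
    using r
  proof (induction r rule: uea_ideal.induct)
    case zero
    show ?case by (simp add: lin_ext_zero[OF vs])
  next
    case (step r f x y g)
    then show ?case using D3[of f x y g] by (simp add: D_def F)
  qed
qed

lemma abs_uvir_eq_iff: "abs_uvir f = abs_uvir g \<longleftrightarrow> f - g \<in> uea_ideal"
  by (rule uvir.abs_eq_iff)

lemma abs_rep_uvir [simp]: "abs_uvir (rep_uvir u) = u"
  by (rule Quotient3_abs_rep[OF Quotient3_uvir])

lemma rep_abs_uvir: "rep_uvir (abs_uvir f) - f \<in> uea_ideal"
  using abs_uvir_eq_iff abs_rep_uvir by blast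

definition u_word :: "vir_basis list \<Rightarrow> uvir" where
  "u_word w = abs_uvir (Poly_Mapping.single (Word w) 1)"

definition u_letter :: "vir_basis \<Rightarrow> uvir" where
  "u_letter p = u_of_vir (Poly_Mapping.single p 1)"

text \<open>
  Scalars are central in the tensor algebra, so that \<open>u_scale\<close> is a scalar multiplication that is
  compatible with products on both sides.
\<close>
lemma single_0_mult: "Poly_Mapping.single 0 a * f = pm_scale a (f :: vir_tensor_algebra)"
  "f * Poly_Mapping.single 0 a = pm_scale a f"
proof -
  interpret vector_space "pm_scale :: complex \<Rightarrow> vir_tensor_algebra \<Rightarrow> _" by (rule vs_pm)
  show "Poly_Mapping.single 0 a * f = pm_scale a f" "f * Poly_Mapping.single 0 a = pm_scale a f"
    by (induction f rule: poly_mapping_singles_induct)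
      (simp_all add: mult_single distrib_left distrib_right scale_right_distrib mult.commute)
qed

lemma u_scale_abs: "u_scale a (abs_uvir f) = abs_uvir (pm_scale a f)"
  by (simp add: u_scale_def times_uvir.abs_eq single_0_mult)

lemma pm_scale_mult: "pm_scale a f * g = pm_scale a (f * (g :: vir_tensor_algebra))" "f * pm_scale a g = pm_scale a (f * g)"
proof -
  show "pm_scale a f * g = pm_scale a (f * g)"
    unfolding single_0_mult(1)[symmetric] by (simp add: mult.assoc)
  have "f * pm_scale a g = (f * Poly_Mapping.single 0 a) * g"
    unfolding single_0_mult(1)[symmetric] by (simp add: mult.assoc)
  then show "f * pm_scale a g = pm_scale a (f * g)"
    unfolding single_0_mult(2) by (simp add: \<open>pm_scale a f * g = pm_scale a (f * g)\<close>)
qed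

lemma u_scale_mult: "u_scale a u * v = u_scale a (u * v)" "u * u_scale a v = u_scale a (u * v)"
proof -
  have "u_scale a (abs_uvir f) * abs_uvir g = u_scale a (abs_uvir f * abs_uvir g)"
    "abs_uvir f * u_scale a (abs_uvir g) = u_scale a (abs_uvir f * abs_uvir g)" for f g
    by (simp_all add: u_scale_abs times_uvir.abs_eq pm_scale_mult)
  from this[of "rep_uvir u" "rep_uvir v"]
  show "u_scale a u * v = u_scale a (u * v)" "u * u_scale a v = u_scale a (u * v)" by simp_all
qed

lemma vector_space_u_scale: "vector_space u_scale"
proof
  interpret vector_space "pm_scale :: complex \<Rightarrow> vir_tensor_algebra \<Rightarrow> _" by (rule vs_pm)
  have "u_scale a (abs_uvir f + abs_uvir g) = u_scale a (abs_uvir f) + u_scale a (abs_uvir g)"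
    "u_scale (a + b) (abs_uvir f) = u_scale a (abs_uvir f) + u_scale b (abs_uvir f)"
    "u_scale a (u_scale b (abs_uvir f)) = u_scale (a * b) (abs_uvir f)" "u_scale 1 (abs_uvir f) = abs_uvir f" for a b f g
    by (simp_all add: u_scale_abs plus_uvir.abs_eq scale_right_distrib scale_left_distrib)
  then show "u_scale a (x + y) = u_scale a x + u_scale a y" "u_scale (a + b) x = u_scale a x + u_scale b x"
    "u_scale a (u_scale b x) = u_scale (a * b) x" "u_scale 1 x = x" for a b x y
    by (metis abs_rep_uvir)+
qed

lemmas vs_u = vector_space_u_scale

lemma u_word_Cons: "u_word (p # w) = u_letter p * u_word w"
  by (simp add: u_word_def u_letter_def u_of_vir_def times_uvir.abs_eq mult_single word_plus)

lemma u_word_snoc: "u_word w * u_letter p = u_word (w @ [p])"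
  by (simp add: u_word_def u_letter_def u_of_vir_def times_uvir.abs_eq mult_single word_plus)

lemma u_word_Nil: "u_word [] = 1"
  by (simp add: u_word_def one_uvir_def one_poly_mapping_def[symmetric] zero_vir_word_def[symmetric] one_uvir.abs_eq
      flip: single_one)

lemma u_of_vir_add: "u_of_vir (x + y) = u_of_vir x + u_of_vir y"
  by (simp add: u_of_vir_def tensor_of_vir_add plus_uvir.abs_eq)

lemma u_of_vir_scale: "u_of_vir (pm_scale a x) = u_scale a (u_of_vir x)"
  by (simp add: u_of_vir_def tensor_of_vir_scale u_scale_abs)

lemma u_of_vir_single: "u_of_vir (Poly_Mapping.single p a) = u_scale a (u_letter p)"
  using u_of_vir_scale[of a "Poly_Mapping.single p 1"] by (simp add: u_letter_def)

lemma module_hom_u_of_vir: "module_hom pm_scale u_scale u_of_vir"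
  using vs_pm vs_u
  by (intro module_hom.intro module_hom_axioms.intro) (simp_all add: module_iff_vector_space u_of_vir_add u_of_vir_scale)

lemma u_bracket: "u_of_vir x * u_of_vir y = u_of_vir y * u_of_vir x + u_of_vir (vir_bracket x y)"
proof -
  have "tensor_of_vir x * tensor_of_vir y - (tensor_of_vir y * tensor_of_vir x + tensor_of_vir (vir_bracket x y)) \<in> uea_ideal"
    using uea_ideal.step[OF uea_ideal.zero, of 1 x y 1] by (simp add: diff_diff_eq)
  then show ?thesis
    by (simp add: u_of_vir_def times_uvir.abs_eq plus_uvir.abs_eq abs_uvir_eq_iff)
qed

lemma u_letter_Lgen: "u_letter (Lgen k) * u_letter (Lgen l) = u_letter (Lgen l) * u_letter (Lgen k)
    + (u_scale (of_int (k - l)) (u_letter (Lgen (k + l))) + u_scale (if k + l = 0 then vir_cocycle k else 0) (u_letter Cgen))"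
  using u_bracket[of "Lvir k" "Lvir l"]
  by (simp add: u_letter_def[symmetric] vir_bracket_single basis_bracket_Lgen u_of_vir_add u_of_vir_single
      u_of_vir_scale vector_space.vector_space_assms(4)[OF vs_u] del: basis_bracket.simps)

lemma u_letter_Cgen: "u_letter Cgen * u_letter p = u_letter p * u_letter Cgen"
  using u_bracket[of Cvir "Poly_Mapping.single p 1"]
  by (simp add: u_letter_def vir_bracket_single u_of_vir_def zero_uvir.abs_eq[symmetric])

lemma uvir_word_induct [case_names word add scale]:
  assumes "\<And>w. P (u_word w)" "\<And>u v. P u \<Longrightarrow> P v \<Longrightarrow> P (u + v)" "\<And>a u. P u \<Longrightarrow> P (u_scale a u)"
  shows "P u"
proof -
  have "P (abs_uvir f)" for f
  proof (induction f rule: poly_mapping_singles_induct)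
    case (1 v a)
    have "abs_uvir (Poly_Mapping.single v a) = u_scale a (u_word (letters v))"
      by (simp add: u_word_def u_scale_abs)
    then show ?case using assms(1,3) by simp
  next
    case (2 f g)
    then show ?case using assms(2) by (metis plus_uvir.abs_eq)
  qed
  from this[of "rep_uvir u"] show ?thesis by simp
qed

lemma uvir_induct [case_names one letter add scale]:
  assumes "P 1" "\<And>p u. P u \<Longrightarrow> P (u_letter p * u)" "\<And>u v. P u \<Longrightarrow> P v \<Longrightarrow> P (u + v)" "\<And>a u. P u \<Longrightarrow> P (u_scale a u)"
  shows "P u"
proof (induction u rule: uvir_word_induct)
  case (word w)
  show ?case by (induction w) (auto simp: u_word_Nil u_word_Cons assms)
qed (use assms in auto)

lemma u_letter_Cgen_central: "u_letter Cgen * u = u * u_letter Cgen"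
proof (induction u rule: uvir_induct)
  case (letter p u)
  then show ?case by (metis u_letter_Cgen mult.assoc)
qed (simp_all add: algebra_simps u_scale_mult)

text \<open>
  The universal property of the enveloping algebra in terms of words.
\<close>
definition u_ext :: "(complex \<Rightarrow> 'v \<Rightarrow> 'v) \<Rightarrow> (vir_basis list \<Rightarrow> 'v) \<Rightarrow> uvir \<Rightarrow> 'v::ab_group_add" where
  "u_ext s G u = lin_ext s (\<lambda>w. G (letters w)) (rep_uvir u)"

locale uvir_extension = vector_space s for s :: "complex \<Rightarrow> 'v::ab_group_add \<Rightarrow> 'v" +
  fixes G :: "vir_basis list \<Rightarrow> 'v"
  assumes L: "G (u @ Lgen k # Lgen l # v) = G (u @ Lgen l # Lgen k # v)
       + (s (of_int (k - l)) (G (u @ Lgen (k + l) # v)) + s (if k + l = 0 then vir_cocycle k else 0) (G (u @ Cgen # v)))"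
    and C: "G (u @ Cgen # p # v) = G (u @ p # Cgen # v)"
begin

lemmas vs = vector_space_axioms

lemma u_ext_abs: "u_ext s G (abs_uvir f) = lin_ext s (\<lambda>w. G (letters w)) f"
  using lin_ext_uea_ideal[OF vs L C rep_abs_uvir[of f]] by (simp add: u_ext_def lin_ext_diff[OF vs])

lemma u_ext_word: "u_ext s G (u_word w) = G w"
  by (simp add: u_word_def u_ext_abs lin_ext_single[OF vs])

lemma module_hom_u_ext: "module_hom u_scale s (u_ext s G)"
proof -
  have "u_ext s G (abs_uvir f + abs_uvir g) = u_ext s G (abs_uvir f) + u_ext s G (abs_uvir g)"
    "u_ext s G (u_scale a (abs_uvir f)) = s a (u_ext s G (abs_uvir f))" for f g a
    by (simp_all add: plus_uvir.abs_eq u_scale_abs u_ext_abs lin_ext_add[OF vs] lin_ext_scale[OF vs])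
  then have "u_ext s G (x + y) = u_ext s G x + u_ext s G y" "u_ext s G (u_scale a x) = s a (u_ext s G x)" for x y a
    by (metis abs_rep_uvir)+
  then show ?thesis using vs_u vs
    by (intro module_hom.intro module_hom_axioms.intro) (simp_all add: module_iff_vector_space)
qed

end

lemma subspace_balanced_rel: "module.subspace u_scale (balanced_rel E)"
proof -
  interpret vector_space u_scale by (rule vs_u)
  have add: "v \<in> balanced_rel E \<Longrightarrow> r \<in> balanced_rel E \<Longrightarrow> r + v \<in> balanced_rel E" for r v
    by (induction v rule: balanced_rel.induct) (simp_all add: add.assoc[symmetric] balanced_rel.step)
  have "u_scale a v \<in> balanced_rel E" if "v \<in> balanced_rel E" for a v
    using that
  proof (induction v rule: balanced_rel.induct)
    case (step r x \<chi> u)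
    have "u_scale a (r + (u * u_of_vir x - u_scale \<chi> u))
        = u_scale a r + (u_scale a u * u_of_vir x - u_scale \<chi> (u_scale a u))"
      by (simp add: scale_right_distrib scale_right_diff_distrib u_scale_mult mult.commute)
    then show ?case using balanced_rel.step[OF step.IH step.hyps(2), of "u_scale a u"] by (simp add: mult.commute)
  qed (simp add: balanced_rel.zero)
  with add show ?thesis by (auto simp: subspace_def balanced_rel.zero)
qed

lemma balanced_rel_left: "r \<in> balanced_rel E \<Longrightarrow> v * r \<in> balanced_rel E"
proof (induction r rule: balanced_rel.induct)
  case (step r x \<chi> u)
  have "v * (r + (u * u_of_vir x - u_scale \<chi> u)) = v * r + ((v * u) * u_of_vir x - u_scale \<chi> (v * u))"
    by (simp add: algebra_simps u_scale_mult)
  then show ?case using balanced_rel.step[OF step.IH step.hyps(2)] by simp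
qed (simp add: balanced_rel.zero)

lemma balanced_rel_gen: "(x, \<chi>) \<in> E \<Longrightarrow> u * u_of_vir x - u_scale \<chi> u \<in> balanced_rel E"
  using balanced_rel.step[OF balanced_rel.zero] by fastforce

lemma quotient_space_balanced: "quotient_space u_scale uvir_module (balanced_rel E)"
proof -
  interpret vector_space u_scale by (rule vs_u)
  show ?thesis
    by unfold_locales (simp_all add: uvir_module_def subspace_UNIV subspace_balanced_rel)
qed

lemma hom_balanced_rel:
  assumes "module_hom u_scale s h" "\<And>u x \<chi>. (x, \<chi>) \<in> E \<Longrightarrow> h (u * u_of_vir x) = s \<chi> (h u)" "r \<in> balanced_rel E"
  shows "h r = 0"
  using assms(3)
  by (induction r rule: balanced_rel.induct)
    (simp_all add: module_hom.zero[OF assms(1)] module_hom.add[OF assms(1)] module_hom.diff[OF assms(1)] module_hom.scale[OF assms(1)] assms(2))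

section \<open>Vertex operators on one Whittaker module\<close>

lemma Lvir_vir_pos: "0 < n \<Longrightarrow> Lvir n \<in> vir_pos"
  by (auto simp: vir_pos_def)

lemma zero_vir_pos: "0 \<in> vir_pos"
  by (auto simp: vir_pos_def lie_subalgebra_def)

interpretation uvir: vector_space u_scale by (rule vector_space_u_scale)

interpretation vac: quotient_space u_scale uvir_module "balanced_rel (vacuum_char c)" for c
  by (rule quotient_space_balanced)

lemma u_of_vir_lin_ext: "u_of_vir x = lin_ext u_scale u_letter x"
proof -
  have "u_of_vir (lin_ext pm_scale (\<lambda>p. Poly_Mapping.single p 1) x) = lin_ext u_scale (\<lambda>p. u_of_vir (Poly_Mapping.single p 1)) x"
    by (rule module_hom_lin_ext_comp[OF vs_pm module_hom_u_of_vir])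
  moreover have "lin_ext pm_scale (\<lambda>p. Poly_Mapping.single p 1) x = x"
    by (induction x rule: poly_mapping_singles_induct) (simp_all add: lin_ext_single[OF vs_pm] lin_ext_add[OF vs_pm])
  ultimately show ?thesis by (simp add: u_letter_def[abs_def])
qed

text \<open>
  Projecting along the relations makes the Whittaker module a subspace of the type \<open>uvir\<close>; the
  operators \<open>T\<close> and \<open>Z\<close> below extend its Vir-action to the whole type.
\<close>
locale whittaker_module =
  fixes c :: complex and \<Psi> :: "vir \<Rightarrow> complex"
  assumes whittaker: "whittaker_function \<Psi>" and L3: "3 \<le> n \<Longrightarrow> \<Psi> (Lvir n) = 0"
begin

abbreviation "R \<equiv> balanced_rel (whittaker_char c \<Psi>)"

sublocale U: quotient_space u_scale uvir_module R
  by (rule quotient_space_balanced)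

lemma Wh_eq: "Wh c \<Psi> = U.Q"
  by (simp add: Wh_def induced_module_def)

lemma carrier_uvir [simp]: "carrier uvir_module = UNIV"
  by (simp add: uvir_module_def)

lemma \<Psi>_zero: "\<Psi> 0 = 0"
  using whittaker zero_vir_pos unfolding whittaker_function_def by (metis add_cancel_right_right add_0)

lemma R_Lgen: "0 < n \<Longrightarrow> u * u_letter (Lgen n) - u_scale (\<Psi> (Lvir n)) u \<in> R"
  unfolding u_letter_def using Lvir_vir_pos[of n]
  by (intro balanced_rel_gen) (force simp: whittaker_char_def intro: exI[of _ 0])

lemma R_Cgen: "u * u_letter Cgen - u_scale c u \<in> R"
  unfolding u_letter_def using zero_vir_pos
  by (intro balanced_rel_gen) (force simp: whittaker_char_def \<Psi>_zero intro: exI[of _ 1])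

definition pr :: "uvir \<Rightarrow> uvir" where
  "pr = (SOME \<pi>. module_hom u_scale u_scale \<pi> \<and> (\<forall>x. \<pi> x = 0 \<longleftrightarrow> x \<in> R) \<and> (\<forall>x. x - \<pi> x \<in> R) \<and> (\<forall>x. \<pi> (\<pi> x) = \<pi> x))"

lemma pr: "module_hom u_scale u_scale pr" "pr x = 0 \<longleftrightarrow> x \<in> R" "x - pr x \<in> R" "pr (pr x) = pr x"
proof -
  have "\<exists>\<pi>. module_hom u_scale u_scale \<pi> \<and> (\<forall>x. \<pi> x = 0 \<longleftrightarrow> x \<in> R) \<and> (\<forall>x. x - \<pi> x \<in> R) \<and> (\<forall>x. \<pi> (\<pi> x) = \<pi> x)"
    by (rule projection_along[OF vs_u U.R_sub]) blast
  from someI_ex[OF this] show "module_hom u_scale u_scale pr" "pr x = 0 \<longleftrightarrow> x \<in> R" "x - pr x \<in> R" "pr (pr x) = pr x"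
    unfolding pr_def by blast+
qed

lemmas pr_lin = module_hom.add[OF pr(1)] module_hom.scale[OF pr(1)] module_hom.diff[OF pr(1)] module_hom.zero[OF pr(1)]
  module_hom.sum[OF pr(1)]

lemma pr_eq_iff: "pr x = pr y \<longleftrightarrow> x - y \<in> R"
  using pr(2)[of "x - y"] by (simp add: pr_lin)

lemma pr_left: "pr (v * pr u) = pr (v * u)"
proof -
  have "v * (u - pr u) \<in> R" by (rule balanced_rel_left[OF pr(3)])
  then show ?thesis by (metis pr_eq_iff right_diff_distrib)
qed

lemma pr_Cgen: "pr (u_letter Cgen * u) = u_scale c (pr u)"
  using R_Cgen[of u] by (simp add: u_letter_Cgen_central pr_lin(2)[symmetric] pr_eq_iff)

definition T :: "int \<Rightarrow> uvir \<Rightarrow> uvir" where "T k u = pr (u_letter (Lgen k) * u)"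
definition Z :: "uvir \<Rightarrow> uvir" where "Z u = pr (u_letter Cgen * u)"

text \<open>
  \<open>L(n)\<close> with \<open>n \<ge> 3\<close> annihilates the Whittaker vector, and \<open>L(n) L(k) u\<close> involves only \<open>L(n) u\<close> and
  \<open>L(n + k) u\<close>.
\<close>
lemma T_restricted_aux: "\<exists>N. \<forall>n\<ge>N. u_letter (Lgen n) * u \<in> R"
proof (induction u rule: uvir_induct)
  case one
  have "u_letter (Lgen n) * 1 \<in> R" if "3 \<le> n" for n
    using R_Lgen[of n 1] L3[OF that] that by simp
  then show ?case by blast
next
  case (letter p u)
  then obtain N where N: "\<And>n. N \<le> n \<Longrightarrow> u_letter (Lgen n) * u \<in> R" by blast
  show ?case
  proof (cases p)
    case (Lgen k)
    show ?thesis
    proof (intro exI[of _ "max N (max (N - k) (1 - k))"] allI impI)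
      fix n assume n: "max N (max (N - k) (1 - k)) \<le> n"
      then have "u_letter (Lgen n) * u_letter (Lgen k) = u_letter (Lgen k) * u_letter (Lgen n)
          + u_scale (of_int (n - k)) (u_letter (Lgen (n + k)))"
        by (subst u_letter_Lgen) auto
      then have "u_letter (Lgen n) * (u_letter p * u) = u_letter (Lgen k) * (u_letter (Lgen n) * u)
          + u_scale (of_int (n - k)) (u_letter (Lgen (n + k)) * u)"
        unfolding Lgen mult.assoc[symmetric] by (simp only: distrib_right u_scale_mult)
      also have "\<dots> \<in> R"
        using n by (intro uvir.subspace_add[OF U.R_sub] uvir.subspace_scale[OF U.R_sub] balanced_rel_left N) auto
      finally show "u_letter (Lgen n) * (u_letter p * u) \<in> R" .
    qed
  next
    case Cgen
    have "u_letter (Lgen n) * (u_letter p * u) = u_letter Cgen * (u_letter (Lgen n) * u)" for n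
      unfolding Cgen by (metis u_letter_Cgen mult.assoc)
    then show ?thesis using N balanced_rel_left by metis
  qed
next
  case (add u v)
  then obtain N M where "\<And>n. N \<le> n \<Longrightarrow> u_letter (Lgen n) * u \<in> R" "\<And>n. M \<le> n \<Longrightarrow> u_letter (Lgen n) * v \<in> R"
    by blast
  then show ?case
    by (intro exI[of _ "max N M"]) (auto simp: distrib_left intro: uvir.subspace_add[OF U.R_sub])
next
  case (scale a u)
  then show ?case using uvir.subspace_scale[OF U.R_sub] by (metis u_scale_mult(2))
qed

sublocale restricted_virasoro u_scale T Z
proof (intro restricted_virasoro.intro restricted_operators.intro restricted_operators_axioms.intro
    restricted_virasoro_axioms.intro vector_space_u_scale)
  show "module_hom u_scale u_scale (T k)" for k
    using pr(1) by unfold_locales (simp_all add: T_def distrib_left pr_lin u_scale_mult)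
  show "module_hom u_scale u_scale Z"
    using pr(1) by unfold_locales (simp_all add: Z_def distrib_left pr_lin u_scale_mult)
  show "\<exists>N. \<forall>n\<ge>N. T n x = 0" for x
    using T_restricted_aux[of x] by (simp add: T_def pr(2))
  show "T k (T l x) = T l (T k x) + (u_scale (of_int (k - l)) (T (k + l) x)
       + (if k + l = 0 then u_scale (vir_cocycle k) (Z x) else 0))" for k l x
  proof -
    have TT: "T k (T l x) = pr ((u_letter (Lgen k) * u_letter (Lgen l)) * x)" for k l
      by (simp add: T_def pr_left mult.assoc)
    show ?thesis
      unfolding TT[of k l] TT[of l k] u_letter_Lgen[of k l]
      by (simp add: T_def Z_def distrib_right pr_lin u_scale_mult del: of_int_diff)
  qed
  show "Z (T k x) = T k (Z x)" for k x
    by (simp add: T_def Z_def pr_left mult.assoc[symmetric] u_letter_Cgen)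
qed

lemma Z_pr: "Z (pr z) = u_scale c (pr z)"
  by (simp add: Z_def pr_left pr_Cgen)

sublocale word_ext: uvir_extension u_scale "\<lambda>w. word_field w m x" for m x
  by unfold_locales (rule word_field_bracket, rule word_field_Cgen)

definition field_of :: "uvir \<Rightarrow> int \<Rightarrow> uvir \<Rightarrow> uvir" where
  "field_of u m x = u_ext u_scale (\<lambda>w. word_field w m x) u"

lemma field_of_word: "field_of (u_word w) = word_field w"
  by (intro ext) (simp add: field_of_def word_ext.u_ext_word)

lemma field_of_hom_left: "module_hom u_scale u_scale (\<lambda>u. field_of u m x)"
  unfolding field_of_def by (rule word_ext.module_hom_u_ext)

lemma is_field_field_of: "is_field (field_of u)"
  unfolding is_field_def
proof (intro conjI allI)
  have f: "field_of u m x = (\<Sum>w\<in>Poly_Mapping.keys (rep_uvir u).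
     u_scale (Poly_Mapping.lookup (rep_uvir u) w) (word_field (letters w) m x))" for m x
    by (simp add: field_of_def u_ext_def lin_ext_def)
  show "module_hom u_scale u_scale (field_of u m)" for m
    by unfold_locales
      (simp_all add: f module_hom.add[OF field_hom[OF is_field_word]] module_hom.scale[OF field_hom[OF is_field_word]]
        uvir.scale_right_distrib sum.distrib uvir.scale_sum_right mult.commute)
  fix x
  have "\<forall>w. \<exists>N. \<forall>m\<ge>N. word_field w m x = 0"
    using field_annihilated[OF is_field_word] by (auto simp: annihilated_def)
  then obtain N where N: "\<And>w m. N w \<le> m \<Longrightarrow> word_field w m x = 0" by metis
  have "field_of u m x = 0" if "\<forall>w\<in>Poly_Mapping.keys (rep_uvir u). N (letters w) \<le> m" for m
    unfolding f using that by (simp add: N)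
  then have "\<forall>m \<ge> Max (insert 0 ((\<lambda>w. N (letters w)) ` Poly_Mapping.keys (rep_uvir u))). field_of u m x = 0"
    by auto
  then show "annihilated (field_of u) x" unfolding annihilated_def by blast
qed

lemma field_of_right_letter:
  "field_of (u * u_letter p) m x = lin_ext u_scale (\<lambda>w. word_field (letters w @ [p]) m x) (rep_uvir u)"
proof -
  have "u * u_letter p = abs_uvir (rep_uvir u * Poly_Mapping.single (Word [p]) 1)"
    by (simp add: times_uvir.abs_eq[symmetric] u_letter_def u_of_vir_def)
  then have "field_of (u * u_letter p) m x
    = lin_ext u_scale (\<lambda>w. word_field (letters w) m x) (rep_uvir u * Poly_Mapping.single (Word [p]) 1)"
    by (simp add: field_of_def word_ext.u_ext_abs)
  also have "lin_ext u_scale (\<lambda>w. word_field (letters w) m x) (f * Poly_Mapping.single (Word [p]) 1)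
     = lin_ext u_scale (\<lambda>w. word_field (letters w @ [p]) m x) f" for f
  proof (induction f rule: poly_mapping_singles_induct)
    case (1 w a)
    then show ?case by (cases w) (simp add: mult_single word_plus lin_ext_single[OF vs_u])
  qed (simp add: distrib_right lin_ext_add[OF vs_u])
  finally show ?thesis .
qed

lemma field_of_right_Lgen: "-1 \<le> k \<Longrightarrow> field_of (u * u_letter (Lgen k)) m x = 0"
  by (simp add: field_of_right_letter word_field_vacuum_L lin_ext_def)

lemma field_of_right_Cgen: "field_of (u * u_letter Cgen) m x = field_of u m (Z x)"
  unfolding field_of_right_letter word_field_vacuum_C by (simp add: field_of_def u_ext_def)

text \<open>
  The modes are well defined on the universal Virasoro vertex algebra: the relations are generated by \<open>u L(k)\<close> for
  \<open>k \<ge> -1\<close>, which acts as an iterate of the vanishing field \<open>L(k) 1\<close>, and by \<open>u (C - c)\<close>.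
\<close>
lemma field_of_vacuum_rel:
  assumes "v \<in> balanced_rel (vacuum_char c)"
  shows "field_of v m (pr z) = 0"
proof (rule hom_balanced_rel[OF field_of_hom_left _ assms])
  fix u y \<chi> assume "(y, \<chi>) \<in> vacuum_char c"
  then obtain x a where y: "y = x + pm_scale a Cvir" "\<chi> = a * c" "Poly_Mapping.keys x \<subseteq> Lgen ` {-1..}"
    by (auto simp: vacuum_char_def)
  note hom = module_hom.add[OF field_of_hom_left] module_hom.scale[OF field_of_hom_left] module_hom.sum[OF field_of_hom_left]
  have "u * u_of_vir x = (\<Sum>p\<in>Poly_Mapping.keys x. u_scale (Poly_Mapping.lookup x p) (u * u_letter p))"
    by (simp add: u_of_vir_lin_ext lin_ext_def sum_distrib_left u_scale_mult)
  moreover have "field_of (u * u_letter p) m (pr z) = 0" if "p \<in> Poly_Mapping.keys x" for p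
    using y(3) that field_of_right_Lgen by fastforce
  ultimately have "field_of (u * u_of_vir x) m (pr z) = 0" by (simp add: hom)
  then have "field_of (u * u_of_vir y) m (pr z) = u_scale a (field_of u m (Z (pr z)))"
    by (simp add: y u_of_vir_add u_of_vir_single distrib_left u_scale_mult hom field_of_right_Cgen)
  then show "field_of (u * u_of_vir y) m (pr z) = u_scale \<chi> (field_of u m (pr z))"
    by (simp add: Z_pr y module_hom.scale[OF field_hom[OF is_field_field_of]])
qed

definition mode :: "uvir \<Rightarrow> int \<Rightarrow> uvir \<Rightarrow> uvir" where
  "mode u m z = field_of u m (pr z)"

lemma cls_pr: "U.cls (pr z) = U.cls z"
  using uvir.subspace_neg[OF U.R_sub pr(3)[of z]] by (simp add: U.cls_eq_iff)

lemma induced_action_cls: "induced_action (whittaker_char c \<Psi>) (Lvir k) (U.cls z) = U.cls (T k z)"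
proof -
  have "induced_action (whittaker_char c \<Psi>) (Lvir k) (U.cls z) = (\<Union>u\<in>U.cls z. U.cls (u_letter (Lgen k) * u))"
    by (simp add: induced_action_def U.cls_def u_letter_def)
  also have "\<dots> = U.cls (u_letter (Lgen k) * z)"
  proof -
    have "U.cls (u_letter (Lgen k) * u) = U.cls (u_letter (Lgen k) * z)" if "u \<in> U.cls z" for u
      using that balanced_rel_left[of "u - z" _ "u_letter (Lgen k)"]
      by (simp add: U.mem_cls U.cls_eq_iff right_diff_distrib)
    moreover have "z \<in> U.cls z" by (simp add: U.mem_cls uvir.subspace_0[OF U.R_sub])
    ultimately show ?thesis by blast
  qed
  finally show ?thesis by (simp add: T_def cls_pr)
qed

text \<open>
  Summation over the indices with nonzero class and over those with nonzero representative differ by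
  summands in \<open>R\<close> only.
\<close>
lemma word_mode_cls:
  "word_mode (Wh c \<Psi>) c (\<lambda>n. induced_action (whittaker_char c \<Psi>) (Lvir n)) w m (U.cls z) = U.cls (word_field w m (pr z))"
proof (induction w arbitrary: m z)
  case Nil
  then show ?case by (simp add: vacuum_field_def Wh_eq U.zero_Q cls_pr)
next
  case (Cons p w)
  let ?T = "\<lambda>n. induced_action (whittaker_char c \<Psi>) (Lvir n)"
  show ?case
  proof (cases p)
    case Cgen
    have "pr (u_scale c (word_field w m (pr z))) = pr (Z (word_field w m (pr z)))"
      by (simp add: Z_def pr_Cgen pr pr_lin)
    then have "U.cls (u_scale c (word_field w m (pr z))) = U.cls (Z (word_field w m (pr z)))"
      by (simp only: pr_eq_iff U.cls_eq_iff)
    then show ?thesis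
      unfolding Cgen word_mode.simps vir_basis.case Cons.IH word_field.simps letter_field_def
      by (simp add: Wh_eq U.smult_Q)
  next
    case (Lgen k)
    let ?Y = "word_field w"
    note Y = is_field_word[of w]
    define t where "t i = u_scale (sbinom (k + 1) i) (T (k - int i) (?Y (m + int i) (pr z))
      - u_scale ((-1) powi (k + 1)) (?Y (k + 1 + m - int i) (T (int i - 1) (pr z))))" for i
    have prT: "pr (T j z) = T j (pr z)" for j z by (simp add: T_def pr pr_left)
    have it: "iterate_term (Wh c \<Psi>) ?T k (word_mode (Wh c \<Psi>) c ?T w) m (U.cls z) i = U.cls (t i)" for i
      unfolding iterate_term_def induced_action_cls Cons.IH prT unfolding Wh_eq
      by (simp add: U.smult_Q U.minus_Q t_def sbinom_def)
    obtain N where N: "\<And>i. m + int N \<le> i \<Longrightarrow> ?Y i (pr z) = 0" using annihilated_bound[OF field_annihilated[OF Y]] by blast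
    obtain K where K: "\<And>i. K \<le> i \<Longrightarrow> T (int i - 1) (pr z) = 0" using T_bound by blast
    have t0: "t i = 0" if "max N K \<le> i" for i using that by (simp add: t_def N K field_0[OF Y])
    have fin: "finite {i. t i \<noteq> 0}"
      by (rule finite_subset[of _ "{..<max N K}"]) (use t0 in \<open>auto simp: not_le[symmetric]\<close>)
    define A where "A = {i. U.cls (t i) \<noteq> U.cls 0}"
    have A: "A \<subseteq> {i. t i \<noteq> 0}" by (auto simp: A_def)
    have "(\<Sum>i\<in>{i. t i \<noteq> 0} - A. t i) \<in> R"
      by (rule uvir.subspace_sum[OF U.R_sub]) (simp add: A_def U.cls_eq_iff)
    then have "(\<Sum>i. t i) - sum t A \<in> R"
      using sum.subset_diff[OF A fin, of t] by (simp add: Sum_any.expand_set)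
    then have "U.cls (\<Sum>i. t i) = U.cls (sum t A)" by (simp only: U.cls_eq_iff)
    moreover have "word_mode (Wh c \<Psi>) c ?T (p # w) m (U.cls z) = U.cls (sum t A)"
    proof -
      have "word_mode (Wh c \<Psi>) c ?T (p # w) m (U.cls z)
         = finsum U.Q (\<lambda>i. U.cls (t i)) {i. U.cls (t i) \<noteq> \<zero>\<^bsub>U.Q\<^esub>}"
        unfolding Lgen word_mode.simps vir_basis.case it by (simp only: Wh_eq)
      then show ?thesis by (simp add: U.finsum_Q U.zero_Q A_def)
    qed
    ultimately show ?thesis
      unfolding Lgen word_field.simps letter_field_def vir_basis.case iterate_def t_def by (simp only:)
  qed
qed

lemma Wh_mode_cls: "Wh_mode c \<Psi> (vac.cls c u) m (U.cls z) = U.cls (mode u m z)"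
proof -
  let ?f = "rep_uvir (vac.rep (vac.cls c u))"
  have "Wh_mode c \<Psi> (vac.cls c u) m (U.cls z) = U.cls (\<Sum>w\<in>Poly_Mapping.keys ?f.
     u_scale (Poly_Mapping.lookup ?f w) (word_field (letters w) m (pr z)))"
    unfolding Wh_mode_def vir_mode_def vac.rep_def[symmetric] Let_def word_mode_cls
    by (simp add: Wh_eq U.smult_Q U.finsum_Q)
  also have "\<dots> = U.cls (field_of (vac.rep (vac.cls c u)) m (pr z))"
    by (simp add: field_of_def u_ext_def lin_ext_def)
  also have "field_of (vac.rep (vac.cls c u)) m (pr z) = field_of u m (pr z)"
    using field_of_vacuum_rel[OF vac.rep_cls[of c u], of m z] by (simp add: module_hom.diff[OF field_of_hom_left])
  finally show ?thesis by (simp add: mode_def)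
qed

end

section \<open>Tensor products of induced modules\<close>

interpretation pm: vector_space "pm_scale :: complex \<Rightarrow> ('x \<Rightarrow>\<^sub>0 complex) \<Rightarrow> _" by (rule vector_space_pm_scale)

lemma subspace_multilin_rel: "pm.subspace (multilin_rel M)"
proof -
  have add: "v \<in> multilin_rel M \<Longrightarrow> r \<in> multilin_rel M \<Longrightarrow> r + v \<in> multilin_rel M" for r v
    by (induction v rule: multilin_rel.induct) (simp_all only: add_0_right add.assoc[symmetric] multilin_rel.step)
  have scale: "pm_scale t v \<in> multilin_rel M" if "v \<in> multilin_rel M" for t v
    using that
  proof (induction v rule: multilin_rel.induct)
    case (step r X y i z s a b)
    show ?case
      using multilin_rel.step[OF step.IH step.hyps(2-4), of "t * s" a b]
      by (simp only: pm.scale_right_distrib pm.scale_scale)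
  qed (simp add: multilin_rel.zero)
  show ?thesis using add scale by (auto simp: pm.subspace_def multilin_rel.zero)
qed

lemma multilin_rel_gen:
  "\<lbrakk>X \<in> families M; y \<in> carrier (M i); z \<in> carrier (M i)\<rbrakk> \<Longrightarrow>
    Poly_Mapping.single (X(i := a \<odot>\<^bsub>M i\<^esub> y \<oplus>\<^bsub>M i\<^esub> b \<odot>\<^bsub>M i\<^esub> z)) 1
          - Poly_Mapping.single (X(i := y)) a - Poly_Mapping.single (X(i := z)) b \<in> multilin_rel M"
  using multilin_rel.step[OF multilin_rel.zero, of X M y i z 1 a b] by simp

lemma lin_ext_multilin_rel:
  assumes vs: "vector_space s"
    and F: "\<And>X i y z a b. X \<in> families M \<Longrightarrow> y \<in> carrier (M i) \<Longrightarrow> z \<in> carrier (M i) \<Longrightarrow>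
      F (X(i := a \<odot>\<^bsub>M i\<^esub> y \<oplus>\<^bsub>M i\<^esub> b \<odot>\<^bsub>M i\<^esub> z)) = s a (F (X(i := y))) + s b (F (X(i := z)))"
    and r: "r \<in> multilin_rel M"
  shows "lin_ext s F r = 0"
proof -
  interpret vector_space s by (rule vs)
  show ?thesis using r
    by (induction r rule: multilin_rel.induct)
      (simp_all add: lin_ext_zero[OF vs] lin_ext_add[OF vs] lin_ext_scale[OF vs] lin_ext_diff[OF vs] lin_ext_single[OF vs] F)
qed

lemma subspace_keys: "pm.subspace {f. Poly_Mapping.keys f \<subseteq> A}"
proof -
  have "{f. Poly_Mapping.keys f \<subseteq> A} = {f. \<forall>x. x \<notin> A \<longrightarrow> Poly_Mapping.lookup f x = (0::complex)}"
    by (auto simp: in_keys_iff)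
  then show ?thesis by (simp add: pm.subspace_def lookup_add)
qed

text \<open>
  The common setting for \<open>Virc c \<otimes> \<dots> \<otimes> Virc c\<close> and for the tensor product of the Whittaker modules: factors are
  quotients of \<open>uvir\<close>, so that pure tensors are parametrized by functions into \<open>uvir\<close>.
\<close>
locale balanced_tensor =
  fixes E :: "'n::finite \<Rightarrow> (vir \<times> complex) set"
begin

sublocale U: quotient_space u_scale uvir_module "balanced_rel (E i)" for i
  by (rule quotient_space_balanced)

definition M :: "'n \<Rightarrow> (complex, uvir set) module" where "M i = induced_module (E i)"

lemma M_eq: "M i = U.Q i"
  by (simp add: M_def induced_module_def)

lemma carrier_uvir: "carrier uvir_module = UNIV"
  by (simp add: uvir_module_def)

lemma carrier_free: "carrier (free_module (families M)) = {f. Poly_Mapping.keys f \<subseteq> families M}"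
  by (simp add: free_module_def)

lemma M_lincomb: "y \<in> carrier (M i) \<Longrightarrow> z \<in> carrier (M i) \<Longrightarrow> a \<odot>\<^bsub>M i\<^esub> y \<oplus>\<^bsub>M i\<^esub> b \<odot>\<^bsub>M i\<^esub> z \<in> carrier (M i)"
  unfolding M_eq U.carrier_Q carrier_uvir by (auto simp: U.smult_Q U.add_Q)

lemma families_upd: "X \<in> families M \<Longrightarrow> y \<in> carrier (M i) \<Longrightarrow> X(i := y) \<in> families M"
  by (simp add: families_def)

lemma multilin_rel_carrier: "r \<in> multilin_rel M \<Longrightarrow> Poly_Mapping.keys r \<subseteq> families M"
proof (induction r rule: multilin_rel.induct)
  case (step r X y i z s a b)
  note sub = subspace_keys[of "families M"]
  have single: "Poly_Mapping.single Y q \<in> {f. Poly_Mapping.keys f \<subseteq> families M}" if "Y \<in> families M" for Y and q :: complex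
    using that by simp
  have "r + pm_scale s
         (Poly_Mapping.single (X(i := a \<odot>\<^bsub>M i\<^esub> y \<oplus>\<^bsub>M i\<^esub> b \<odot>\<^bsub>M i\<^esub> z)) 1
          - Poly_Mapping.single (X(i := y)) a - Poly_Mapping.single (X(i := z)) b) \<in> {f. Poly_Mapping.keys f \<subseteq> families M}"
    using step.IH
    by (intro pm.subspace_add[OF sub] pm.subspace_scale[OF sub] pm.subspace_diff[OF sub] single families_upd M_lincomb step.hyps)
      simp
  then show ?case by simp
qed simp

sublocale W: quotient_space pm_scale "free_module (families M)" "multilin_rel M"
proof unfold_locales
  show "pm.subspace (carrier (free_module (families M)))"
    unfolding carrier_free by (rule subspace_keys)
  show "multilin_rel M \<subseteq> carrier (free_module (families M))"
    using multilin_rel_carrier by (auto simp: carrier_free)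
qed (simp_all add: free_module_def subspace_multilin_rel)

lemma tensor_module_eq: "tensor_module M = W.Q"
  by (simp add: tensor_module_def)

lemma tensor_class_eq: "tensor_class M = W.cls"
  by (intro ext) (simp add: tensor_class_def W.cls_def)

definition clsf :: "('n \<Rightarrow> uvir) \<Rightarrow> 'n \<Rightarrow> uvir set" where "clsf Y = (\<lambda>i. U.cls i (Y i))"
definition repf :: "('n \<Rightarrow> uvir set) \<Rightarrow> 'n \<Rightarrow> uvir" where "repf X = (\<lambda>i. SOME u. u \<in> X i)"

lemma clsf_families: "clsf Y \<in> families M"
  by (simp add: families_def clsf_def M_eq U.carrier_Q carrier_uvir)

lemma clsf_repf: "X \<in> families M \<Longrightarrow> clsf (repf X) = X"
  using U.rep_carrier(2) by (auto simp: families_def clsf_def repf_def M_eq U.rep_def)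

lemma repf_clsf: "repf (clsf Y) i - Y i \<in> balanced_rel (E i)"
  using U.rep_cls[of i "Y i"] by (simp add: repf_def clsf_def U.rep_def)

lemma clsf_eq: "(\<And>i. Y i - Y' i \<in> balanced_rel (E i)) \<Longrightarrow> clsf Y = clsf Y'"
  unfolding clsf_def by (rule ext) (simp add: U.cls_eq_iff)

text \<open>
  The second condition says that \<open>\<phi>\<close> depends only on the cosets of the arguments.
\<close>
definition multilinear :: "(complex \<Rightarrow> 'v \<Rightarrow> 'v) \<Rightarrow> (('n \<Rightarrow> uvir) \<Rightarrow> 'v::ab_group_add) \<Rightarrow> bool" where
  "multilinear s \<phi> \<longleftrightarrow>
     (\<forall>Y i a b y z. \<phi> (Y(i := u_scale a y + u_scale b z)) = s a (\<phi> (Y(i := y))) + s b (\<phi> (Y(i := z)))) \<and>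
     (\<forall>Y Y'. (\<forall>i. Y i - Y' i \<in> balanced_rel (E i)) \<longrightarrow> \<phi> Y = \<phi> Y')"

lemma multilinearD:
  assumes "multilinear s \<phi>"
  shows "\<phi> (Y(i := u_scale a y + u_scale b z)) = s a (\<phi> (Y(i := y))) + s b (\<phi> (Y(i := z)))"
    and "(\<And>i. Y i - Y' i \<in> balanced_rel (E i)) \<Longrightarrow> \<phi> Y = \<phi> Y'"
  using assms unfolding multilinear_def by blast+

text \<open>
  The universal property of the tensor product: representatives are chosen in every factor, and a
  multilinear \<open>\<phi>\<close> does not see the choice.
\<close>
definition lift :: "(complex \<Rightarrow> 'v \<Rightarrow> 'v) \<Rightarrow> (('n \<Rightarrow> uvir) \<Rightarrow> 'v::ab_group_add) \<Rightarrow> (('n \<Rightarrow> uvir set) \<Rightarrow>\<^sub>0 complex) \<Rightarrow> 'v" where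
  "lift s \<phi> = lin_ext s (\<lambda>X. \<phi> (repf X))"

lemma lift_multilin_rel:
  assumes vs: "vector_space s" and \<phi>: "multilinear s \<phi>" and r: "r \<in> multilin_rel M"
  shows "lift s \<phi> r = 0"
  unfolding lift_def
proof (rule lin_ext_multilin_rel[OF vs _ r])
  fix X i y z a b assume X: "X \<in> families M" and "y \<in> carrier (M i)" "z \<in> carrier (M i)"
  then obtain u v where yz: "y = U.cls i u" "z = U.cls i v" by (auto simp: M_eq U.carrier_Q)
  have rep: "repf (X(i := A)) = (repf X)(i := U.rep A)" for A
    by (auto simp: repf_def U.rep_def)
  have cong: "\<phi> ((repf X)(i := U.rep (U.cls i t))) = \<phi> ((repf X)(i := t))" for t
    by (rule multilinearD(2)[OF \<phi>]) (simp add: U.rep_cls uvir.subspace_0[OF U.R_sub])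
  show "\<phi> (repf (X(i := a \<odot>\<^bsub>M i\<^esub> y \<oplus>\<^bsub>M i\<^esub> b \<odot>\<^bsub>M i\<^esub> z))) = s a (\<phi> (repf (X(i := y)))) + s b (\<phi> (repf (X(i := z))))"
    unfolding rep yz M_eq U.smult_Q U.add_Q cong by (rule multilinearD(1)[OF \<phi>])
qed

lemma lift_clsf:
  assumes "vector_space s" "multilinear s \<phi>"
  shows "lift s \<phi> (Poly_Mapping.single (clsf Y) a) = s a (\<phi> Y)"
  unfolding lift_def using multilinearD(2)[OF assms(2) repf_clsf] by (simp add: lin_ext_single[OF assms(1)])

definition proj :: "(('n \<Rightarrow> uvir set) \<Rightarrow>\<^sub>0 complex) \<Rightarrow> ('n \<Rightarrow> uvir set) \<Rightarrow>\<^sub>0 complex" where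
  "proj = (SOME \<pi>. module_hom pm_scale pm_scale \<pi> \<and> (\<forall>x. \<pi> x = 0 \<longleftrightarrow> x \<in> multilin_rel M)
     \<and> (\<forall>x. x - \<pi> x \<in> multilin_rel M) \<and> (\<forall>x. \<pi> (\<pi> x) = \<pi> x))"

lemma proj: "module_hom pm_scale pm_scale proj" "proj x = 0 \<longleftrightarrow> x \<in> multilin_rel M"
  "x - proj x \<in> multilin_rel M" "proj (proj x) = proj x"
proof -
  have "\<exists>\<pi>. module_hom pm_scale pm_scale \<pi> \<and> (\<forall>x. \<pi> x = 0 \<longleftrightarrow> x \<in> multilin_rel M)
     \<and> (\<forall>x. x - \<pi> x \<in> multilin_rel M) \<and> (\<forall>x. \<pi> (\<pi> x) = \<pi> x)"
    by (rule projection_along[OF vs_pm W.R_sub]) blast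
  from someI_ex[OF this] show "module_hom pm_scale pm_scale proj" "proj x = 0 \<longleftrightarrow> x \<in> multilin_rel M"
    "x - proj x \<in> multilin_rel M" "proj (proj x) = proj x"
    unfolding proj_def by blast+
qed

lemmas proj_lin = module_hom.add[OF proj(1)] module_hom.scale[OF proj(1)] module_hom.diff[OF proj(1)]
  module_hom.zero[OF proj(1)] module_hom.sum[OF proj(1)]

lemma proj_eq_iff: "proj x = proj y \<longleftrightarrow> x - y \<in> multilin_rel M"
  using proj(2)[of "x - y"] by (simp add: proj_lin)

lemma proj_eq_iff_cls: "proj x = proj y \<longleftrightarrow> W.cls x = W.cls y"
  by (simp add: proj_eq_iff W.cls_eq_iff)

lemma lift_proj:
  assumes "vector_space s" "multilinear s \<phi>"
  shows "lift s \<phi> (proj x) = lift s \<phi> x"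
  using lift_multilin_rel[OF assms proj(3)[of x]] by (simp add: lift_def lin_ext_diff[OF assms(1)])

definition pure :: "('n \<Rightarrow> uvir) \<Rightarrow> ('n \<Rightarrow> uvir set) \<Rightarrow>\<^sub>0 complex" where
  "pure Y = proj (Poly_Mapping.single (clsf Y) 1)"

lemma proj_single: "proj (Poly_Mapping.single (clsf Y) a) = pm_scale a (pure Y)"
  by (simp add: pure_def proj_lin(2)[symmetric])

lemma lift_pure:
  assumes "vector_space s" "multilinear s \<phi>"
  shows "lift s \<phi> (pure Y) = \<phi> Y"
proof -
  interpret vector_space s by (rule assms)
  show ?thesis unfolding pure_def lift_proj[OF assms] lift_clsf[OF assms] by simp
qed

lemma multilinear_pure: "multilinear pm_scale pure"
  unfolding multilinear_def
proof (intro conjI allI impI)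
  fix Y i a b y z
  have c: "clsf (Y(i := t)) = (clsf Y)(i := U.cls i t)" for t
    by (rule ext) (simp add: clsf_def)
  have "Poly_Mapping.single (clsf (Y(i := u_scale a y + u_scale b z))) 1
      - Poly_Mapping.single (clsf (Y(i := y))) a - Poly_Mapping.single (clsf (Y(i := z))) b \<in> multilin_rel M"
    using multilin_rel_gen[OF clsf_families[of Y], of "U.cls i y" i "U.cls i z" a b]
    unfolding c by (simp add: M_eq U.smult_Q U.add_Q U.carrier_Q carrier_uvir)
  then have "proj (Poly_Mapping.single (clsf (Y(i := u_scale a y + u_scale b z))) 1
      - Poly_Mapping.single (clsf (Y(i := y))) a - Poly_Mapping.single (clsf (Y(i := z))) b) = 0"
    by (simp only: proj)
  then show "pure (Y(i := u_scale a y + u_scale b z)) = pm_scale a (pure (Y(i := y))) + pm_scale b (pure (Y(i := z)))"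
    by (simp add: proj_lin proj_single algebra_simps)
next
  fix Y Y' assume "\<forall>i. Y i - Y' i \<in> balanced_rel (E i)"
  then show "pure Y = pure Y'" using clsf_eq[of Y Y'] by (simp add: pure_def)
qed

lemmas pure_cong = multilinearD(2)[OF multilinear_pure]

lemma pure_hom: "module_hom u_scale pm_scale (\<lambda>u. pure (Y(i := u)))"
proof unfold_locales
  show "pure (Y(i := u + v)) = pure (Y(i := u)) + pure (Y(i := v))" for u v
    using multilinearD(1)[OF multilinear_pure, of Y i 1 u 1 v] by simp
  show "pure (Y(i := u_scale a u)) = pm_scale a (pure (Y(i := u)))" for u a
    using multilinearD(1)[OF multilinear_pure, of Y i a u 0 0] by simp
qed

lemmas pure_lin = module_hom.add[OF pure_hom] module_hom.scale[OF pure_hom] module_hom.diff[OF pure_hom]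
  module_hom.zero[OF pure_hom] module_hom.sum[OF pure_hom]

lemma pure_zero: "Y i \<in> balanced_rel (E i) \<Longrightarrow> pure Y = 0"
  using pure_cong[of Y "Y(i := 0)"] pure_lin(4)[of Y i] uvir.subspace_0[OF U.R_sub] by (simp split: if_splits)

lemma multilinearI:
  assumes hom: "\<And>Y i. module_hom u_scale s (\<lambda>u. \<phi> (Y(i := u)))"
    and cong: "\<And>Y Y'. (\<And>i. Y i - Y' i \<in> balanced_rel (E i)) \<Longrightarrow> \<phi> Y = \<phi> Y'"
  shows "multilinear s \<phi>"
  unfolding multilinear_def
  using module_hom.add[OF hom] module_hom.scale[OF hom] cong by metis

lemma module_hom_lift: "vector_space s \<Longrightarrow> module_hom pm_scale s (lift s \<phi>)"
  unfolding lift_def by (rule module_hom_lin_ext)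

lemma lift_eqI:
  assumes vs: "vector_space s" and "module_hom pm_scale s f" "module_hom pm_scale s g"
    and "\<And>X. f (Poly_Mapping.single X 1) = g (Poly_Mapping.single X 1)"
  shows "f x = g x"
proof (induction x rule: poly_mapping_singles_induct)
  case (1 X a)
  have "f (pm_scale a (Poly_Mapping.single X 1)) = g (pm_scale a (Poly_Mapping.single X 1))"
    by (simp only: module_hom.scale[OF assms(2)] module_hom.scale[OF assms(3)] assms(4))
  then show ?case by simp
next
  case (2 x y)
  then show ?case by (simp add: module_hom.add[OF assms(2)] module_hom.add[OF assms(3)])
qed

lemma multilinear_left_mult: "multilinear pm_scale (\<lambda>Y. pure (Y(i := v * Y i)))"
proof (rule multilinearI)
  fix Y j
  show "module_hom u_scale pm_scale (\<lambda>u. pure ((Y(j := u))(i := v * (Y(j := u)) i)))"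
  proof (cases "i = j")
    case True
    have "module_hom u_scale pm_scale (\<lambda>u. pure (Y(j := v * u)))"
      by unfold_locales (simp_all add: distrib_left pure_lin u_scale_mult)
    then show ?thesis using True by simp
  next
    case False
    have "module_hom u_scale pm_scale (\<lambda>u. pure ((Y(i := v * Y i))(j := u)))" by (rule pure_hom)
    then show ?thesis using False by (simp add: fun_upd_twist)
  qed
next
  fix Y Y' assume Y: "\<And>i. Y i - Y' i \<in> balanced_rel (E i)"
  have "v * (Y i - Y' i) \<in> balanced_rel (E i)" by (rule balanced_rel_left[OF Y])
  then show "pure (Y(i := v * Y i)) = pure (Y'(i := v * Y' i))"
    using Y by (intro pure_cong) (simp add: right_diff_distrib)
qed

definition act_at :: "'n \<Rightarrow> uvir \<Rightarrow> (('n \<Rightarrow> uvir set) \<Rightarrow>\<^sub>0 complex) \<Rightarrow> ('n \<Rightarrow> uvir set) \<Rightarrow>\<^sub>0 complex" where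
  "act_at i v = lift pm_scale (\<lambda>Y. pure (Y(i := v * Y i)))"

lemma act_at_hom: "module_hom pm_scale pm_scale (act_at i v)"
  unfolding act_at_def by (rule module_hom_lift[OF vs_pm])

lemma act_at_pure: "act_at i v (pure Y) = pure (Y(i := v * Y i))"
  unfolding act_at_def by (rule lift_pure[OF vs_pm multilinear_left_mult])

lemma act_at_single: "act_at i v (Poly_Mapping.single X 1) = pure ((repf X)(i := v * repf X i))"
  by (simp add: act_at_def lift_def lin_ext_single[OF vs_pm])

lemma act_at_act_at_same: "act_at i v (act_at i v' x) = act_at i (v * v') x"
proof (rule lift_eqI[OF vs_pm _ act_at_hom])
  show "module_hom pm_scale pm_scale (\<lambda>x. act_at i v (act_at i v' x))"
    using module_hom_compose[OF act_at_hom act_at_hom] by (simp add: o_def)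
qed (simp add: act_at_single act_at_pure mult.assoc)

lemma act_at_act_at_other:
  assumes "i \<noteq> j" shows "act_at i v (act_at j v' x) = act_at j v' (act_at i v x)"
proof -
  have hom: "module_hom pm_scale pm_scale (\<lambda>x. act_at i v (act_at j v' x))" for i j v v'
    using module_hom_compose[OF act_at_hom act_at_hom] by (simp add: o_def)
  show ?thesis
    by (rule lift_eqI[OF vs_pm hom hom]) (use assms in \<open>simp add: act_at_single act_at_pure fun_upd_twist\<close>)
qed

lemma act_at_lin: "act_at i (u + v) x = act_at i u x + act_at i v x" "act_at i (u_scale a v) x = pm_scale a (act_at i v x)"
proof -
  have e: "act_at i v x = lin_ext pm_scale (\<lambda>X. pure ((repf X)(i := v * repf X i))) x" for v
    by (simp add: act_at_def lift_def)
  show "act_at i (u + v) x = act_at i u x + act_at i v x"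
    unfolding e by (simp add: distrib_right pure_lin lin_ext_add_fun[OF vs_pm])
  show "act_at i (u_scale a v) x = pm_scale a (act_at i v x)"
    unfolding e by (simp add: u_scale_mult pure_lin lin_ext_scale_fun[OF vs_pm])
qed

end

section \<open>The tensor product of Whittaker modules\<close>

lemma vir_pos_keys: "x \<in> vir_pos \<Longrightarrow> Poly_Mapping.keys x \<subseteq> Lgen ` {1..}"
proof -
  let ?S = "{x. Poly_Mapping.keys x \<subseteq> Lgen ` {1..}} :: vir set"
  have sub: "pm.subspace ?S" by (rule subspace_keys)
  have "vir_bracket x y \<in> ?S" if xy: "x \<in> ?S" "y \<in> ?S" for x y
  proof -
    have "basis_bracket p q \<in> ?S" if "p \<in> Poly_Mapping.keys x" "q \<in> Poly_Mapping.keys y" for p q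
    proof -
      have "p \<in> Lgen ` {1..}" "q \<in> Lgen ` {1..}" using that xy by auto
      then obtain k l where kl: "p = Lgen k" "q = Lgen l" "1 \<le> k" "1 \<le> l" by auto
      then have "basis_bracket p q = Poly_Mapping.single (Lgen (k + l)) (of_int (k - l))"
        by (simp add: basis_bracket_Lgen)
      then show ?thesis using kl by simp
    qed
    then show ?thesis
      unfolding vir_bracket_def by (intro pm.subspace_sum[OF sub] pm.subspace_scale[OF sub])
  qed
  then have "lie_subalgebra ?S"
    using pm.subspace_0[OF sub] pm.subspace_add[OF sub] pm.subspace_scale[OF sub] unfolding lie_subalgebra_def by blast
  moreover have "Lvir n \<in> ?S" if "0 < n" for n using that by simp
  ultimately show "x \<in> vir_pos \<Longrightarrow> Poly_Mapping.keys x \<subseteq> Lgen ` {1..}" unfolding vir_pos_def by blast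
qed

lemma vector_space_complex: "vector_space ((*) :: complex \<Rightarrow> complex \<Rightarrow> complex)"
  by unfold_locales (simp_all add: algebra_simps)

lemma lie_subalgebra_vir_pos: "lie_subalgebra vir_pos"
  unfolding vir_pos_def lie_subalgebra_def by blast

lemma subspace_vir_pos: "pm.subspace vir_pos"
  using lie_subalgebra_vir_pos by (auto simp: lie_subalgebra_def pm.subspace_def)

context whittaker_module
begin

text \<open>
  A Whittaker function is linear on \<open>vir_pos\<close> only, and all its arguments there are combinations of
  \<open>L(n)\<close>, \<open>n > 0\<close>.
\<close>
lemma \<Psi>_expand:
  assumes "x \<in> vir_pos"
  shows "\<Psi> x = (\<Sum>p\<in>Poly_Mapping.keys x. Poly_Mapping.lookup x p * \<Psi> (Poly_Mapping.single p 1))"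
proof -
  have single: "Poly_Mapping.single p 1 \<in> vir_pos" if "p \<in> Poly_Mapping.keys x" for p
    using vir_pos_keys[OF assms] that Lvir_vir_pos by fastforce
  have "(\<Sum>p\<in>A. pm_scale (Poly_Mapping.lookup x p) (Poly_Mapping.single p 1)) \<in> vir_pos \<and>
     \<Psi> (\<Sum>p\<in>A. pm_scale (Poly_Mapping.lookup x p) (Poly_Mapping.single p 1))
      = (\<Sum>p\<in>A. Poly_Mapping.lookup x p * \<Psi> (Poly_Mapping.single p 1))"
    if "finite A" "A \<subseteq> Poly_Mapping.keys x" for A
    using that
  proof (induction A rule: finite_induct)
    case empty
    show ?case using \<Psi>_zero zero_vir_pos by simp
  next
    case (insert p A)
    have p: "pm_scale (Poly_Mapping.lookup x p) (Poly_Mapping.single p 1) \<in> vir_pos"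
      using insert.prems single by (intro pm.subspace_scale[OF subspace_vir_pos]) auto
    have "\<Psi> (pm_scale (Poly_Mapping.lookup x p) (Poly_Mapping.single p 1)) = Poly_Mapping.lookup x p * \<Psi> (Poly_Mapping.single p 1)"
      using whittaker single[of p] insert.prems unfolding whittaker_function_def by blast
    then show ?case
      using insert p whittaker pm.subspace_add[OF subspace_vir_pos p]
      unfolding whittaker_function_def by (simp del: pm_scale_single)
  qed
  from this[of "Poly_Mapping.keys x"]
  have "\<Psi> (\<Sum>p\<in>Poly_Mapping.keys x. pm_scale (Poly_Mapping.lookup x p) (Poly_Mapping.single p 1))
      = (\<Sum>p\<in>Poly_Mapping.keys x. Poly_Mapping.lookup x p * \<Psi> (Poly_Mapping.single p 1))"
    by (simp del: pm_scale_single)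
  moreover have "(\<Sum>p\<in>Poly_Mapping.keys x. pm_scale (Poly_Mapping.lookup x p) (Poly_Mapping.single p 1)) = x"
    by (rule poly_mapping_eqI) (auto simp: lookup_sum lookup_single when_def in_keys_iff)
  ultimately show ?thesis by simp
qed

definition L_part :: "vir_basis list \<Rightarrow> int list" where
  "L_part v = concat (map (\<lambda>p. case p of Lgen k \<Rightarrow> [k] | Cgen \<Rightarrow> []) v)"

lemma L_part_simps [simp]: "L_part [] = []" "L_part (Lgen k # v) = k # L_part v" "L_part (Cgen # v) = L_part v"
  "L_part (u @ v) = L_part u @ L_part v"
  by (simp_all add: L_part_def)

text \<open>
  The central letters commute with everything and count a factor \<open>c\<close> each.
\<close>
definition word_value :: "vir_basis list \<Rightarrow> complex" where
  "word_value v = c ^ length (filter ((=) Cgen) v) * straighten c (whittaker_weight (\<lambda>k. \<Psi> (Lvir k))) (L_part v)"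

lemma uvir_extension_word_value: "uvir_extension (*) word_value"
proof (intro uvir_extension.intro uvir_extension_axioms.intro vector_space_complex)
  show "word_value (u @ Lgen k # Lgen l # v) = word_value (u @ Lgen l # Lgen k # v) +
      (of_int (k - l) * word_value (u @ Lgen (k + l) # v)
       + (if k + l = 0 then vir_cocycle k else 0) * word_value (u @ Cgen # v))" for u k l v
    unfolding word_value_def L_part_simps filter.simps filter_append length_append
      straighten_commute[of c _ "L_part u" k l "L_part v"]
    by (simp add: straighten_step_def power_add algebra_simps)
  show "word_value (u @ Cgen # p # v) = word_value (u @ p # Cgen # v)" for u p v
    by (cases p) (simp_all add: word_value_def)
qed

text \<open>
  The linear form that reads off the coefficient of the Whittaker vector; it shows that this vector is
  not zero.
\<close>
definition counit :: "uvir \<Rightarrow> complex" where "counit = u_ext (*) word_value"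

lemma counit_hom: "module_hom u_scale (*) counit"
  unfolding counit_def by (rule uvir_extension.module_hom_u_ext[OF uvir_extension_word_value])

lemmas counit_lin = module_hom.add[OF counit_hom] module_hom.scale[OF counit_hom] module_hom.diff[OF counit_hom]
  module_hom.zero[OF counit_hom] module_hom.sum[OF counit_hom]

lemma counit_one: "counit 1 = 1"
  unfolding u_word_Nil[symmetric] counit_def uvir_extension.u_ext_word[OF uvir_extension_word_value]
  by (simp add: word_value_def straighten.simps whittaker_weight_def)

lemma counit_Lgen: "0 < n \<Longrightarrow> counit (u * u_letter (Lgen n)) = \<Psi> (Lvir n) * counit u"
proof (induction u rule: uvir_word_induct)
  case (word w)
  then show ?case
    unfolding u_word_snoc counit_def uvir_extension.u_ext_word[OF uvir_extension_word_value]
    by (simp add: word_value_def straighten_whittaker L3)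
next
  case (add u v)
  then show ?case by (simp only: distrib_right distrib_left counit_lin)
next
  case (scale a u)
  then show ?case by (simp only: u_scale_mult counit_lin mult.left_commute)
qed

lemma counit_Cgen: "counit (u * u_letter Cgen) = c * counit u"
proof (induction u rule: uvir_word_induct)
  case (word w)
  then show ?case
    unfolding u_word_snoc counit_def uvir_extension.u_ext_word[OF uvir_extension_word_value]
    by (simp add: word_value_def)
next
  case (add u v)
  then show ?case by (simp only: distrib_right distrib_left counit_lin)
next
  case (scale a u)
  then show ?case by (simp only: u_scale_mult counit_lin mult.left_commute)
qed

lemma counit_rel:
  assumes "r \<in> R" shows "counit r = 0"
proof (rule hom_balanced_rel[OF counit_hom _ assms])
  fix u y \<chi> assume "(y, \<chi>) \<in> whittaker_char c \<Psi>"
  then obtain x z where y: "y = x + pm_scale z Cvir" "\<chi> = \<Psi> x + z * c" "x \<in> vir_pos"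
    by (auto simp: whittaker_char_def)
  have "u * u_of_vir x = (\<Sum>p\<in>Poly_Mapping.keys x. u_scale (Poly_Mapping.lookup x p) (u * u_letter p))"
    by (simp add: u_of_vir_lin_ext lin_ext_def sum_distrib_left u_scale_mult)
  then have "counit (u * u_of_vir x) = (\<Sum>p\<in>Poly_Mapping.keys x. Poly_Mapping.lookup x p * counit (u * u_letter p))"
    by (simp add: counit_lin)
  also have "\<dots> = (\<Sum>p\<in>Poly_Mapping.keys x. Poly_Mapping.lookup x p * \<Psi> (Poly_Mapping.single p 1) * counit u)"
    by (rule sum.cong) (use vir_pos_keys[OF y(3)] in \<open>auto simp: counit_Lgen\<close>)
  finally have "counit (u * u_of_vir x) = \<Psi> x * counit u"
    by (simp add: \<Psi>_expand[OF y(3)] sum_distrib_right)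
  then show "counit (u * u_of_vir y) = \<chi> * counit u"
    unfolding y u_of_vir_add pm_scale_single u_of_vir_single distrib_left u_scale_mult counit_lin counit_Cgen
    by (simp add: distrib_right)
qed

end

locale whittaker_tensor =
  fixes c :: complex and \<Psi> :: "'n::finite \<Rightarrow> vir \<Rightarrow> complex"
  assumes whittaker: "whittaker_function (\<Psi> i)" and L3: "3 \<le> n \<Longrightarrow> \<Psi> i (Lvir n) = 0"
    and nontrivial: "\<exists>x\<in>vir_pos. \<Psi> i x \<noteq> 0"
begin

sublocale F: whittaker_module c "\<Psi> i" for i
  by unfold_locales (rule whittaker, rule L3)

sublocale balanced_tensor "\<lambda>i. whittaker_char c (\<Psi> i)" .

sublocale vt: balanced_tensor "\<lambda>i::'n. vacuum_char c" .

definition L_at :: "'n \<Rightarrow> int \<Rightarrow> _" where "L_at i k = act_at i (u_letter (Lgen k))"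
definition C_at :: "'n \<Rightarrow> _" where "C_at i = act_at i (u_letter Cgen)"

lemma L_at_pure: "L_at i k (pure Y) = pure (Y(i := u_letter (Lgen k) * Y i))"
  by (simp add: L_at_def act_at_pure)

lemma L_at_restricted: "\<exists>N. \<forall>n\<ge>N. L_at i n x = 0"
proof -
  have "\<forall>X. \<exists>N. \<forall>n\<ge>N. u_letter (Lgen n) * repf X i \<in> balanced_rel (whittaker_char c (\<Psi> i))"
    using F.T_restricted_aux by blast
  then obtain N where N: "\<And>X n. N X \<le> n \<Longrightarrow> u_letter (Lgen n) * repf X i \<in> balanced_rel (whittaker_char c (\<Psi> i))"
    by metis
  have "L_at i n x = 0" if "\<forall>X\<in>Poly_Mapping.keys x. N X \<le> n" for n
  proof -
    have "pure ((repf X)(i := u_letter (Lgen n) * repf X i)) = 0" if "X \<in> Poly_Mapping.keys x" for X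
      using N[of X n] \<open>\<forall>X\<in>Poly_Mapping.keys x. N X \<le> n\<close> that by (intro pure_zero[of _ i]) simp
    then show ?thesis by (simp add: L_at_def act_at_def lift_def lin_ext_def)
  qed
  then have "\<forall>n\<ge>Max (insert 0 (N ` Poly_Mapping.keys x)). L_at i n x = 0" by auto
  then show ?thesis by blast
qed

lemma L_at_bracket: "L_at i k (L_at j l x) = L_at j l (L_at i k x) + (if i = j then pm_scale (of_int (k - l)) (L_at i (k + l) x)
       + (if k + l = 0 then pm_scale (vir_cocycle k) (C_at i x) else 0) else 0)"
proof (cases "i = j")
  case True
  show ?thesis
    unfolding True L_at_def act_at_act_at_same u_letter_Lgen[of k l]
    by (simp add: act_at_lin C_at_def del: of_int_diff)
next
  case False
  then show ?thesis by (simp add: L_at_def act_at_act_at_other)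
qed

lemma C_at_L_at: "C_at i (L_at j k x) = L_at j k (C_at i x)"
proof (cases "i = j")
  case True
  then show ?thesis by (simp add: C_at_def L_at_def act_at_act_at_same u_letter_Cgen)
qed (simp add: C_at_def L_at_def act_at_act_at_other)

sublocale RV: restricted_virasoro pm_scale "L_at i" "C_at i" for i
proof (intro restricted_virasoro.intro restricted_operators.intro restricted_operators_axioms.intro
    restricted_virasoro_axioms.intro vector_space_pm_scale)
  show "L_at i k (L_at i l x) = L_at i l (L_at i k x) + (pm_scale (of_int (k - l)) (L_at i (k + l) x)
       + (if k + l = 0 then pm_scale (vir_cocycle k) (C_at i x) else 0))" for k l x
    using L_at_bracket[of i k i l x] by simp
qed (simp_all add: L_at_restricted C_at_L_at, simp_all add: L_at_def C_at_def act_at_hom)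

definition w :: "('n \<Rightarrow> uvir set) \<Rightarrow>\<^sub>0 complex" where "w = pure (\<lambda>_. 1)"

text \<open>
  The largest index at which the \<open>i\<close>-th Whittaker function does not vanish.
\<close>
definition depth :: "'n \<Rightarrow> int" where "depth i = (if \<Psi> i (Lvir 2) \<noteq> 0 then 2 else 1)"

lemma depth: "\<Psi> i (Lvir (depth i)) \<noteq> 0"
proof (rule ccontr)
  assume "\<not> \<Psi> i (Lvir (depth i)) \<noteq> 0"
  then have z: "\<Psi> i (Lvir 1) = 0" "\<Psi> i (Lvir 2) = 0" by (auto simp: depth_def split: if_splits)
  have z': "\<Psi> i (Lvir n) = 0" if "1 \<le> n" for n
  proof -
    have "n = 1 \<or> n = 2 \<or> 3 \<le> n" using that by linarith
    then show ?thesis using z L3 by auto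
  qed
  have "\<Psi> i x = 0" if x: "x \<in> vir_pos" for x
    unfolding F.\<Psi>_expand[OF x] by (rule sum.neutral) (use z' vir_pos_keys[OF x] in fastforce)
  then show False using nontrivial by blast
qed

lemma pure_scalar: 
  assumes "u - u_scale a 1 \<in> balanced_rel (whittaker_char c (\<Psi> i))"
  shows "pure ((\<lambda>_. 1)(i := u)) = pm_scale a w"
proof -
  have "pure ((\<lambda>_. 1)(i := u)) = pure ((\<lambda>_. 1)(i := u_scale a 1))"
    using assms by (intro pure_cong) (simp add: uvir.subspace_0[OF subspace_balanced_rel])
  also have "\<dots> = pm_scale a (pure ((\<lambda>_. 1)(i := 1)))" by (rule pure_lin)
  also have "(\<lambda>_. 1)(i := 1) = (\<lambda>_. 1::uvir)" by auto
  finally show ?thesis unfolding w_def .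
qed

lemma act_at_w: "act_at i v w = pure ((\<lambda>_. 1)(i := v))"
  unfolding w_def act_at_pure by simp

lemma whittaker_system_W: "whittaker_system pm_scale L_at C_at c w (\<lambda>i k. \<Psi> i (Lvir k)) depth"
proof (intro whittaker_system.intro whittaker_system_axioms.intro vector_space_pm_scale)
  show "C_at i w = pm_scale c w" for i
    unfolding C_at_def act_at_w using F.R_Cgen[of 1 i] by (intro pure_scalar) simp
  show "0 < k \<Longrightarrow> L_at i k w = pm_scale (\<Psi> i (Lvir k)) w" for i k
    unfolding L_at_def act_at_w using F.R_Lgen[of k 1 i] by (intro pure_scalar) simp
  show "depth i < k \<Longrightarrow> \<Psi> i (Lvir k) = 0" for i k
  proof -
    assume "depth i < k"
    then have "k = 2 \<and> \<Psi> i (Lvir 2) = 0 \<or> 3 \<le> k" by (auto simp: depth_def split: if_splits)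
    then show ?thesis using L3 by blast
  qed
next
  show "module_hom pm_scale pm_scale (L_at i k)" for i k by (simp add: L_at_def act_at_hom)
  show "module_hom pm_scale pm_scale (C_at i)" for i by (simp add: C_at_def act_at_hom)
  show "L_at i k (L_at j l x) = L_at j l (L_at i k x) + (if i = j then pm_scale (of_int (k - l)) (L_at i (k + l) x)
       + (if k + l = 0 then pm_scale (vir_cocycle k) (C_at i x) else 0) else 0)" for i j k l x
    by (rule L_at_bracket)
  show "C_at i (L_at j k x) = L_at j k (C_at i x)" for i j k x by (rule C_at_L_at)
  show "0 < depth i" for i by (simp add: depth_def)
  show "\<Psi> i (Lvir (depth i)) \<noteq> 0" for i by (rule depth)
qed

definition act_word :: "('n \<times> int) list \<Rightarrow> _" where "act_word = whittaker_system.act L_at"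
definition W_space :: "_ set" where "W_space = whittaker_system.module_space pm_scale L_at w depth"

lemmas act_word_simps [simp] = whittaker_system.act_simps[OF whittaker_system_W, folded act_word_def]
lemmas C_at_act_word = whittaker_system.Z_act[OF whittaker_system_W, folded act_word_def]
lemmas W_space_eq = whittaker_system.module_space_eq[OF whittaker_system_W, folded act_word_def W_space_def]
lemmas W_irreducible = whittaker_system.irreducible[OF whittaker_system_W, folded W_space_def]
lemmas W_locally_nilpotent = whittaker_system.locally_nilpotent[OF whittaker_system_W, folded W_space_def]

text \<open>
  The product of the linear forms \<open>counit\<close> of the factors takes the value 1 at \<open>w\<close>.
\<close>
lemma w_nonzero: "w \<noteq> 0"
proof -
  note vsc = vector_space_complex
  have "multilinear (*) (\<lambda>Y. \<Prod>i\<in>UNIV. F.counit i (Y i))"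
  proof (rule multilinearI)
    fix Y i
    have e: "(\<Prod>j\<in>UNIV. F.counit j ((Y(i := u)) j)) = F.counit i u * (\<Prod>j\<in>UNIV - {i}. F.counit j (Y j))" for u
      by (subst prod.remove[of UNIV i]) (auto intro!: prod.cong)
    show "module_hom u_scale (*) (\<lambda>u. \<Prod>j\<in>UNIV. F.counit j ((Y(i := u)) j))"
      unfolding e using F.counit_hom[of i] vsc uvir.vector_space_axioms
      by (intro module_hom.intro module_hom_axioms.intro) (simp_all add: module_iff_vector_space F.counit_lin algebra_simps)
  next
    fix Y Y' :: "'n \<Rightarrow> uvir" assume "\<And>i. Y i - Y' i \<in> balanced_rel (whittaker_char c (\<Psi> i))"
    then have "F.counit i (Y i) = F.counit i (Y' i)" for i
      using F.counit_rel[of "Y i - Y' i" i] by (simp add: F.counit_lin)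
    then show "(\<Prod>i\<in>UNIV. F.counit i (Y i)) = (\<Prod>i\<in>UNIV. F.counit i (Y' i))" by simp
  qed
  from lift_pure[OF vsc this, of "\<lambda>_. 1"]
  have "lift (*) (\<lambda>Y. \<Prod>i\<in>UNIV. F.counit i (Y i)) w = 1" by (simp add: w_def F.counit_one)
  then show ?thesis using module_hom.zero[OF module_hom_lift[OF vsc]] by fastforce
qed

lemma subspace_module_space: "pm.subspace W_space"
  by (simp add: W_space_eq pm.subspace_span)

lemma w_module_space: "w \<in> W_space"
  unfolding W_space_eq by (rule pm.span_base) (metis act_word_simps(1) rangeI)

lemma L_at_module_space:
  assumes "x \<in> W_space" shows "L_at i k x \<in> W_space" "C_at i x \<in> W_space"
proof -
  have 1: "pm.subspace {x. L_at i k x \<in> W_space}" "pm.subspace {x. C_at i x \<in> W_space}"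
    using module_hom.subspace_vimage[OF RV.T_hom subspace_module_space]
      module_hom.subspace_vimage[OF RV.Z_hom subspace_module_space] by (simp_all add: vimage_def)
  have act: "act_word u w \<in> W_space" for u
    unfolding W_space_eq by (rule pm.span_base) simp
  have "L_at i k (act_word u w) \<in> W_space" for u
    using act[of "(i, k) # u"] by simp
  then have "pm.span (range (\<lambda>u. act_word u w)) \<subseteq> {x. L_at i k x \<in> W_space}"
    by (intro pm.span_minimal 1) auto
  then show "L_at i k x \<in> W_space" using assms by (auto simp: W_space_eq)
  have "C_at i (act_word u w) \<in> W_space" for u
    unfolding C_at_act_word by (rule pm.subspace_scale[OF subspace_module_space act])
  then have "pm.span (range (\<lambda>u. act_word u w)) \<subseteq> {x. C_at i x \<in> W_space}"
    by (intro pm.span_minimal 1) auto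
  then show "C_at i x \<in> W_space" using assms by (auto simp: W_space_eq)
qed

text \<open>
  The arguments of a pure tensor are changed from 1 to their values one at a time, and each of them is built
  up from 1 by multiplication with letters.
\<close>
lemma pure_module_space: "pure Y \<in> W_space"
proof -
  have "finite A \<Longrightarrow> (\<forall>i. i \<notin> A \<longrightarrow> Y i = 1) \<Longrightarrow> pure Y \<in> W_space" for A Y
  proof (induction A arbitrary: Y rule: finite_induct)
    case empty
    then have "Y = (\<lambda>_. 1)" by auto
    then show ?case using w_module_space by (simp add: w_def)
  next
    case (insert i A)
    let ?Y = "Y(i := 1)"
    have "pure (?Y(i := u)) \<in> W_space" for u
    proof (induction u rule: uvir_induct)
      case one
      have "pure ?Y \<in> W_space" by (rule insert.IH) (use insert.prems in auto)
      then show ?case by (simp only: fun_upd_upd)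
    next
      case (letter p u)
      have "pure (?Y(i := u_letter p * u)) = act_at i (u_letter p) (pure (?Y(i := u)))"
        unfolding act_at_pure by (simp only: fun_upd_upd fun_upd_same)
      then show ?case
        using L_at_module_space[OF letter, of i, unfolded L_at_def C_at_def] by (cases p) (simp_all only:)
    next
      case (add u v)
      then show ?case using pure_lin(1)[of ?Y i u v] pm.subspace_add[OF subspace_module_space] by (simp only:)
    next
      case (scale a u)
      then show ?case using pure_lin(2)[of ?Y i a u] pm.subspace_scale[OF subspace_module_space] by (simp only:)
    qed
    from this[of "Y i"] show ?case by simp
  qed
  from this[of UNIV Y] show ?thesis by simp
qed

lemma proj_module_space:
  assumes "Poly_Mapping.keys f \<subseteq> families M"
  shows "proj f \<in> W_space"
proof -
  have "proj f = lin_ext pm_scale (\<lambda>X. proj (Poly_Mapping.single X 1)) f"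
  proof (induction f rule: poly_mapping_singles_induct)
    case (1 X a)
    have "proj (pm_scale a (Poly_Mapping.single X 1)) = pm_scale a (proj (Poly_Mapping.single X 1))" by (rule proj_lin)
    then show ?case by (simp add: lin_ext_single[OF vs_pm])
  qed (simp add: proj_lin lin_ext_add[OF vs_pm])
  also have "\<dots> \<in> W_space"
    unfolding lin_ext_def
  proof (intro pm.subspace_sum[OF subspace_module_space] pm.subspace_scale[OF subspace_module_space])
    fix X assume "X \<in> Poly_Mapping.keys f"
    then have "clsf (repf X) = X" using assms by (intro clsf_repf) auto
    then show "proj (Poly_Mapping.single X 1) \<in> W_space"
      using pure_module_space[of "repf X"] by (simp add: pure_def)
  qed
  finally show ?thesis .
qed

end

section \<open>Vertex operators on the tensor product\<close>

text \<open>
  For fixed total mode, bounds from above on the modes of all factors bound them from below as well; this makes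
  the sums in the tensor product of vertex operators finite.
\<close>
lemma fixed_sum_lower_bound:
  fixes \<kappa> :: "'n::finite \<Rightarrow> int"
  assumes "\<And>j. j \<noteq> i \<Longrightarrow> \<kappa> j < N"
  shows "(\<Sum>j\<in>UNIV. \<kappa> j) - int (card (UNIV :: 'n set)) * \<bar>N\<bar> \<le> \<kappa> i"
proof -
  have "(\<Sum>j\<in>UNIV. \<kappa> j) = \<kappa> i + (\<Sum>j\<in>UNIV - {i}. \<kappa> j)" by (rule sum.remove) auto
  moreover have "(\<Sum>j\<in>UNIV - {i}. \<kappa> j) \<le> (\<Sum>j\<in>UNIV - {i}. \<bar>N\<bar>)"
  proof (rule sum_mono)
    fix j assume "j \<in> UNIV - {i}" then show "\<kappa> j \<le> \<bar>N\<bar>" using assms[of j] by simp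
  qed
  moreover have "(\<Sum>j\<in>UNIV - {i}. \<bar>N\<bar>) \<le> int (card (UNIV :: 'n set)) * \<bar>N\<bar>"
    by (simp add: mult_right_mono)
  ultimately show ?thesis by linarith
qed

lemma finite_bounded_fixed_sum:
  "finite {\<kappa> :: 'n::finite \<Rightarrow> int. (\<Sum>i\<in>UNIV. \<kappa> i) = t \<and> (\<forall>i. \<kappa> i < N)}"
proof -
  let ?b = "t - int (card (UNIV :: 'n set)) * \<bar>N\<bar>"
  have "\<kappa> i \<in> {?b..N}" if "(\<Sum>i\<in>UNIV. \<kappa> i) = t" "\<forall>i. \<kappa> i < N" for \<kappa> :: "'n \<Rightarrow> int" and i
    using that fixed_sum_lower_bound[of i \<kappa> N] by (auto simp: less_imp_le)
  then have "{\<kappa> :: 'n \<Rightarrow> int. (\<Sum>i\<in>UNIV. \<kappa> i) = t \<and> (\<forall>i. \<kappa> i < N)} \<subseteq> (UNIV :: 'n set) \<rightarrow>\<^sub>E {?b..N}"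
    by (auto simp: PiE_UNIV_domain)
  then show ?thesis by (rule finite_subset) (auto intro: finite_PiE)
qed

lemma Sum_any_sum:
  assumes "finite A" "\<And>a. a \<in> A \<Longrightarrow> finite {x. g x a \<noteq> 0}"
  shows "Sum_any (\<lambda>x. \<Sum>a\<in>A. g x a) = (\<Sum>a\<in>A. Sum_any (\<lambda>x. g x a))"
proof -
  let ?S = "\<Union>a\<in>A. {x. g x a \<noteq> 0}"
  have fin: "finite ?S" using assms by auto
  have "Sum_any (\<lambda>x. \<Sum>a\<in>A. g x a) = (\<Sum>x\<in>?S. \<Sum>a\<in>A. g x a)"
  proof (rule Sum_any.expand_superset[OF fin])
    show "{x. (\<Sum>a\<in>A. g x a) \<noteq> 0} \<subseteq> ?S" by (auto intro: ccontr elim: sum.not_neutral_contains_not_neutral)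
  qed
  also have "\<dots> = (\<Sum>a\<in>A. \<Sum>x\<in>?S. g x a)" by (rule sum.swap)
  also have "\<dots> = (\<Sum>a\<in>A. Sum_any (\<lambda>x. g x a))"
    by (intro sum.cong refl Sum_any.expand_superset[OF fin, symmetric]) auto
  finally show ?thesis .
qed

lemma finite_subset_nonzero: "finite B \<Longrightarrow> (\<And>x. x \<notin> B \<Longrightarrow> f x = 0) \<Longrightarrow> finite {x. f x \<noteq> 0}"
  by (rule finite_subset[of _ B]) auto

lemma bij_fun_upd_add: "bij (\<lambda>\<kappa> :: 'n \<Rightarrow> int. \<kappa>(i := \<kappa> i + d))"
  by (rule bij_betw_byWitness[where f' = "\<lambda>\<kappa>. \<kappa>(i := \<kappa> i - d)"]) auto

lemma sum_fun_upd_add: "(\<Sum>j\<in>UNIV. (\<kappa>(i := \<kappa> i + d)) j) = (\<Sum>j\<in>UNIV. \<kappa> j) + (d :: int)"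
  for \<kappa> :: "'n::finite \<Rightarrow> int"
proof -
  have "(\<Sum>j\<in>UNIV. (\<kappa>(i := \<kappa> i + d)) j) = \<kappa> i + d + (\<Sum>j\<in>UNIV - {i}. (\<kappa>(i := \<kappa> i + d)) j)"
    by (subst sum.remove[of UNIV i]) auto
  also have "(\<Sum>j\<in>UNIV - {i}. (\<kappa>(i := \<kappa> i + d)) j) = (\<Sum>j\<in>UNIV - {i}. \<kappa> j)"
    by (rule sum.cong) auto
  also have "\<kappa> i + d + (\<Sum>j\<in>UNIV - {i}. \<kappa> j) = (\<Sum>j\<in>UNIV. \<kappa> j) + d"
    by (subst sum.remove[of UNIV i]) auto
  finally show ?thesis .
qed

context whittaker_tensor
begin

text \<open>
  The modes \<open>\<kappa> i\<close> of the factors contribute to the mode \<open>n\<close> of the tensor product: in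
  \<open>\<Prod>i. z\<^sup>-\<^sup>\<kappa>\<^sup>i\<^sup>-\<^sup>1\<close> the exponents add up to \<open>-n-1\<close>.
\<close>
definition total :: "int \<Rightarrow> ('n \<Rightarrow> int) \<Rightarrow> bool" where
  "total n \<kappa> \<longleftrightarrow> (\<Sum>i\<in>UNIV. \<kappa> i) + int (card (UNIV :: 'n set)) = n + 1"

lemma total_upd: "total n (\<kappa>(i := \<kappa> i + d)) \<longleftrightarrow> total (n - d) \<kappa>"
  unfolding total_def sum_fun_upd_add by linarith

lemma finite_total: "finite {\<kappa>. total n \<kappa> \<and> (\<forall>i. \<kappa> i < N)}"
  using finite_bounded_fixed_sum[of "n + 1 - int (card (UNIV :: 'n set))" N]
  by (simp add: total_def algebra_simps)

definition field_prod :: "('n \<Rightarrow> int \<Rightarrow> uvir \<Rightarrow> uvir) \<Rightarrow> int \<Rightarrow> ('n \<Rightarrow> uvir) \<Rightarrow> _" where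
  "field_prod Y n z = Sum_any (\<lambda>\<kappa>. if total n \<kappa> then pure (\<lambda>i. Y i (\<kappa> i) (z i)) else 0)"

definition fields :: "('n \<Rightarrow> int \<Rightarrow> uvir \<Rightarrow> uvir) \<Rightarrow> bool" where
  "fields Y \<longleftrightarrow> (\<forall>i. F.is_field (Y i))"

lemma fieldsD: "fields Y \<Longrightarrow> F.is_field (Y i)"
  by (simp add: fields_def)

lemma pure_0: "Y i = 0 \<Longrightarrow> pure Y = 0"
  by (rule pure_zero[of _ i]) (simp add: balanced_rel.zero)

lemma common_bound:
  assumes "fields Y"
  obtains N where "\<And>i m. N \<le> m \<Longrightarrow> Y i m (z i) = 0"
proof -
  have "\<forall>i. \<exists>N. \<forall>m\<ge>N. Y i m (z i) = 0"
    using F.field_annihilated[OF fieldsD[OF assms]] by (auto simp: F.annihilated_def)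
  then obtain N where N: "\<And>i m. N i \<le> m \<Longrightarrow> Y i m (z i) = 0" by metis
  have "Y i m (z i) = 0" if "Max (range N) \<le> m" for i m
  proof (rule N)
    have "N i \<le> Max (range N)" by (rule Max_ge) auto
    then show "N i \<le> m" using that by simp
  qed
  then show thesis using that by blast
qed

lemma finite_field_prod:
  assumes "\<And>i m. N \<le> m \<Longrightarrow> Y i m (z i) = 0"
  shows "finite {\<kappa>. (if total n \<kappa> then pure (\<lambda>i. Y i (\<kappa> i) (z i)) else 0) \<noteq> 0}"
proof (rule finite_subset_nonzero[OF finite_total[of n N]])
  fix \<kappa> assume "\<kappa> \<notin> {\<kappa>. total n \<kappa> \<and> (\<forall>i. \<kappa> i < N)}"
  then have "total n \<kappa> \<Longrightarrow> \<exists>i. N \<le> \<kappa> i" by (auto simp: not_less)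
  then show "(if total n \<kappa> then pure (\<lambda>i. Y i (\<kappa> i) (z i)) else 0) = 0"
    using assms by (auto intro: pure_0)
qed

lemma field_prod_superset:
  assumes "\<And>i m. N \<le> m \<Longrightarrow> Y i m (z i) = 0"
  shows "field_prod Y n z = (\<Sum>\<kappa> | total n \<kappa> \<and> (\<forall>i. \<kappa> i < N). pure (\<lambda>i. Y i (\<kappa> i) (z i)))"
proof -
  have "field_prod Y n z = (\<Sum>\<kappa> | total n \<kappa> \<and> (\<forall>i. \<kappa> i < N). if total n \<kappa> then pure (\<lambda>i. Y i (\<kappa> i) (z i)) else 0)"
    unfolding field_prod_def
  proof (rule Sum_any.expand_superset[OF finite_total], rule subsetI, rule ccontr)
    fix \<kappa> assume "\<kappa> \<in> {\<kappa>. (if total n \<kappa> then pure (\<lambda>i. Y i (\<kappa> i) (z i)) else 0) \<noteq> 0}"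
      and "\<kappa> \<notin> {\<kappa>. total n \<kappa> \<and> (\<forall>i. \<kappa> i < N)}"
    then have "pure (\<lambda>i. Y i (\<kappa> i) (z i)) \<noteq> 0" "\<exists>i. N \<le> \<kappa> i" by (auto simp: not_less split: if_splits)
    then show False using assms pure_0 by metis
  qed
  then show ?thesis by simp
qed

text \<open>
  Linearity in whatever determines the \<open>i\<close>-th factor: this is used for the vector as well as for
  the element of the vertex algebra in that factor.
\<close>
lemma field_prod_slot_hom:
  assumes Y: "fields Y" and g: "\<And>\<kappa>. module_hom u_scale u_scale (g \<kappa>)"
    and slot: "\<And>u \<kappa>. pure (\<lambda>j. Y' u j (\<kappa> j) (z' u j)) = pure ((\<lambda>j. Y j (\<kappa> j) (z j))(i := g (\<kappa> i) u))"
    and fin: "\<And>u. \<exists>N. \<forall>m\<ge>N. g m u = 0"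
  shows "module_hom u_scale pm_scale (\<lambda>u. field_prod (Y' u) n (z' u))"
proof -
  obtain N0 where N0: "\<And>i m. N0 \<le> m \<Longrightarrow> Y i m (z i) = 0" using common_bound[OF Y] by blast
  let ?t = "\<lambda>u \<kappa>. if total n \<kappa> then pure ((\<lambda>j. Y j (\<kappa> j) (z j))(i := g (\<kappa> i) u)) else 0"
  have fp: "field_prod (Y' u) n (z' u) = Sum_any (?t u)" for u
    unfolding field_prod_def slot ..
  have finite: "finite {\<kappa>. ?t u \<kappa> \<noteq> 0}" for u
  proof -
    obtain N where N: "\<forall>m\<ge>N. g m u = 0" using fin by blast
    show ?thesis
    proof (rule finite_subset_nonzero[OF finite_total[of n "max N N0"]])
      fix \<kappa> assume "\<kappa> \<notin> {\<kappa>. total n \<kappa> \<and> (\<forall>i. \<kappa> i < max N N0)}"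
      then have "total n \<kappa> \<Longrightarrow> \<exists>i. max N N0 \<le> \<kappa> i" by (auto simp: not_less)
      moreover have "pure ((\<lambda>j. Y j (\<kappa> j) (z j))(i := g (\<kappa> i) u)) = 0" if "max N N0 \<le> \<kappa> k" for k
        using that N N0 by (intro pure_0[of _ k]) auto
      ultimately show "?t u \<kappa> = 0" by auto
    qed
  qed
  note glin = module_hom.add[OF g] module_hom.scale[OF g]
  have add: "Sum_any (?t (u + v)) = Sum_any (?t u) + Sum_any (?t v)" for u v
  proof -
    have e: "?t (u + v) \<kappa> = ?t u \<kappa> + ?t v \<kappa>" for \<kappa> by (simp add: glin pure_lin)
    show ?thesis unfolding e by (rule Sum_any.distrib[OF finite finite])
  qed
  have scale: "Sum_any (?t (u_scale a u)) = pm_scale a (Sum_any (?t u))" for a u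
  proof -
    have e: "?t (u_scale a u) \<kappa> = pm_scale a (?t u \<kappa>)" for \<kappa> by (simp add: glin pure_lin)
    have "Sum_any (?t (u_scale a u)) = (\<Sum>\<kappa>\<in>{\<kappa>. ?t u \<kappa> \<noteq> 0}. pm_scale a (?t u \<kappa>))"
      unfolding e by (rule Sum_any.expand_superset[OF finite]) auto
    then show ?thesis by (simp only: Sum_any.expand_set pm.scale_sum_right)
  qed
  show ?thesis
    unfolding fp using uvir.vector_space_axioms vs_pm
    by (intro module_hom.intro module_hom_axioms.intro add scale) (simp_all add: module_iff_vector_space)
qed

text \<open>
  Fields are evaluated at canonical representatives, so that the result depends on cosets only.
\<close>
definition prs :: "('n \<Rightarrow> uvir) \<Rightarrow> 'n \<Rightarrow> uvir" where "prs z = (\<lambda>i. F.pr i (z i))"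

text \<open>
  The field \<open>Y\<^sub>1(z) \<otimes> \<dots> \<otimes> Y\<^sub>l(z)\<close>.
\<close>
definition tensor_field :: "('n \<Rightarrow> int \<Rightarrow> uvir \<Rightarrow> uvir) \<Rightarrow> int \<Rightarrow> _ \<Rightarrow> _" where
  "tensor_field Y n = lift pm_scale (\<lambda>z. field_prod Y n (prs z))"

lemma prs_upd: "prs (z(i := u)) = (prs z)(i := F.pr i u)"
  by (auto simp: prs_def)

lemma multilinear_field_prod:
  assumes Y: "fields Y"
  shows "multilinear pm_scale (\<lambda>z. field_prod Y n (prs z))"
proof (rule multilinearI)
  fix z i
  show "module_hom u_scale pm_scale (\<lambda>u. field_prod Y n (prs (z(i := u))))"
  proof (rule field_prod_slot_hom[OF Y, where Y' = "\<lambda>_. Y" and z = "prs z" and i = i and g = "\<lambda>m u. Y i m (F.pr i u)"])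
    show "module_hom u_scale u_scale (\<lambda>u. Y i m (F.pr i u))" for m
      using module_hom_compose[OF F.pr(1)[of i] F.field_hom[OF fieldsD[OF Y], of i m]] by (simp add: o_def)
    show "pure (\<lambda>j. Y j (\<kappa> j) (prs (z(i := u)) j)) = pure ((\<lambda>j. Y j (\<kappa> j) (prs z j))(i := Y i (\<kappa> i) (F.pr i u)))" for u \<kappa>
      by (rule arg_cong[of _ _ pure]) (auto simp: prs_upd)
    show "\<exists>N. \<forall>m\<ge>N. Y i m (F.pr i u) = 0" for u
      using F.field_annihilated[OF fieldsD[OF Y, of i]] by (simp add: F.annihilated_def)
  qed
next
  fix z z' :: "'n \<Rightarrow> uvir" assume "\<And>i. z i - z' i \<in> balanced_rel (whittaker_char c (\<Psi> i))"
  then have "prs z = prs z'" unfolding prs_def by (intro ext) (simp add: F.pr_eq_iff)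
  then show "field_prod Y n (prs z) = field_prod Y n (prs z')" by simp
qed

lemma tensor_field_hom: "module_hom pm_scale pm_scale (tensor_field Y n)"
  unfolding tensor_field_def by (rule module_hom_lift[OF vs_pm])

lemma tensor_field_pure: "fields Y \<Longrightarrow> tensor_field Y n (pure z) = field_prod Y n (prs z)"
  unfolding tensor_field_def by (rule lift_pure[OF vs_pm multilinear_field_prod])

lemma tensor_field_proj: "fields Y \<Longrightarrow> tensor_field Y n (proj x) = tensor_field Y n x"
  unfolding tensor_field_def by (rule lift_proj[OF vs_pm multilinear_field_prod])

lemma tensor_field_single: "tensor_field Y n (Poly_Mapping.single X 1) = field_prod Y n (prs (repf X))"
  by (simp add: tensor_field_def lift_def lin_ext_single[OF vs_pm])

lemma tensor_field_annihilated:
  assumes "fields Y" shows "\<exists>N. \<forall>n\<ge>N. tensor_field Y n x = 0"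
proof -
  have "\<exists>N. \<forall>n\<ge>N. field_prod Y n z = 0" for z
  proof -
    obtain N where N: "\<And>i m. N \<le> m \<Longrightarrow> Y i m (z i) = 0" using common_bound[OF assms] by blast
    let ?C = "int (card (UNIV :: 'n set))"
    have "field_prod Y n z = 0" if n: "?C * N + ?C \<le> n" for n
    proof -
      have "\<not> (total n \<kappa> \<and> (\<forall>i. \<kappa> i < N))" for \<kappa>
      proof
        assume \<kappa>: "total n \<kappa> \<and> (\<forall>i. \<kappa> i < N)"
        then have "(\<Sum>i\<in>UNIV. \<kappa> i) \<le> (\<Sum>i\<in>(UNIV :: 'n set). N)" by (intro sum_mono) (auto simp: less_imp_le)
        then show False using \<kappa> n by (simp add: total_def)
      qed
      then have "{\<kappa>. total n \<kappa> \<and> (\<forall>i. \<kappa> i < N)} = {}" by blast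
      then show ?thesis using field_prod_superset[of N Y z n, OF N] by (simp only: sum.empty)
    qed
    then show ?thesis by blast
  qed
  then obtain N where N: "\<And>z n. N z \<le> n \<Longrightarrow> field_prod Y n z = 0" by metis
  have "tensor_field Y n x = 0" if "\<forall>X\<in>Poly_Mapping.keys x. N (prs (repf X)) \<le> n" for n
    using that N by (simp add: tensor_field_def lift_def lin_ext_def)
  then have "\<forall>n\<ge>Max (insert 0 ((\<lambda>X. N (prs (repf X))) ` Poly_Mapping.keys x)). tensor_field Y n x = 0" by auto
  then show ?thesis by blast
qed

lemma is_field_tensor_field: "fields Y \<Longrightarrow> RV.is_field (tensor_field Y)"
  by (simp add: RV.is_field_def tensor_field_hom RV.annihilated_def tensor_field_annihilated)

lemma fields_upd: "fields Y \<Longrightarrow> F.is_field y \<Longrightarrow> fields (Y(i := y))"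
  by (simp add: fields_def)

abbreviation slot :: "('n \<Rightarrow> int \<Rightarrow> uvir \<Rightarrow> uvir) \<Rightarrow> ('n \<Rightarrow> uvir) \<Rightarrow> 'n \<Rightarrow> ('n \<Rightarrow> int) \<Rightarrow> uvir \<Rightarrow> _" where
  "slot Y z i \<kappa> u \<equiv> pure ((\<lambda>j. Y j (\<kappa> j) (z j))(i := u))"

lemma slot_lin: "slot Y z i \<kappa> (\<Sum>a\<in>A. u_scale (s a) (f a)) = (\<Sum>a\<in>A. pm_scale (s a) (slot Y z i \<kappa> (f a)))"
  by (simp only: pure_lin)

lemma Sum_any_total_shift:
  "Sum_any (\<lambda>\<kappa>. if total n \<kappa> then f (\<kappa>(i := \<kappa> i + d)) else 0) = Sum_any (\<lambda>\<kappa>. if total (n + d) \<kappa> then f \<kappa> else 0)"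
  by (rule Sum_any.reindex_cong[OF bij_fun_upd_add[of i d], symmetric]) (auto simp: total_upd)

lemma L_at_slot: "L_at i k (slot Y z i \<kappa> u) = slot Y z i \<kappa> (F.T i k u)"
proof -
  have "F.pr i (u_letter (Lgen k) * u) - u_letter (Lgen k) * u \<in> balanced_rel (whittaker_char c (\<Psi> i))"
    using uvir.subspace_neg[OF subspace_balanced_rel F.pr(3)[of "u_letter (Lgen k) * u" i]] by simp
  then show ?thesis
    unfolding L_at_pure F.T_def
    by (intro pure_cong) (simp add: uvir.subspace_0[OF subspace_balanced_rel] uvir.subspace_neg[OF subspace_balanced_rel] F.pr(3))
qed


lemma hom_Sum_any:
  assumes "module_hom pm_scale pm_scale h" "finite {x. f x \<noteq> 0}"
  shows "h (Sum_any f) = Sum_any (\<lambda>x. h (f x))"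
proof -
  have "Sum_any (\<lambda>x. h (f x)) = (\<Sum>x | f x \<noteq> 0. h (f x))"
    by (rule Sum_any.expand_superset[OF assms(2)]) (auto simp: module_hom.zero[OF assms(1)])
  then show ?thesis by (simp add: Sum_any.expand_set module_hom.sum[OF assms(1)])
qed

lemma module_hom_pm_scale: "module_hom pm_scale pm_scale (pm_scale a :: ('x \<Rightarrow>\<^sub>0 complex) \<Rightarrow> _)"
  using vs_pm by (intro module_hom.intro module_hom_axioms.intro)
    (simp_all add: module_iff_vector_space pm.scale_right_distrib mult.commute)

lemma finite_total_shift:
  assumes "finite {\<kappa>. (if total (n + d) \<kappa> then f \<kappa> else 0) \<noteq> 0}"
  shows "finite {\<kappa>. (if total n \<kappa> then f (\<kappa>(i := \<kappa> i + d)) else 0) \<noteq> 0}"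
proof -
  have "{\<kappa>. (if total n \<kappa> then f (\<kappa>(i := \<kappa> i + d)) else 0) \<noteq> 0}
    = (\<lambda>\<kappa>. \<kappa>(i := \<kappa> i + d)) -` {\<kappa>. (if total (n + d) \<kappa> then f \<kappa> else 0) \<noteq> 0}"
    by (simp add: vimage_def total_upd del: fun_upd_apply)
  then show ?thesis
    using finite_vimageI[OF assms bij_is_inj[OF bij_fun_upd_add[of i d]]] by simp
qed

text \<open>
  The left part of the iterate formula shifts the mode of the \<open>i\<close>-th factor by \<open>a\<close>, which shifts the total mode
  by \<open>a\<close>; summation over \<open>\<kappa>\<close> and over \<open>a\<close> can be interchanged once \<open>a\<close> is bounded independently of
  \<open>\<kappa>\<close>.
\<close>
lemma field_prod_left_part:
  assumes Y: "fields Y"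
  shows "field_prod (Y(i := F.left_part i 0 s (Y i))) n (prs z) = RV.left_part i 0 s (tensor_field Y) n (pure z)"
proof -
  define zz where "zz = prs z"
  obtain N where N: "\<And>i m. N \<le> m \<Longrightarrow> Y i m (zz i) = 0" using common_bound[OF Y] by blast
  let ?C = "int (card (UNIV :: 'n set))"
  \<comment> \<open>a lower bound for the mode of the factor i, valid for all contributing modes\<close>
  define lo where "lo = n + 1 - ?C - ?C * \<bar>N\<bar>"
  have lo: "lo \<le> \<kappa> i" if "total n \<kappa>" "\<And>j. j \<noteq> i \<Longrightarrow> \<kappa> j < N" for \<kappa>
    using fixed_sum_lower_bound[of i \<kappa> N] that by (auto simp: total_def lo_def)
  obtain A1 where A1: "\<And>m. n + int A1 \<le> m \<Longrightarrow> tensor_field Y m (pure z) = 0"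
    using RV.annihilated_bound[OF RV.field_annihilated[OF is_field_tensor_field[OF Y]]] by blast
  \<comment> \<open>from this index on, both the left parts in the factor i and the modes of the tensor product vanish\<close>
  define A where "A = max A1 (nat (N - lo))"
  define k where "k a = s - 1 - int a" for a
  define f where "f a \<kappa> = L_at i (k a) (pure (\<lambda>j. Y j (\<kappa> j) (zz j)))" for a \<kappa>
  have slot_f: "slot Y zz i \<kappa> (F.T i (k a) (Y i (\<kappa> i + int a) (zz i))) = f a (\<kappa>(i := \<kappa> i + int a))" for a \<kappa>
  proof -
    have "(\<lambda>j. Y j ((\<kappa>(i := \<kappa> i + int a)) j) (zz j)) = (\<lambda>j. Y j (\<kappa> j) (zz j))(i := Y i (\<kappa> i + int a) (zz i))"
      by auto
    then show ?thesis by (simp only: f_def L_at_slot)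
  qed
  have summand: "(if total n \<kappa> then pure (\<lambda>j. (Y(i := F.left_part i 0 s (Y i))) j (\<kappa> j) (zz j)) else 0)
     = (\<Sum>a<A. pm_scale (sbinom s a) (if total n \<kappa> then f a (\<kappa>(i := \<kappa> i + int a)) else 0))" for \<kappa>
  proof (cases "total n \<kappa>")
    case True
    have u: "(\<lambda>j. (Y(i := F.left_part i 0 s (Y i))) j (\<kappa> j) (zz j))
       = (\<lambda>j. Y j (\<kappa> j) (zz j))(i := F.left_part i 0 s (Y i) (\<kappa> i) (zz i))" by auto
    show ?thesis
    proof (cases "\<exists>j. j \<noteq> i \<and> N \<le> \<kappa> j")
      case True': True
      then obtain j where j: "j \<noteq> i" "N \<le> \<kappa> j" by blast
      then have z: "slot Y zz i \<kappa> v = 0" for v using N by (intro pure_0[of _ j]) simp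
      show ?thesis unfolding u z slot_f[symmetric] by simp
    next
      case False
      then have "lo \<le> \<kappa> i" by (intro lo[OF True]) auto
      then have "F.left_part i 0 s (Y i) (\<kappa> i) (zz i)
         = (\<Sum>a<A. u_scale (sbinom s a) (F.T i (k a) (Y i (\<kappa> i + int a) (zz i))))"
        unfolding k_def by (intro F.left_part_sum N) (auto simp: A_def)
      then show ?thesis using True unfolding u by (simp only: slot_lin[of Y \<kappa> zz i] slot_f if_True)
    qed
  qed simp
  have fin: "finite {\<kappa>. (if total m \<kappa> then f a \<kappa> else 0) \<noteq> 0}" for m a
    by (rule finite_subset[OF _ finite_field_prod[of N Y zz m, OF N]])
      (auto simp: f_def RV.T_0)
  have fin': "finite {\<kappa>. (if total n \<kappa> then f a (\<kappa>(i := \<kappa> i + int a)) else 0) \<noteq> 0}" for a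
    by (rule finite_total_shift[OF fin])
  have fin'': "finite {\<kappa>. pm_scale b (if total n \<kappa> then f a (\<kappa>(i := \<kappa> i + int a)) else 0) \<noteq> 0}" for a b
    by (rule finite_subset[OF _ fin'[of a]]) auto
  have "field_prod (Y(i := F.left_part i 0 s (Y i))) n zz
     = Sum_any (\<lambda>\<kappa>. \<Sum>a<A. pm_scale (sbinom s a) (if total n \<kappa> then f a (\<kappa>(i := \<kappa> i + int a)) else 0))"
    unfolding field_prod_def summand ..
  also have "\<dots> = (\<Sum>a<A. Sum_any (\<lambda>\<kappa>. pm_scale (sbinom s a) (if total n \<kappa> then f a (\<kappa>(i := \<kappa> i + int a)) else 0)))"
    by (rule Sum_any_sum[OF _ fin'']) simp
  also have "\<dots> = (\<Sum>a<A. pm_scale (sbinom s a) (Sum_any (\<lambda>\<kappa>. if total n \<kappa> then f a (\<kappa>(i := \<kappa> i + int a)) else 0)))"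
    by (simp only: hom_Sum_any[OF module_hom_pm_scale fin'])
  also have "\<dots> = (\<Sum>a<A. pm_scale (sbinom s a) (L_at i (k a) (tensor_field Y (n + int a) (pure z))))"
  proof (intro sum.cong refl arg_cong[of _ _ "pm_scale _"])
    fix a
    have "Sum_any (\<lambda>\<kappa>. if total n \<kappa> then f a (\<kappa>(i := \<kappa> i + int a)) else 0)
       = Sum_any (\<lambda>\<kappa>. L_at i (k a) (if total (n + int a) \<kappa> then pure (\<lambda>j. Y j (\<kappa> j) (zz j)) else 0))"
      unfolding Sum_any_total_shift by (intro Sum_any.cong) (simp add: f_def RV.T_0)
    also have "\<dots> = L_at i (k a) (field_prod Y (n + int a) zz)"
      unfolding field_prod_def by (rule hom_Sum_any[OF RV.T_hom finite_field_prod[of N Y zz, OF N], symmetric])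
    finally show "Sum_any (\<lambda>\<kappa>. if total n \<kappa> then f a (\<kappa>(i := \<kappa> i + int a)) else 0)
       = L_at i (k a) (tensor_field Y (n + int a) (pure z))" by (simp add: tensor_field_pure[OF Y] zz_def)
  qed
  also have "\<dots> = RV.left_part i 0 s (tensor_field Y) n (pure z)"
    unfolding k_def by (rule RV.left_part_sum[symmetric], rule A1) (simp add: A_def)
  finally show ?thesis by (simp add: zz_def)
qed

lemma field_prod_right_part:
  assumes Y: "fields Y"
  shows "field_prod (Y(i := F.right_part i 0 s (Y i))) n (prs z) = RV.right_part i 0 s (tensor_field Y) n (pure z)"
proof -
  define zz where "zz = prs z"
  obtain K1 where K1: "\<And>a. K1 \<le> a \<Longrightarrow> F.T i (int a - 1) (zz i) = 0" using F.T_bound by blast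
  obtain K2 where K2: "\<And>a. K2 \<le> a \<Longrightarrow> L_at i (int a - 1) (pure z) = 0" using RV.T_bound by blast
  define K where "K = max K1 K2"
  \<comment> \<open>the argument after L(a - 1) has acted in the factor i\<close>
  define za where "za a = zz(i := F.T i (int a - 1) (zz i))" for a
  define f where "f a \<kappa> = pure (\<lambda>j. Y j (\<kappa> j) (za a j))" for a \<kappa>
  define e where "e = ((-1::complex) powi s)"
  define d where "d a = s - int a" for a
  have slot_f: "slot Y zz i \<kappa> (Y i (s + \<kappa> i - int a) (F.T i (int a - 1) (zz i))) = f a (\<kappa>(i := \<kappa> i + d a))" for a \<kappa>
  proof -
    have "(\<lambda>j. Y j ((\<kappa>(i := \<kappa> i + d a)) j) (za a j))
        = (\<lambda>j. Y j (\<kappa> j) (zz j))(i := Y i (s + \<kappa> i - int a) (F.T i (int a - 1) (zz i)))"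
      by (auto simp: za_def d_def algebra_simps)
    then show ?thesis by (simp only: f_def)
  qed
  have summand: "(if total n \<kappa> then pure (\<lambda>j. (Y(i := F.right_part i 0 s (Y i))) j (\<kappa> j) (zz j)) else 0)
     = (\<Sum>a<K. pm_scale (e * sbinom s a) (if total n \<kappa> then f a (\<kappa>(i := \<kappa> i + d a)) else 0))" for \<kappa>
  proof (cases "total n \<kappa>")
    case True
    have u: "(\<lambda>j. (Y(i := F.right_part i 0 s (Y i))) j (\<kappa> j) (zz j))
       = (\<lambda>j. Y j (\<kappa> j) (zz j))(i := F.right_part i 0 s (Y i) (\<kappa> i) (zz i))" by auto
    have "F.right_part i 0 s (Y i) (\<kappa> i) (zz i)
        = u_scale e (\<Sum>a<K. u_scale (sbinom s a) (Y i (s + \<kappa> i - int a) (F.T i (int a - 1) (zz i))))"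
      unfolding e_def by (rule F.right_part_sum) (auto simp: K_def K1 F.field_0[OF fieldsD[OF Y]])
    then have "F.right_part i 0 s (Y i) (\<kappa> i) (zz i)
        = (\<Sum>a<K. u_scale (e * sbinom s a) (Y i (s + \<kappa> i - int a) (F.T i (int a - 1) (zz i))))"
      by (simp add: uvir.scale_sum_right)
    then show ?thesis using True unfolding u by (simp only: slot_lin[of Y \<kappa> zz i] slot_f if_True)
  qed simp
  have fin: "finite {\<kappa>. (if total m \<kappa> then f a \<kappa> else 0) \<noteq> 0}" for m a
  proof -
    obtain N where N: "\<And>i m. N \<le> m \<Longrightarrow> Y i m (za a i) = 0" using common_bound[OF Y] by blast
    show ?thesis unfolding f_def by (rule finite_field_prod[of N Y "za a", OF N])
  qed
  have fin': "finite {\<kappa>. (if total n \<kappa> then f a (\<kappa>(i := \<kappa> i + d a)) else 0) \<noteq> 0}" for a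
    by (rule finite_total_shift[OF fin])
  have fin'': "finite {\<kappa>. pm_scale b (if total n \<kappa> then f a (\<kappa>(i := \<kappa> i + d a)) else 0) \<noteq> 0}" for a b
    by (rule finite_subset[OF _ fin'[of a]]) auto
  have "field_prod (Y(i := F.right_part i 0 s (Y i))) n zz
     = Sum_any (\<lambda>\<kappa>. \<Sum>a<K. pm_scale (e * sbinom s a) (if total n \<kappa> then f a (\<kappa>(i := \<kappa> i + d a)) else 0))"
    unfolding field_prod_def summand ..
  also have "\<dots> = (\<Sum>a<K. Sum_any (\<lambda>\<kappa>. pm_scale (e * sbinom s a) (if total n \<kappa> then f a (\<kappa>(i := \<kappa> i + d a)) else 0)))"
    by (rule Sum_any_sum[OF _ fin'']) simp
  also have "\<dots> = (\<Sum>a<K. pm_scale (e * sbinom s a) (Sum_any (\<lambda>\<kappa>. if total n \<kappa> then f a (\<kappa>(i := \<kappa> i + d a)) else 0)))"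
    by (simp only: hom_Sum_any[OF module_hom_pm_scale fin'])
  also have "\<dots> = (\<Sum>a<K. pm_scale (e * sbinom s a) (tensor_field Y (s + n - int a) (L_at i (int a - 1) (pure z))))"
  proof (intro sum.cong refl arg_cong[of _ _ "pm_scale _"])
    fix a
    have "prs (z(i := u_letter (Lgen (int a - 1)) * z i)) = za a"
      by (simp add: prs_upd za_def zz_def) (simp add: F.T_def prs_def F.pr_left)
    then have "tensor_field Y (s + n - int a) (L_at i (int a - 1) (pure z)) = field_prod Y (s + n - int a) (za a)"
      by (simp add: L_at_pure tensor_field_pure[OF Y])
    moreover have nd: "n + d a = s + n - int a" by (simp add: d_def)
    ultimately show "Sum_any (\<lambda>\<kappa>. if total n \<kappa> then f a (\<kappa>(i := \<kappa> i + d a)) else 0)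
       = tensor_field Y (s + n - int a) (L_at i (int a - 1) (pure z))"
      unfolding Sum_any_total_shift nd by (simp only: field_prod_def f_def)
  qed
  also have "\<dots> = RV.right_part i 0 s (tensor_field Y) n (pure z)"
    by (subst RV.right_part_sum[of K]) (simp_all add: K_def K2 RV.field_0[OF is_field_tensor_field[OF Y]] e_def pm.scale_sum_right)
  finally show ?thesis by (simp add: zz_def)
qed

text \<open>
  \<open>L(k)\<close> applied to the \<open>i\<close>-th tensor factor of \<open>v\<close> acts as the iterate of the \<open>i\<close>-th \<open>L\<close> with the field of \<open>v\<close>, as
  if the tensor product were a module for the \<open>i\<close>-th copy alone.
\<close>
lemma tensor_field_iterate:
  assumes Y: "fields Y"
  shows "tensor_field (Y(i := F.iterate i k (Y i))) n x = RV.iterate i k (tensor_field Y) n x"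
proof (rule lift_eqI[OF vs_pm tensor_field_hom RV.field_hom[OF RV.is_field_iterate[OF is_field_tensor_field[OF Y]]]])
  fix X
  let ?z = "repf X" and ?L = "F.left_part i 0 (k + 1) (Y i)" and ?R = "F.right_part i 0 (k + 1) (Y i)"
  note fL = fields_upd[OF Y F.is_field_left_part[OF fieldsD[OF Y]]]
    and fR = fields_upd[OF Y F.is_field_right_part[OF fieldsD[OF Y]]]
  have TWs: "L_at i l (Poly_Mapping.single X 1) = L_at i l (pure ?z)" for l
    by (simp add: L_at_def act_at_single act_at_pure)
  have TMs: "tensor_field Y m (Poly_Mapping.single X 1) = tensor_field Y m (pure ?z)" for m
    by (simp add: tensor_field_single tensor_field_pure[OF Y])
  obtain N where N: "\<And>j m. N \<le> m \<Longrightarrow> (Y(i := ?L)) j m (prs ?z j) = 0" using common_bound[OF fL] by blast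
  obtain N' where N': "\<And>j m. N' \<le> m \<Longrightarrow> (Y(i := ?R)) j m (prs ?z j) = 0" using common_bound[OF fR] by blast
  have "field_prod (Y(i := ?L)) n (prs ?z) = field_prod (Y(i := F.iterate i k (Y i))) n (prs ?z) + field_prod (Y(i := ?R)) n (prs ?z)"
  proof -
    have e: "(if total n \<kappa> then pure (\<lambda>j. (Y(i := ?L)) j (\<kappa> j) (prs ?z j)) else 0)
      = (if total n \<kappa> then pure (\<lambda>j. (Y(i := F.iterate i k (Y i))) j (\<kappa> j) (prs ?z j)) else 0)
      + (if total n \<kappa> then pure (\<lambda>j. (Y(i := ?R)) j (\<kappa> j) (prs ?z j)) else 0)" for \<kappa>
    proof -
      have u: "pure (\<lambda>j. (Y(i := y)) j (\<kappa> j) (prs ?z j)) = slot Y (prs ?z) i \<kappa> (y (\<kappa> i) (prs ?z i))" for y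
        by (rule arg_cong[of _ _ pure]) auto
      show ?thesis unfolding u F.iterate_field[OF fieldsD[OF Y]] by (simp add: pure_lin)
    qed
    obtain N'' where N'': "\<And>j m. N'' \<le> m \<Longrightarrow> (Y(i := F.iterate i k (Y i))) j m (prs ?z j) = 0"
      using common_bound[OF fields_upd[OF Y F.is_field_iterate[OF fieldsD[OF Y]]]] by blast
    show ?thesis
      unfolding field_prod_def e by (rule Sum_any.distrib[OF finite_field_prod[of N'' "Y(i := F.iterate i k (Y i))" "prs ?z", OF N''] finite_field_prod[of N' "Y(i := ?R)" "prs ?z", OF N']])
  qed
  then have "tensor_field (Y(i := F.iterate i k (Y i))) n (Poly_Mapping.single X 1)
     = RV.iterate i k (tensor_field Y) n (pure ?z)"
    unfolding tensor_field_single RV.iterate_field[OF is_field_tensor_field[OF Y]] field_prod_left_part[OF Y] field_prod_right_part[OF Y]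
    by (simp add: algebra_simps)
  also have "\<dots> = RV.iterate i k (tensor_field Y) n (Poly_Mapping.single X 1)"
    unfolding RV.iterate_def TWs TMs ..
  finally show "tensor_field (Y(i := F.iterate i k (Y i))) n (Poly_Mapping.single X 1)
     = RV.iterate i k (tensor_field Y) n (Poly_Mapping.single X 1)" .
qed

lemma tensor_field_vacuum: "tensor_field (\<lambda>i. F.vacuum_field) n (pure z) = (if n = -1 then pure z else 0)"
proof -
  have f: "fields (\<lambda>i. F.vacuum_field)" by (simp add: fields_def F.is_field_vacuum)
  have m: "\<kappa> = (\<lambda>_. -1)" if "pure (\<lambda>i. F.vacuum_field (\<kappa> i) (prs z i)) \<noteq> 0" for \<kappa>
  proof (rule ext, rule ccontr)
    fix i assume "\<kappa> i \<noteq> -1"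
    then have "pure (\<lambda>i. F.vacuum_field (\<kappa> i) (prs z i)) = 0"
      by (intro pure_0[of _ i]) (simp add: F.vacuum_field_def)
    with that show False by simp
  qed
  have tot: "total n (\<lambda>_. -1) \<longleftrightarrow> n = -1" unfolding total_def by auto
  have "tensor_field (\<lambda>i. F.vacuum_field) n (pure z)
     = (\<Sum>\<kappa>\<in>{\<lambda>_. -1}. if total n \<kappa> then pure (\<lambda>i. F.vacuum_field (\<kappa> i) (prs z i)) else 0)"
    unfolding tensor_field_pure[OF f] field_prod_def by (rule Sum_any.expand_superset) (use m in \<open>auto split: if_splits\<close>)
  also have "\<dots> = (if n = -1 then pure (prs z) else 0)"
    using tot by (simp add: F.vacuum_field_def)
  also have "pure (prs z) = pure z"
  proof (rule pure_cong)
    fix i show "prs z i - z i \<in> balanced_rel (whittaker_char c (\<Psi> i))"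
      using uvir.subspace_neg[OF subspace_balanced_rel F.pr(3)[of "z i" i]] by (simp add: prs_def)
  qed
  finally show ?thesis .
qed

end

section \<open>Symmetrized tensors\<close>

context whittaker_tensor
begin

lemma M_Wh: "M = (\<lambda>i. Wh c (\<Psi> i))"
  by (intro ext) (simp add: M_def Wh_def)

lemma vt_M_Virc: "vt.M = (\<lambda>i. Virc c)"
  by (intro ext) (simp add: vt.M_def Virc_def)

lemma field_prod_W_space: "field_prod Y n z \<in> W_space"
  unfolding field_prod_def Sum_any.expand_set
  by (intro pm.subspace_sum[OF subspace_module_space]) (simp add: pure_module_space pm.subspace_0[OF subspace_module_space])

lemma tensor_field_W_space: "tensor_field Y n x \<in> W_space"
  unfolding tensor_field_def lift_def lin_ext_def
  by (intro pm.subspace_sum[OF subspace_module_space] pm.subspace_scale[OF subspace_module_space] field_prod_W_space)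

lemma fields_field_of: "fields (\<lambda>i. F.field_of i (u i))"
  by (simp add: fields_def F.is_field_field_of)

lemma multilinear_tensor_field_field_of: "vt.multilinear pm_scale (\<lambda>u. tensor_field (\<lambda>i. F.field_of i (u i)) n x)"
proof (rule vt.multilinearI)
  fix u :: "'n \<Rightarrow> uvir" and j
  have h: "module_hom u_scale pm_scale (\<lambda>v. field_prod (\<lambda>i. F.field_of i ((u(j := v)) i)) n zz)" for zz
  proof (rule field_prod_slot_hom[OF fields_field_of[of u], where Y' = "\<lambda>v i. F.field_of i ((u(j := v)) i)" and z = zz and i = j
        and g = "\<lambda>m v. F.field_of j v m (zz j)"])
    show "module_hom u_scale u_scale (\<lambda>v. F.field_of j v m (zz j))" for m by (rule F.field_of_hom_left)
    show "pure (\<lambda>i. F.field_of i ((u(j := v)) i) (\<kappa> i) (zz i))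
        = pure ((\<lambda>i. F.field_of i (u i) (\<kappa> i) (zz i))(j := F.field_of j v (\<kappa> j) (zz j)))" for v \<kappa>
      by (rule arg_cong[of _ _ pure]) auto
    show "\<exists>N. \<forall>m\<ge>N. F.field_of j v m (zz j) = 0" for v
      using F.field_annihilated[OF F.is_field_field_of[of j v]] by (simp add: F.annihilated_def)
  qed
  show "module_hom u_scale pm_scale (\<lambda>v. tensor_field (\<lambda>i. F.field_of i ((u(j := v)) i)) n x)"
    unfolding tensor_field_def lift_def using uvir.vector_space_axioms vs_pm
    by (intro module_hom.intro module_hom_axioms.intro)
      (simp_all only: module_hom.add[OF h] module_hom.scale[OF h] lin_ext_add_fun[OF vs_pm] lin_ext_scale_fun[OF vs_pm] module_iff_vector_space)
next
  fix u u' :: "'n \<Rightarrow> uvir" assume u: "\<And>i. u i - u' i \<in> balanced_rel (vacuum_char c)"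
  have eq: "F.field_of i (u i) m (F.pr i z) = F.field_of i (u' i) m (F.pr i z)" for i m z
    using F.field_of_vacuum_rel[OF u[of i], of i m z] by (simp add: module_hom.diff[OF F.field_of_hom_left])
  have "field_prod (\<lambda>i. F.field_of i (u i)) n (prs z) = field_prod (\<lambda>i. F.field_of i (u' i)) n (prs z)" for z
    unfolding field_prod_def prs_def eq ..
  then show "tensor_field (\<lambda>i. F.field_of i (u i)) n x = tensor_field (\<lambda>i. F.field_of i (u' i)) n x"
    by (simp add: tensor_field_def)
qed

lemma proj_mode_sum:
  fixes n :: int
  assumes X: "X \<in> families vt.M" and Z: "Z \<in> families M"
  defines "K \<equiv> {k. (\<Sum>i\<in>UNIV. k i) + int (card (UNIV :: 'n set)) = n + 1 \<and>
                (\<forall>i. Wh_mode c (\<Psi> i) (X i) (k i) (Z i) \<noteq> \<zero>\<^bsub>Wh c (\<Psi> i)\<^esub>)}"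
  shows "proj (\<Sum>k\<in>K. Poly_Mapping.single (\<lambda>i. Wh_mode c (\<Psi> i) (X i) (k i) (Z i)) q)
     = pm_scale q (field_prod (\<lambda>i. F.field_of i (repf X i)) n (prs (repf Z)))"
    and "k \<in> K \<Longrightarrow> (\<lambda>i. Wh_mode c (\<Psi> i) (X i) (k i) (Z i)) \<in> families M"
proof -
  let ?m = "\<lambda>k i. F.mode i (repf X i) (k i) (repf Z i)"
  have "X i = vac.cls c (repf X i)" "Z i = F.U.cls i (repf Z i)" for i
    using fun_cong[OF vt.clsf_repf[OF X], of i] fun_cong[OF clsf_repf[OF Z], of i]
    by (simp_all add: vt.clsf_def clsf_def)
  then have mode: "Wh_mode c (\<Psi> i) (X i) m (Z i) = F.U.cls i (F.mode i (repf X i) m (repf Z i))" for i m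
    using F.Wh_mode_cls[of i "repf X i" m "repf Z i"] by simp
  have fam: "(\<lambda>i. Wh_mode c (\<Psi> i) (X i) (k i) (Z i)) = clsf (?m k)" for k
    by (simp add: mode clsf_def)
  show "k \<in> K \<Longrightarrow> (\<lambda>i. Wh_mode c (\<Psi> i) (X i) (k i) (Z i)) \<in> families M"
    unfolding fam by (rule clsf_families)
  have zero: "Wh_mode c (\<Psi> i) (X i) m (Z i) = \<zero>\<^bsub>Wh c (\<Psi> i)\<^esub> \<longleftrightarrow> F.mode i (repf X i) m (repf Z i) \<in> balanced_rel (whittaker_char c (\<Psi> i))" for i m
    by (simp add: mode F.Wh_eq F.U.zero_Q F.U.cls_eq_iff)
  have K: "k \<in> K \<longleftrightarrow> total n k \<and> (\<forall>i. ?m k i \<notin> balanced_rel (whittaker_char c (\<Psi> i)))" for k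
    by (simp add: K_def total_def zero)
  obtain N where N: "\<And>i m. N \<le> m \<Longrightarrow> F.field_of i (repf X i) m (prs (repf Z) i) = 0"
    using common_bound[OF fields_field_of] by blast
  have fin: "finite K"
  proof (rule finite_subset[OF _ finite_total[of n N]], rule subsetI)
    fix k assume k: "k \<in> K"
    have "k i < N" for i
    proof (rule ccontr)
      assume "\<not> k i < N"
      then have "?m k i = 0" using N by (simp add: F.mode_def prs_def)
      then show False using k K by (metis balanced_rel.zero)
    qed
    then show "k \<in> {\<kappa>. total n \<kappa> \<and> (\<forall>i. \<kappa> i < N)}" using k K by blast
  qed
  have "field_prod (\<lambda>i. F.field_of i (repf X i)) n (prs (repf Z)) = Sum_any (\<lambda>k. if total n k then pure (?m k) else 0)"
    unfolding field_prod_def F.mode_def prs_def ..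
  also have "\<dots> = (\<Sum>k\<in>K. if total n k then pure (?m k) else 0)"
    by (rule Sum_any.expand_superset[OF fin]) (auto simp: K split: if_splits dest: pure_zero)
  also have "\<dots> = (\<Sum>k\<in>K. pure (?m k))" by (rule sum.cong) (auto simp: K)
  finally show "proj (\<Sum>k\<in>K. Poly_Mapping.single (\<lambda>i. Wh_mode c (\<Psi> i) (X i) (k i) (Z i)) q)
     = pm_scale q (field_prod (\<lambda>i. F.field_of i (repf X i)) n (prs (repf Z)))"
    by (simp add: fam proj_lin proj_single pm.scale_sum_right)
qed

text \<open>
  The tensor product of vertex operators is independent of the representatives of both arguments. The
  representative of the second argument drops out by multilinearity in the vectors, that of the first one by
  multilinearity in the elements of the vertex algebra.
\<close>
lemma Wh_tensor_mode_cls: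
  assumes f: "Poly_Mapping.keys f \<subseteq> families vt.M" and h: "Poly_Mapping.keys h \<subseteq> families M"
  obtains y where "Wh_tensor_mode c \<Psi> (vt.W.cls f) n (W.cls h) = W.cls y" "Poly_Mapping.keys y \<subseteq> families M"
    "proj y = vt.lift pm_scale (\<lambda>u. tensor_field (\<lambda>i. F.field_of i (u i)) n (proj h)) f"
proof -
  define f' where "f' = vt.W.rep (vt.W.cls f)"
  define h' where "h' = W.rep (W.cls h)"
  have f': "f' - f \<in> multilin_rel vt.M" and h': "h' - h \<in> multilin_rel M"
    unfolding f'_def h'_def by (rule vt.W.rep_cls, rule W.rep_cls)
  have kf: "Poly_Mapping.keys f' \<subseteq> families vt.M"
    using vt.W.rep_carrier(1)[OF vt.W.cls_in_Q, of f] f by (simp add: vt.carrier_free f'_def)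
  have kh: "Poly_Mapping.keys h' \<subseteq> families M"
    using W.rep_carrier(1)[OF W.cls_in_Q, of h] h by (simp add: carrier_free h'_def)
  define K where "K X Z = {k. (\<Sum>i\<in>UNIV. k i) + int (card (UNIV :: 'n set)) = n + 1 \<and>
                (\<forall>i. Wh_mode c (\<Psi> i) (X i) (k i) (Z i) \<noteq> \<zero>\<^bsub>Wh c (\<Psi> i)\<^esub>)}" for X Z
  define y where "y = (\<Sum>X\<in>Poly_Mapping.keys f'. \<Sum>Z\<in>Poly_Mapping.keys h'. \<Sum>k\<in>K X Z.
     Poly_Mapping.single (\<lambda>i. Wh_mode c (\<Psi> i) (X i) (k i) (Z i)) (Poly_Mapping.lookup f' X * Poly_Mapping.lookup h' Z))"
  have "Wh_tensor_mode c \<Psi> (vt.W.cls f) n (W.cls h) = tensor_class M y"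
    unfolding Wh_tensor_mode_def tensor_mode_def Let_def y_def K_def f'_def h'_def W.rep_def M_Wh ..
  then have "Wh_tensor_mode c \<Psi> (vt.W.cls f) n (W.cls h) = W.cls y" by (simp only: tensor_class_eq)
  moreover have "Poly_Mapping.keys y \<subseteq> families M"
  proof -
    note sub = subspace_keys[of "families M"]
    have "y \<in> {f. Poly_Mapping.keys f \<subseteq> families M}"
      unfolding y_def
    proof (intro pm.subspace_sum[OF sub])
      fix X Z k assume "X \<in> Poly_Mapping.keys f'" "Z \<in> Poly_Mapping.keys h'" "k \<in> K X Z"
      then have "(\<lambda>i. Wh_mode c (\<Psi> i) (X i) (k i) (Z i)) \<in> families M"
        using kf kh unfolding K_def by (intro proj_mode_sum(2)) auto
      then show "Poly_Mapping.single (\<lambda>i. Wh_mode c (\<Psi> i) (X i) (k i) (Z i)) (Poly_Mapping.lookup f' X * Poly_Mapping.lookup h' Z)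
         \<in> {f. Poly_Mapping.keys f \<subseteq> families M}" by simp
    qed
    then show ?thesis by simp
  qed
  moreover have "proj y = vt.lift pm_scale (\<lambda>u. tensor_field (\<lambda>i. F.field_of i (u i)) n (proj h)) f"
  proof -
    let ?Y = "\<lambda>X i. F.field_of i (repf X i)"
    have "proj y = (\<Sum>X\<in>Poly_Mapping.keys f'. \<Sum>Z\<in>Poly_Mapping.keys h'.
        pm_scale (Poly_Mapping.lookup f' X * Poly_Mapping.lookup h' Z) (field_prod (?Y X) n (prs (repf Z))))"
      unfolding y_def proj_lin(5)
    proof (intro sum.cong refl)
      fix X Z assume "X \<in> Poly_Mapping.keys f'" "Z \<in> Poly_Mapping.keys h'"
      then show "(\<Sum>k\<in>K X Z. proj (Poly_Mapping.single (\<lambda>i. Wh_mode c (\<Psi> i) (X i) (k i) (Z i)) (Poly_Mapping.lookup f' X * Poly_Mapping.lookup h' Z)))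
        = pm_scale (Poly_Mapping.lookup f' X * Poly_Mapping.lookup h' Z) (field_prod (?Y X) n (prs (repf Z)))"
        using proj_mode_sum(1)[where X = X and Z = Z and n = n] kf kh unfolding K_def proj_lin(5)[symmetric] by auto
    qed
    also have "\<dots> = (\<Sum>X\<in>Poly_Mapping.keys f'. pm_scale (Poly_Mapping.lookup f' X) (tensor_field (?Y X) n h'))"
      by (simp add: tensor_field_def lift_def lin_ext_def pm.scale_sum_right)
    also have "\<dots> = (\<Sum>X\<in>Poly_Mapping.keys f'. pm_scale (Poly_Mapping.lookup f' X) (tensor_field (?Y X) n (proj h)))"
    proof -
      have "proj h' = proj h" using h' by (simp add: proj_eq_iff)
      then have "tensor_field (?Y X) n h' = tensor_field (?Y X) n (proj h)" for X
        using tensor_field_proj[OF fields_field_of] by metis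
      then show ?thesis by simp
    qed
    also have "\<dots> = vt.lift pm_scale (\<lambda>u. tensor_field (\<lambda>i. F.field_of i (u i)) n (proj h)) f'"
      by (simp add: vt.lift_def lin_ext_def)
    also have "\<dots> = vt.lift pm_scale (\<lambda>u. tensor_field (\<lambda>i. F.field_of i (u i)) n (proj h)) f"
      using vt.lift_multilin_rel[OF vs_pm multilinear_tensor_field_field_of f'] by (simp add: vt.lift_def lin_ext_diff[OF vs_pm])
    finally show ?thesis .
  qed
  ultimately show thesis by (rule that)
qed

lemma tensor_field_vacuum_proj:
  assumes "Poly_Mapping.keys h \<subseteq> families M"
  shows "tensor_field (\<lambda>i. F.vacuum_field) (-1) (proj h) = proj h"
proof -
  have f: "fields (\<lambda>i. F.vacuum_field)" by (simp add: fields_def F.is_field_vacuum)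
  have "tensor_field (\<lambda>i. F.vacuum_field) (-1) h = lin_ext pm_scale (\<lambda>X. pure (repf X)) h"
    unfolding tensor_field_def lift_def using tensor_field_vacuum[of "-1"] tensor_field_pure[OF f, of "-1"] by simp
  also have "\<dots> = lin_ext pm_scale (\<lambda>X. proj (Poly_Mapping.single X 1)) h"
    unfolding lin_ext_def
  proof (rule sum.cong[OF refl])
    fix X assume "X \<in> Poly_Mapping.keys h"
    then show "pm_scale (Poly_Mapping.lookup h X) (pure (repf X)) = pm_scale (Poly_Mapping.lookup h X) (proj (Poly_Mapping.single X 1))"
      using assms clsf_repf[of X] by (auto simp: pure_def)
  qed
  also have "\<dots> = proj (lin_ext pm_scale (\<lambda>X. Poly_Mapping.single X 1) h)"
    by (rule module_hom_lin_ext_comp[OF vs_pm proj(1), symmetric])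
  also have "lin_ext pm_scale (\<lambda>X. Poly_Mapping.single X 1) h = h"
    by (induction h rule: poly_mapping_singles_induct) (simp_all add: lin_ext_single[OF vs_pm] lin_ext_add[OF vs_pm])
  finally show ?thesis by (simp add: tensor_field_proj[OF f])
qed

text \<open>
  A vector in the kernel would be an eigenvector of the locally nilpotent \<open>L(n) - \<Psi>(L(n))\<close> with nonzero
  eigenvalue.
\<close>
lemma shifted_injective:
  assumes x: "x \<in> W_space" "x \<noteq> 0" and n: "0 < n" and \<mu>: "\<mu> \<noteq> \<Psi> j (Lvir n)"
  shows "L_at j n x - pm_scale \<mu> x \<noteq> 0"
proof
  let ?D = "\<lambda>x. L_at j n x - pm_scale (\<Psi> j (Lvir n)) x"
  assume "L_at j n x - pm_scale \<mu> x = 0"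
  then have D: "?D x = pm_scale (\<mu> - \<Psi> j (Lvir n)) x" by (simp add: pm.scale_left_diff_distrib)
  have lin: "?D (pm_scale a x) = pm_scale a (?D x)" for a
    by (simp add: RV.T_scale pm.scale_right_diff_distrib mult.commute)
  have "(?D ^^ N) x = pm_scale ((\<mu> - \<Psi> j (Lvir n)) ^ N) x" for N
  proof (induction N)
    case (Suc N)
    have "(?D ^^ Suc N) x = ?D (pm_scale ((\<mu> - \<Psi> j (Lvir n)) ^ N) x)" using Suc by simp
    then show ?case unfolding lin D by (simp add: mult.commute)
  qed simp
  then show False
    using W_locally_nilpotent[OF x(1) n, of j] x(2) \<mu> by auto
qed


end

locale whittaker_orbifold = whittaker_tensor c \<Psi> for c :: complex and \<Psi> :: "'n::finite \<Rightarrow> vir \<Rightarrow> complex" +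
  fixes G :: "('n \<Rightarrow> 'n) set"
  assumes subgroup_G: "subgroup G (BijGroup UNIV)"
    and separated: "\<lbrakk>g \<in> G; g \<noteq> id\<rbrakk> \<Longrightarrow> \<exists>j n. 0 < n \<and> \<Psi> (g j) (Lvir n) \<noteq> \<Psi> j (Lvir n)"
begin

lemma G_bij: "g \<in> G \<Longrightarrow> bij g"
  using subgroup.subset[OF subgroup_G] by (auto simp: BijGroup_def Bij_def)

lemma G_id: "id \<in> G"
  using subgroup.one_closed[OF subgroup_G] by (simp add: BijGroup_def id_def restrict_def)

lemma G_comp:
  assumes "h \<in> G" "g \<in> G" shows "h \<circ> g \<in> G"
proof -
  have "h \<in> Bij UNIV" "g \<in> Bij UNIV" using subgroup.subset[OF subgroup_G] assms by (auto simp: BijGroup_def)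
  then show ?thesis
    using subgroup.m_closed[OF subgroup_G assms] by (simp add: BijGroup_def compose_def o_def restrict_def)
qed

lemma finite_G: "finite G"
  by (rule finite)

lemma G_inj_on: "h \<in> G \<Longrightarrow> inj_on (\<lambda>g. h \<circ> g) A"
  using bij_is_inj[OF G_bij] by (intro inj_onI ext) (metis comp_apply injD)

lemma G_translate: "h \<in> G \<Longrightarrow> (\<lambda>g. h \<circ> g) ` G = G"
proof (rule endo_inj_surj[OF finite_G])
  assume h: "h \<in> G"
  then show "(\<lambda>g. h \<circ> g) ` G \<subseteq> G" using G_comp by auto
  show "inj_on (\<lambda>g. h \<circ> g) G"
    by (rule G_inj_on[OF h])
qed

definition orbit_sum :: "('n \<Rightarrow> vir_basis list) \<Rightarrow> ('n \<Rightarrow> uvir set) \<Rightarrow>\<^sub>0 complex" where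
  "orbit_sum X = (\<Sum>g\<in>G. Poly_Mapping.single (vt.clsf (\<lambda>i. u_word (X (inv_into UNIV g i)))) 1)"

lemma orbit_sum_carrier: "Poly_Mapping.keys (orbit_sum X) \<subseteq> families vt.M"
proof -
  have "orbit_sum X \<in> {f. Poly_Mapping.keys f \<subseteq> families vt.M}"
    unfolding orbit_sum_def by (intro pm.subspace_sum[OF subspace_keys]) (simp add: vt.clsf_families)
  then show ?thesis by simp
qed

text \<open>
  Permuting the factors maps generators of the multilinear relations to generators, as all factors are the same
  module.
\<close>
lemma perm_action_cls:
  assumes h: "bij h"
  shows "perm_action vt.M h (vt.W.cls f)
    = vt.W.cls (lin_ext pm_scale (\<lambda>X. Poly_Mapping.single (X \<circ> inv_into UNIV h) 1) f)"
proof -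
  let ?P = "lin_ext pm_scale (\<lambda>X. Poly_Mapping.single (X \<circ> inv_into UNIV h) 1)"
  define f' where "f' = vt.W.rep (vt.W.cls f)"
  have f': "f' - f \<in> multilin_rel vt.M" unfolding f'_def by (rule vt.W.rep_cls)
  have "perm_action vt.M h (vt.W.cls f) = tensor_class vt.M (?P f')"
    unfolding perm_action_def Let_def f'_def vt.W.rep_def lin_ext_def by simp
  then have "perm_action vt.M h (vt.W.cls f) = vt.W.cls (?P f')" by (simp only: vt.tensor_class_eq)
  also have "\<dots> = vt.W.cls (?P f)"
  proof -
    have upd: "(X(i := t)) \<circ> inv_into UNIV h = (X \<circ> inv_into UNIV h)(h i := t)" for X :: "'n \<Rightarrow> uvir set" and i t
      using bij_inv_eq_iff[OF h] by (auto simp: fun_eq_iff bij_is_surj[OF h] bij_is_inj[OF h])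
    have "lin_ext pm_scale (\<lambda>X. vt.proj (Poly_Mapping.single (X \<circ> inv_into UNIV h) 1)) (f' - f) = 0"
    proof (rule lin_ext_multilin_rel[OF vs_pm _ f'])
      fix X i y z a b assume X: "X \<in> families vt.M" and yz: "y \<in> carrier (vt.M i)" "z \<in> carrier (vt.M i)"
      let ?X = "X \<circ> inv_into UNIV h"
      have M: "vt.M i = vt.M (h i)" by (simp add: vt.M_def)
      have X': "?X \<in> families vt.M" using X by (simp add: families_def vt.M_def)
      have rel: "vt.proj (Poly_Mapping.single (?X(h i := a \<odot>\<^bsub>vt.M i\<^esub> y \<oplus>\<^bsub>vt.M i\<^esub> b \<odot>\<^bsub>vt.M i\<^esub> z)) 1
          - Poly_Mapping.single (?X(h i := y)) a - Poly_Mapping.single (?X(h i := z)) b) = 0"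
        using multilin_rel_gen[OF X', of y "h i" z a b] yz unfolding M vt.proj(2) .
      have sc: "vt.proj (Poly_Mapping.single (?X(h i := t)) q) = pm_scale q (vt.proj (Poly_Mapping.single (?X(h i := t)) 1))" for t q
        by (simp add: vt.proj_lin(2)[symmetric])
      show "vt.proj (Poly_Mapping.single ((X(i := a \<odot>\<^bsub>vt.M i\<^esub> y \<oplus>\<^bsub>vt.M i\<^esub> b \<odot>\<^bsub>vt.M i\<^esub> z)) \<circ> inv_into UNIV h) 1)
        = pm_scale a (vt.proj (Poly_Mapping.single ((X(i := y)) \<circ> inv_into UNIV h) 1))
        + pm_scale b (vt.proj (Poly_Mapping.single ((X(i := z)) \<circ> inv_into UNIV h) 1))"
        using rel unfolding upd vt.proj_lin(3) sc[of y a] sc[of z b] by (simp only: diff_diff_eq right_minus_eq)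
    qed
    then have "vt.proj (?P (f' - f)) = 0"
      by (simp add: module_hom_lin_ext_comp[OF vs_pm vt.proj(1)])
    then show ?thesis
      by (simp add: vt.W.cls_eq_iff vt.proj lin_ext_diff[OF vs_pm])
  qed
  finally show ?thesis .
qed

lemma orbit_sum_fixed: "vt.W.cls (orbit_sum X) \<in> Virc_tensor_fixed c G"
proof -
  have "perm_action vt.M h (vt.W.cls (orbit_sum X)) = vt.W.cls (orbit_sum X)" if h: "h \<in> G" for h
  proof -
    let ?s = "\<lambda>g. Poly_Mapping.single (vt.clsf (\<lambda>i. u_word (X (inv_into UNIV g i)))) (1::complex)"
    have "lin_ext pm_scale (\<lambda>X. Poly_Mapping.single (X \<circ> inv_into UNIV h) 1) (orbit_sum X) = (\<Sum>g\<in>G. ?s (h \<circ> g))"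
      unfolding orbit_sum_def lin_ext_sum[OF vs_pm]
    proof (rule sum.cong[OF refl])
      fix g assume g: "g \<in> G"
      have "inv_into UNIV (h \<circ> g) = inv_into UNIV g \<circ> inv_into UNIV h"
        by (rule o_inv_distrib) (use G_bij g h in auto)
      then show "lin_ext pm_scale (\<lambda>X. Poly_Mapping.single (X \<circ> inv_into UNIV h) 1) (?s g) = ?s (h \<circ> g)"
        by (simp add: lin_ext_single[OF vs_pm] vt.clsf_def o_def)
    qed
    also have "\<dots> = (\<Sum>g\<in>(\<lambda>g. h \<circ> g) ` G. ?s g)"
      by (subst sum.reindex[OF G_inj_on[OF h]]) simp
    also have "\<dots> = orbit_sum X" by (simp only: G_translate[OF h] orbit_sum_def)
    finally show ?thesis by (simp only: perm_action_cls[OF G_bij[OF h]])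
  qed
  then show ?thesis
    unfolding Virc_tensor_fixed_def Virc_tensor_def vt_M_Virc[symmetric] vt.tensor_module_eq
    using orbit_sum_carrier by (auto intro!: vt.W.cls_in_Q simp: vt.carrier_free)
qed

lemma orbit_sum_mode:
  assumes h: "Poly_Mapping.keys h \<subseteq> families M"
  obtains y where "Wh_tensor_mode c \<Psi> (vt.W.cls (orbit_sum X)) n (W.cls h) = W.cls y" "Poly_Mapping.keys y \<subseteq> families M"
    "proj y = (\<Sum>g\<in>G. tensor_field (\<lambda>i. F.word_field i (X (inv_into UNIV g i))) n (proj h))"
proof -
  obtain y where y: "Wh_tensor_mode c \<Psi> (vt.W.cls (orbit_sum X)) n (W.cls h) = W.cls y" "Poly_Mapping.keys y \<subseteq> families M"
    "proj y = vt.lift pm_scale (\<lambda>u. tensor_field (\<lambda>i. F.field_of i (u i)) n (proj h)) (orbit_sum X)"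
    using Wh_tensor_mode_cls[OF orbit_sum_carrier h] by blast
  note y(3)
  also have "vt.lift pm_scale (\<lambda>u. tensor_field (\<lambda>i. F.field_of i (u i)) n (proj h)) (orbit_sum X)
     = (\<Sum>g\<in>G. tensor_field (\<lambda>i. F.field_of i (u_word (X (inv_into UNIV g i)))) n (proj h))"
    unfolding orbit_sum_def module_hom.sum[OF vt.module_hom_lift[OF vs_pm]]
      vt.lift_clsf[OF vs_pm multilinear_tensor_field_field_of] by simp
  finally have "proj y = (\<Sum>g\<in>G. tensor_field (\<lambda>i. F.word_field i (X (inv_into UNIV g i))) n (proj h))"
    unfolding F.field_of_word .
  with y(1,2) show thesis by (rule that)
qed

end

section \<open>The diagonal submodule and the irreducibility over the orbifold\<close>

lemma sum_fun_apply: "(sum f A) x = (\<Sum>a\<in>A. f a x)"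
  by (induction A rule: infinite_finite_induct) auto

context whittaker_orbifold
begin

definition family_scale :: "complex \<Rightarrow> (('n \<Rightarrow> 'n) \<Rightarrow> ('n \<Rightarrow> uvir set) \<Rightarrow>\<^sub>0 complex) \<Rightarrow> _" where
  "family_scale a F = (\<lambda>g. pm_scale a (F g))"

text \<open>
  The direct sum of the twists of \<open>W\<close>: the \<open>i\<close>-th copy of Vir acts on the component \<open>g\<close> as the copy number
  \<open>g i\<close>.
\<close>
definition family_L :: "'n \<Rightarrow> int \<Rightarrow> (('n \<Rightarrow> 'n) \<Rightarrow> ('n \<Rightarrow> uvir set) \<Rightarrow>\<^sub>0 complex) \<Rightarrow> _" where
  "family_L i k F = (\<lambda>g. if g \<in> G then L_at (g i) k (F g) else 0)"

text \<open>
  Moving the \<open>i\<close>-th factor to position \<open>g i\<close> puts the word \<open>X (inv g i)\<close> into position \<open>i\<close>.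
\<close>
definition twisted :: "('n \<Rightarrow> vir_basis list) \<Rightarrow> ('n \<Rightarrow> 'n) \<Rightarrow> 'n \<Rightarrow> int \<Rightarrow> uvir \<Rightarrow> uvir" where
  "twisted X g = (\<lambda>i. F.word_field i (X (inv_into UNIV g i)))"

definition family_field :: "('n \<Rightarrow> vir_basis list) \<Rightarrow> int \<Rightarrow> (('n \<Rightarrow> 'n) \<Rightarrow> ('n \<Rightarrow> uvir set) \<Rightarrow>\<^sub>0 complex) \<Rightarrow> _" where
  "family_field X n F = (\<lambda>g. if g \<in> G then tensor_field (twisted X g) n (F g) else 0)"

lemma family_scale_apply [simp]: "family_scale a F g = pm_scale a (F g)"
  by (simp add: family_scale_def)

lemma vector_space_family_scale: "vector_space family_scale"
  by (intro vector_space.intro) (auto simp: fun_eq_iff pm.scale_right_distrib pm.scale_left_distrib)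

lemma fields_twisted: "fields (twisted X g)"
  by (simp add: fields_def twisted_def F.is_field_word)

text \<open>
  There are finitely many permutations, so a bound can be chosen uniformly in \<open>g\<close>.
\<close>
lemma bounded_on_G:
  fixes P :: "('n \<Rightarrow> 'n) \<Rightarrow> int \<Rightarrow> bool"
  assumes "\<And>g. \<exists>N. \<forall>n\<ge>N. P g n" shows "\<exists>N. \<forall>n\<ge>N. \<forall>g. P g n"
proof -
  obtain N where N: "\<And>g n. N g \<le> n \<Longrightarrow> P g n" using assms by metis
  have "P g n" if "Max (range N) \<le> n" for g n
  proof (rule N)
    have "N g \<le> Max (range N)" by (rule Max_ge) auto
    then show "N g \<le> n" using that by simp
  qed
  then show ?thesis by blast
qed

lemma restricted_operators_family_L: "restricted_operators family_scale (family_L i)"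
proof (intro restricted_operators.intro restricted_operators_axioms.intro vector_space_family_scale)
  show "module_hom family_scale family_scale (family_L i k)" for k
    using vector_space_family_scale
    by (intro module_hom.intro module_hom_axioms.intro)
      (auto simp: module_iff_vector_space family_L_def fun_eq_iff RV.T_add RV.T_scale)
  show "\<exists>N. \<forall>n\<ge>N. family_L i n F = 0" for F
  proof -
    obtain N where "\<forall>n\<ge>N. \<forall>g. L_at (g i) n (F g) = 0"
      using bounded_on_G[of "\<lambda>g n. L_at (g i) n (F g) = 0"] L_at_restricted by blast
    then have "\<forall>n\<ge>N. family_L i n F = 0" by (simp add: family_L_def fun_eq_iff)
    then show ?thesis by blast
  qed
qed

lemma family_field_zero: "family_field X n 0 = 0"
  by (auto simp: family_field_def fun_eq_iff module_hom.zero[OF tensor_field_hom])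

lemma family_field_annihilated: "\<exists>N. \<forall>n\<ge>N. family_field X n F = 0"
proof -
  obtain N where "\<forall>n\<ge>N. \<forall>g. tensor_field (twisted X g) n (F g) = 0"
    using bounded_on_G[of "\<lambda>g n. tensor_field (twisted X g) n (F g) = 0"] tensor_field_annihilated[OF fields_twisted] by blast
  then have "\<forall>n\<ge>N. family_field X n F = 0" by (simp add: family_field_def fun_eq_iff)
  then show ?thesis by blast
qed

text \<open>
  The family of fields \<open>g \<mapsto> g v\<close> is compatible with the twisted action: \<open>L(k)\<close> in the factor \<open>i\<close> of \<open>v\<close> becomes \<open>L(k)\<close>
  in the factor \<open>g i\<close> of \<open>g v\<close>.
\<close>
lemma iterate_family_field:
  "restricted_operators.iterate family_scale (family_L i) k (family_field X) n F = family_field (X(i := Lgen k # X i)) n F"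
proof
  fix g
  interpret D: restricted_operators family_scale "family_L i" by (rule restricted_operators_family_L)
  define t where "t a = family_scale (sbinom (k + 1) a)
     (family_L i (k - int a) (family_field X (n + int a) F)
      - family_scale ((-1) powi (k + 1)) (family_field X (k + 1 + n - int a) (family_L i (int a - 1) F)))" for a
  obtain A where A: "\<And>a. n + int A \<le> a \<Longrightarrow> family_field X a F = 0"
    using D.annihilated_bound[of "family_field X" F] family_field_annihilated[of X F] D.annihilated_def by metis
  obtain K where K: "\<And>a. K \<le> a \<Longrightarrow> family_L i (int a - 1) F = 0" using D.T_bound by blast
  have t0: "t a = 0" if "max A K \<le> a" for a
    using that by (simp add: t_def A K family_field_zero)
  have "D.iterate k (family_field X) n F = (\<Sum>a<max A K. t a)"
    unfolding D.iterate_def t_def[symmetric] by (rule Sum_any_lessThan) (rule t0)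
  then have l: "D.iterate k (family_field X) n F g = (\<Sum>a<max A K. t a g)" by (simp add: sum_fun_apply)
  show "D.iterate k (family_field X) n F g = family_field (X(i := Lgen k # X i)) n F g"
  proof (cases "g \<in> G")
    case True
    have ta: "t a g = pm_scale (sbinom (k + 1) a)
     (L_at (g i) (k - int a) (tensor_field (twisted X g) (n + int a) (F g))
      - pm_scale ((-1) powi (k + 1)) (tensor_field (twisted X g) (k + 1 + n - int a) (L_at (g i) (int a - 1) (F g))))" for a
      using True by (simp add: t_def family_L_def family_field_def)
    have "RV.iterate (g i) k (tensor_field (twisted X g)) n (F g) = (\<Sum>a<max A K. t a g)"
      unfolding RV.iterate_def ta[symmetric] by (rule Sum_any_lessThan) (simp add: t0)
    moreover have "twisted (X(i := Lgen k # X i)) g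
        = (twisted X g)(g i := F.iterate (g i) k (twisted X g (g i)))"
    proof
      fix j
      have "inv_into UNIV g (g i) = i" using bij_is_inj[OF G_bij[OF True]] by simp
      moreover have "inv_into UNIV g j = i \<longleftrightarrow> j = g i" using bij_inv_eq_iff[OF G_bij[OF True]] by metis
      ultimately show "twisted (X(i := Lgen k # X i)) g j = ((twisted X g)(g i := F.iterate (g i) k (twisted X g (g i)))) j"
        by (simp add: twisted_def F.letter_field_def)
    qed
    ultimately show ?thesis
      using True l by (simp add: family_field_def tensor_field_iterate[OF fields_twisted])
  next
    case False
    then have "t a g = 0" for a by (simp add: t_def family_L_def family_field_def)
    then show ?thesis using False l by (simp add: family_field_def)
  qed
qed

text \<open>
  The submodule generated by the constant family \<open>x\<close> in the direct sum of the twists, although its definition involves single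
  modes only.
\<close>
definition diagonal_span :: "(('n \<Rightarrow> uvir set) \<Rightarrow>\<^sub>0 complex) \<Rightarrow> (('n \<Rightarrow> 'n) \<Rightarrow> ('n \<Rightarrow> uvir set) \<Rightarrow>\<^sub>0 complex) set" where
  "diagonal_span x = module.span family_scale {family_field X n (\<lambda>_. x) |X n. True}"

lemma subspace_diagonal_span: "module.subspace family_scale (diagonal_span x)"
proof -
  interpret D: vector_space family_scale by (rule vector_space_family_scale)
  show ?thesis by (simp add: diagonal_span_def D.subspace_span)
qed

text \<open>
  Weak associativity for the families of fields.
\<close>
lemma diagonal_span_family_L:
  assumes "F \<in> diagonal_span x" shows "family_L i k F \<in> diagonal_span x"
proof -
  interpret D: restricted_operators family_scale "family_L i" by (rule restricted_operators_family_L)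
  show ?thesis
    using assms unfolding diagonal_span_def[of x]
  proof (induction rule: D.span_induct)
    case base
    show ?case
      using module_hom.subspace_vimage[OF D.T_hom[of k] D.subspace_span[of "{family_field X n (\<lambda>_. x) |X n. True}"]] unfolding vimage_def .
  next
    case (step F)
    then obtain X n where F: "F = family_field X n (\<lambda>_. x)" by blast
    show ?case unfolding F
    proof (rule D.operator_mode_in_iterates[OF D.subspace_span, where Y = "family_field X" and x = "\<lambda>_. x" and m = n])
      show "D.iterate k (family_field X) m (\<lambda>_. x) \<in> D.span {family_field X n (\<lambda>_. x) |X n. True}" for k m
        unfolding iterate_family_field by (rule D.span_base) blast
      show "D.annihilated (family_field X) (\<lambda>_. x)" using family_field_annihilated by (simp add: D.annihilated_def)
    qed (rule family_field_zero)
  qed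
qed

lemma diagonal_span_W_space:
  assumes "F \<in> diagonal_span x" "g \<in> G" shows "F g \<in> W_space"
proof -
  interpret D: vector_space family_scale by (rule vector_space_family_scale)
  show ?thesis using assms(1) unfolding diagonal_span_def
  proof (induction rule: D.span_induct)
    case base
    show ?case
      by (auto simp: D.subspace_def pm.subspace_0[OF subspace_module_space] pm.subspace_add[OF subspace_module_space]
          pm.subspace_scale[OF subspace_module_space])
  next
    case (step F)
    then show ?case using assms(2) by (auto simp: family_field_def tensor_field_W_space)
  qed
qed

text \<open>
  The components at \<open>g \<noteq> 1\<close> are killed one after the other. The operator chosen for \<open>g\<close> has eigenvalue 0 on the
  component \<open>g\<close> in the generalized sense, is injective on the component at the identity, and keeps components that
  are already zero.
\<close>
lemma diagonal_span_isolate: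
  assumes h: "Poly_Mapping.keys h \<subseteq> families M" and x: "proj h \<noteq> 0"
  shows "\<exists>F\<in>diagonal_span (proj h). F id \<noteq> 0 \<and> (\<forall>g\<in>G - {id}. F g = 0)"
proof -
  interpret D: vector_space family_scale by (rule vector_space_family_scale)
  let ?S = "diagonal_span (proj h)"
  have "finite A \<Longrightarrow> A \<subseteq> G - {id} \<Longrightarrow> \<exists>F\<in>?S. F id \<noteq> 0 \<and> (\<forall>g\<in>A. F g = 0)" for A
  proof (induction A rule: finite_induct)
    case empty
    have "family_field (\<lambda>_. []) (-1) (\<lambda>_. proj h) \<in> ?S" unfolding diagonal_span_def by (rule D.span_base) blast
    moreover have "family_field (\<lambda>_. []) (-1) (\<lambda>_. proj h) id = proj h"
      using G_id tensor_field_vacuum_proj[OF h] by (simp add: family_field_def twisted_def)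
    ultimately show ?case using x by (metis empty_iff)
  next
    case (insert g A)
    then obtain F where F: "F \<in> ?S" "F id \<noteq> 0" "\<forall>g\<in>A. F g = 0" by blast
    have g: "g \<in> G" "g \<noteq> id" using insert.prems by auto
    obtain j n where jn: "0 < n" "\<Psi> (g j) (Lvir n) \<noteq> \<Psi> j (Lvir n)" using separated[OF g] by blast
    \<comment> \<open>the generalized eigenvalue on the component g, which differs from the one at the identity\<close>
    define \<mu> where "\<mu> = \<Psi> (g j) (Lvir n)"
    define D where "D F = family_L j n F - family_scale \<mu> F" for F
    have DS: "(D ^^ N) F \<in> ?S" for N
    proof (induction N)
      case (Suc N)
      have "family_L j n ((D ^^ N) F) - family_scale \<mu> ((D ^^ N) F) \<in> ?S"
        by (intro D.subspace_diff[OF subspace_diagonal_span] D.subspace_scale[OF subspace_diagonal_span] diagonal_span_family_L Suc)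
      then show ?case unfolding funpow.simps o_apply by (subst D_def)
    qed (simp add: F(1))
    have D_apply: "D F' k = L_at (k j) n (F' k) - pm_scale \<mu> (F' k)" if "k \<in> G" for F' k
      using that by (simp add: D_def family_L_def)
    have D_id: "D F' id = L_at j n (F' id) - pm_scale \<mu> (F' id)" for F'
      using D_apply[OF G_id, of F'] by simp
    have Dg: "((D ^^ N) F) g = ((\<lambda>x. L_at (g j) n x - pm_scale \<mu> x) ^^ N) (F g)" for N
      by (induction N) (simp_all add: D_apply g)
    obtain N where N: "((\<lambda>x. L_at (g j) n x - pm_scale \<mu> x) ^^ N) (F g) = 0"
      using W_locally_nilpotent[OF diagonal_span_W_space[OF F(1) g(1)] jn(1), of "g j"] unfolding \<mu>_def by blast
    have "((D ^^ m) F) k = 0" if "k \<in> A" for k m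
    proof (induction m)
      case 0
      show ?case using F(3) that by simp
    next
      case (Suc m)
      have "k \<in> G" using that insert.prems by auto
      then show ?case using Suc by (simp add: D_apply RV.T_0)
    qed
    moreover have "((D ^^ m) F) id \<noteq> 0" for m
    proof (induction m)
      case (Suc m)
      have "L_at j n (((D ^^ m) F) id) - pm_scale \<mu> (((D ^^ m) F) id) \<noteq> 0"
        using jn(2) by (intro shifted_injective[OF diagonal_span_W_space[OF DS G_id] Suc jn(1)]) (simp add: \<mu>_def)
      then show ?case by (simp only: funpow.simps o_apply D_id not_False_eq_True)
    qed (simp only: funpow_0 F(2) not_False_eq_True)
    moreover have "((D ^^ N) F) g = 0" unfolding Dg N ..
    ultimately show ?case using DS[of N] by blast
  qed
  from this[of "G - {id}"] show ?thesis using finite_G by auto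
qed

lemma W_space_in_diagonal_span:
  assumes h: "Poly_Mapping.keys h \<subseteq> families M" and x: "proj h \<noteq> 0" and y: "y \<in> W_space"
  shows "\<exists>F\<in>diagonal_span (proj h). F id = y \<and> (\<forall>g\<in>G - {id}. F g = 0)"
proof -
  interpret D: vector_space family_scale by (rule vector_space_family_scale)
  let ?S = "diagonal_span (proj h)"
  let ?P = "\<lambda>F. F \<in> ?S \<and> (\<forall>g\<in>G - {id}. F g = 0)"
  \<comment> \<open>the values at the identity form a submodule for all copies of Vir\<close>
  let ?Y = "{F id |F. ?P F}"
  obtain F0 where F0: "?P F0" "F0 id \<noteq> 0" using diagonal_span_isolate[OF h x] by blast
  have "W_space \<subseteq> ?Y"
  proof (rule W_irreducible[of ?Y "F0 id"])
    show "pm.subspace ?Y"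
      unfolding pm.subspace_def
    proof (intro conjI ballI allI impI)
      have "?P 0" using D.subspace_0[OF subspace_diagonal_span] by simp
      then show "0 \<in> ?Y" by (intro CollectI exI[of _ 0]) simp
      fix u v assume "u \<in> ?Y" "v \<in> ?Y"
      then obtain F F' where "?P F" "?P F'" "u = F id" "v = F' id" by auto
      then have "?P (F + F')" "u + v = (F + F') id" using D.subspace_add[OF subspace_diagonal_span] by auto
      then show "u + v \<in> ?Y" by blast
    next
      fix a u assume "u \<in> ?Y"
      then obtain F where "?P F" "u = F id" by auto
      then have "?P (family_scale a F)" "pm_scale a u = family_scale a F id" using D.subspace_scale[OF subspace_diagonal_span] by auto
      then show "pm_scale a u \<in> ?Y" by blast
    qed
    show "L_at i k u \<in> ?Y" if u: "u \<in> ?Y" for i k u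
    proof -
      obtain F where F: "?P F" "u = F id" using u by blast
      have "?P (family_L i k F)" using F(1) diagonal_span_family_L by (auto simp: family_L_def RV.T_0)
      moreover have "L_at i k u = family_L i k F id" using F(2) G_id by (simp add: family_L_def)
      ultimately show ?thesis by blast
    qed
    show "F0 id \<in> ?Y" using F0 by blast
    show "F0 id \<in> W_space" using F0 G_id by (blast intro: diagonal_span_W_space)
  qed (rule F0)
  then show ?thesis using y by blast
qed

text \<open>
  For a submodule \<open>N\<close> with a nonzero vector \<open>x\<close>, summation over \<open>G\<close> maps the diagonal submodule of \<open>x\<close> into \<open>N\<close>,
  because orbit sums are fixed by \<open>G\<close>. By the previous lemma the diagonal submodule contains families that are
  supported at the identity with arbitrary value.
\<close>
theorem irreducible_orbifold: "irreducible_under (Virc_tensor_fixed c G) (Wh_tensor c \<Psi>) (Wh_tensor_mode c \<Psi>)"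
proof -
  interpret D: vector_space family_scale by (rule vector_space_family_scale)
  have WQ: "Wh_tensor c \<Psi> = W.Q" by (simp only: Wh_tensor_def M_Wh[symmetric] tensor_module_eq)
  have cls_zero: "W.cls h = \<zero>\<^bsub>W.Q\<^esub> \<longleftrightarrow> proj h = 0" for h
    by (simp add: W.zero_Q W.cls_eq_iff proj)
  have "W.cls (Poly_Mapping.single (clsf (\<lambda>_. 1)) 1) \<in> carrier W.Q"
    using clsf_families[of "\<lambda>_. 1"] by (intro W.cls_in_Q) (simp add: carrier_free)
  moreover have "W.cls (Poly_Mapping.single (clsf (\<lambda>_. 1)) 1) \<noteq> \<zero>\<^bsub>W.Q\<^esub>"
    using w_nonzero by (simp add: cls_zero w_def pure_def)
  ultimately have nonzero: "carrier W.Q \<noteq> {\<zero>\<^bsub>W.Q\<^esub>}" by blast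
  have "N = {\<zero>\<^bsub>W.Q\<^esub>} \<or> N = carrier W.Q"
    if N: "submodule N complex_field W.Q"
      and stable: "\<forall>v\<in>Virc_tensor_fixed c G. \<forall>n. \<forall>x\<in>N. Wh_tensor_mode c \<Psi> v n x \<in> N" for N
  proof -
    interpret N: submodule N complex_field W.Q by (rule N)
    have N_carrier: "N \<subseteq> carrier W.Q" using N.subset by simp
    have N_zero: "W.cls 0 \<in> N" using N.one_closed by (simp add: W.zero_Q)
    have N_add: "W.cls a \<in> N \<Longrightarrow> W.cls b \<in> N \<Longrightarrow> W.cls (a + b) \<in> N" for a b
      using N.m_closed[of "W.cls a" "W.cls b"] by (simp add: W.add_Q)
    have N_scale: "W.cls a \<in> N \<Longrightarrow> W.cls (pm_scale s a) \<in> N" for a s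
      using N.smult_closed[of s "W.cls a"] by (simp add: W.smult_Q complex_field_def)
    show ?thesis
    proof (cases "N = {\<zero>\<^bsub>W.Q\<^esub>}")
      case False
      then obtain x where "x \<in> N" "x \<noteq> \<zero>\<^bsub>W.Q\<^esub>" using N_zero by (auto simp: W.zero_Q)
      then obtain h where h: "W.cls h \<in> N" "Poly_Mapping.keys h \<subseteq> families M" "proj h \<noteq> 0"
        using N_carrier unfolding W.carrier_Q carrier_free cls_zero[symmetric] by blast
      define N' where "N' = {proj y |y. W.cls y \<in> N}"
      have "pm.subspace N'"
        unfolding pm.subspace_def
      proof (intro conjI ballI allI impI)
        show "0 \<in> N'" using N_zero unfolding N'_def by (metis (mono_tags, lifting) mem_Collect_eq proj_lin(4))
        fix u v assume "u \<in> N'" "v \<in> N'"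
        then obtain a b where "W.cls a \<in> N" "W.cls b \<in> N" "u = proj a" "v = proj b" by (auto simp: N'_def)
        then show "u + v \<in> N'" using N_add[of a b] unfolding N'_def by (auto simp: proj_lin(1)[symmetric])
      next
        fix s u assume "u \<in> N'"
        then obtain a where "W.cls a \<in> N" "u = proj a" by (auto simp: N'_def)
        then show "pm_scale s u \<in> N'" using N_scale[of a s] unfolding N'_def by (auto simp: proj_lin(2)[symmetric])
      qed
      note sub = this
      have sum_N': "(\<Sum>g\<in>G. F g) \<in> N'" if "F \<in> diagonal_span (proj h)" for F
        using that unfolding diagonal_span_def
      proof (induction rule: D.span_induct)
        case base
        show ?case
          by (auto simp: D.subspace_def sum.distrib pm.scale_sum_right[symmetric] pm.subspace_0[OF sub] pm.subspace_add[OF sub]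
              pm.subspace_scale[OF sub])
      next
        case (step F)
        then obtain X n where F: "F = family_field X n (\<lambda>_. proj h)" by blast
        obtain y where y: "Wh_tensor_mode c \<Psi> (vt.W.cls (orbit_sum X)) n (W.cls h) = W.cls y"
          "proj y = (\<Sum>g\<in>G. tensor_field (\<lambda>i. F.word_field i (X (inv_into UNIV g i))) n (proj h))"
          using orbit_sum_mode[OF h(2)] by blast
        have "W.cls y \<in> N" using stable orbit_sum_fixed h(1) y(1) by metis
        moreover have "(\<Sum>g\<in>G. F g) = proj y" unfolding y(2) F by (simp add: family_field_def twisted_def)
        ultimately show ?case unfolding N'_def by blast
      qed
      have "W_space \<subseteq> N'"
      proof
        fix y assume "y \<in> W_space"
        then obtain F where F: "F \<in> diagonal_span (proj h)" "F id = y" "\<forall>g\<in>G - {id}. F g = 0"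
          using W_space_in_diagonal_span[OF h(2,3)] by blast
        have "(\<Sum>g\<in>G. F g) = F id + (\<Sum>g\<in>G - {id}. F g)" by (rule sum.remove[OF finite_G G_id])
        then have "(\<Sum>g\<in>G. F g) = y" using F by simp
        then show "y \<in> N'" using sum_N'[OF F(1)] by simp
      qed
      then have "carrier W.Q \<subseteq> N"
      proof (intro subsetI)
        fix A assume sub: "W_space \<subseteq> N'" and "A \<in> carrier W.Q"
        then obtain f where f: "A = W.cls f" "Poly_Mapping.keys f \<subseteq> families M" by (auto simp: W.carrier_Q carrier_free)
        then have "proj f \<in> N'" using proj_module_space sub by blast
        then obtain y where "proj f = proj y" "W.cls y \<in> N" by (auto simp: N'_def)
        then show "A \<in> N" using f(1) by (simp add: proj_eq_iff_cls)
      qed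
      then show ?thesis using N_carrier by blast
    qed simp
  qed
  then show ?thesis unfolding irreducible_under_def WQ using nonzero by blast
qed

end

theorem theorem8p1:
  fixes c :: complex
    and G :: "('n::finite \<Rightarrow> 'n) set"
    and \<Psi> :: "'n \<Rightarrow> vir \<Rightarrow> complex"
    and a b :: "'n \<Rightarrow> complex"
  assumes G: "subgroup G (BijGroup (UNIV :: 'n set))"
    and whittaker: "\<And>i. whittaker_function (\<Psi> i)"
    and L1: "\<And>i. \<Psi> i (Lvir 1) = a i"
    and L2: "\<And>i. \<Psi> i (Lvir 2) = b i"
    and L3: "\<And>i n. n \<ge> 3 \<Longrightarrow> \<Psi> i (Lvir n) = 0"
    and nontrivial: "\<And>i. \<exists>x\<in>vir_pos. \<Psi> i x \<noteq> 0"
    and distinct: "\<And>g. g \<in> G \<Longrightarrow> g \<noteq> id \<Longrightarrow> (\<lambda>i. a (g i)) \<noteq> a \<or> (\<lambda>i. b (g i)) \<noteq> b"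
  shows "irreducible_under (Virc_tensor_fixed c G) (Wh_tensor c \<Psi>) (Wh_tensor_mode c \<Psi>)"
proof (rule whittaker_orbifold.irreducible_orbifold, intro whittaker_orbifold.intro whittaker_tensor.intro
    whittaker_orbifold_axioms.intro whittaker L3 nontrivial G)
  fix g assume "g \<in> G" "g \<noteq> id"
  then have "(\<exists>j. a (g j) \<noteq> a j) \<or> (\<exists>j. b (g j) \<noteq> b j)" using distinct by (auto simp: fun_eq_iff)
  then show "\<exists>j n. 0 < n \<and> \<Psi> (g j) (Lvir n) \<noteq> \<Psi> j (Lvir n)"
    using L1 L2 by (metis zero_less_numeral zero_less_one)
qed

end
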